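(* Let $\Phi$ be an LWR frame and for $\lambda_0\neq\lambda_1$ in $\mathbb C$ let $f^{\mathbb E}_{(\lambda_0,\lambda_1)}$ and $f^{\mathbb H}_{(\lambda_0,\lambda_1)}$ be the immersions induced by $\Phi$ at the evaluation points $(\lambda_0,\lambda_1)$. The complex associated family of $f^{\mathbb E}_{(\lambda_0,\lambda_1)}$ is obtained by fixing $\lambda_0$ and moving $\lambda_1$: for every $\lambda\in\mathbb C^*$, the member of the family with parameter $\lambda$ is (up to ambient isometry) $f^{\mathbb E}_{(\lambda_0,\ \lambda_0+\lambda(\lambda_1-\lambda_0))}$. The complex associated family of $f^{\mathbb H}_{(\lambda_0,\lambda_1)}$ is obtained by fixing $\lambda_1$ and moving $\lambda_0$: for every $\lambda\in\mathbb C^*$, the member of the family with parameter $\lambda$ is (up to ambient isometry) $f^{\mathbb H}_{(\lambda_1-\lambda(\lambda_1-\lambda_0),\ \lambda_1)}$.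
   Context: Ambient spaces. $\mathcal H_2$: $2\times2$ Hermitian matrices with $\langle x,y\rangle=-\frac12\operatorname{tr}(x\widehat y)$ ($\widehat y$ the adjugate), extended complex-bilinearly. $\mathbb H^3=\{x\in\mathcal H_2:\det x=1,\operatorname{tr}x>0\}$; $\mathbb E^3=T_{\mathrm I}\mathbb H^3$ = trace-free Hermitian matrices, oriented so that $(x,y,-\frac i2[x,y])$ is positive; the orientation is transported to $\mathbb H^3$ by $x\mapsto VxV^*$, $V\in \mathrm{SL}_2\mathbb C$. For a conformal immersion $f$: metric $ds^2=2\langle f_z,f_{\bar z}\rangle|dz|^2$, unit normal $N$ with $(f_x,f_y,N)$ positively oriented orthogonal, Hopf differential $Q\,dz^2$ and mean curvature $H$ defined by $-\langle df,dN\rangle=Q\,dz^2+H\,ds^2+\bar Q\,d\bar z^2$; minimal: $H\equiv 0$ in $\mathbb E^3$; CMC 1: $H\equiv1$ in $\mathbb H^3$. LWR potential: $\xi_\lambda=(A\lambda+B)dz$ locally, with $A,B$ holomorphic in $z$, $\mathrm{sl}_2\mathbb C$-valued, $A$ nilpotent. LWR frame: $\Phi_\lambda$ with values in $\mathrm{SL}_2\mathbb C$, holomorphic in $z$ and in $\lambda\in\mathbb C$, with $\Phi^{-1}d\Phi$ an LWR potential. Induced immersions at $(\lambda_0,\lambda_1)$: $f^{\mathbb E}=\psi+\psi^*$ with $\psi=(\lambda_1-\lambda_0)(\dot\Phi\Phi^{-1})_{\lambda_0}$ (dot $=\partial_\lambda$), minimal in $\mathbb E^3$, and $f^{\mathbb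 H}=\Psi^*\Psi$ with $\Psi=\Phi_{\lambda_1}\Phi_{\lambda_0}^{-1}$, CMC 1 in $\mathbb H^3$ (immersions away from the zeros of $A$). Complex associated family of a minimal or CMC 1 conformal immersion $f$ with metric $ds^2$ and Hopf differential $Q\,dz^2$: the family $(f_\lambda)_{\lambda\in\mathbb C^*}$ of minimal (resp. CMC 1) immersions whose metric and Hopf differential are $ds_\lambda^2=|\lambda|^2ds^2$ and $Q_\lambda dz^2=\lambda Q\,dz^2$; it is defined up to ambient isometries. *)

theory Defs
  imports "HOL-Complex_Analysis.Complex_Analysis"
begin

type_synonym cmat = "complex^2^2"

section \<open>The Hermitian matrix model of the ambient spaces\<close>

definition cscale :: "complex \<Rightarrow> cmat \<Rightarrow> cmat" (infixr "*\<^sub>C" 75) where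
  "c *\<^sub>C M = map_matrix ((*) c) M"

definition ctransp :: "cmat \<Rightarrow> cmat" where
  "ctransp M = map_matrix cnj (transpose M)"

definition adjugate :: "cmat \<Rightarrow> cmat" where
  "adjugate M = vector [vector [M$2$2, - M$1$2], vector [- M$2$1, M$1$1]]"

definition hermitian :: "cmat set" where
  "hermitian = {M. ctransp M = M}"

text \<open>Complex bilinear; on \<^const>\<open>hermitian\<close> it is the real Lorentz form with \<open>ip x x = - det x\<close>.\<close>
definition ip :: "cmat \<Rightarrow> cmat \<Rightarrow> complex" where
  "ip x y = - trace (x ** adjugate y) / 2"

definition SL2 :: "cmat set" where
  "SL2 = {V. det V = 1}"

definition E3 :: "cmat set" where
  "E3 = {x \<in> hermitian. trace x = 0}"

definition H3 :: "cmat set" where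
  "H3 = {x \<in> hermitian. det x = 1 \<and> 0 < Re (trace x)}"

text \<open>A triple \<open>(x, y, w)\<close> in \<open>E3\<close> is positive when it is a basis with the orientation of
  \<open>(a, b, -(\<i>/2) [a, b])\<close>, that is, when \<open>w\<close> has positive inner product with \<open>-(\<i>/2) [x, y]\<close>
  (which is the cross product of \<open>E3\<close>).\<close>
definition positive_E3 :: "cmat \<Rightarrow> cmat \<Rightarrow> cmat \<Rightarrow> bool" where
  "positive_E3 x y w \<longleftrightarrow> x \<in> E3 \<and> y \<in> E3 \<and> w \<in> E3 \<and>
     0 < Re (ip ((- \<i> / 2) *\<^sub>C (x ** y - y ** x)) w)"

text \<open>The same at a point \<open>p\<close> of \<open>H3\<close>: \<open>x \<mapsto> V x V\<^sup>*\<close> carries the identity matrix, whose tangent space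
  is \<open>E3\<close>, to \<open>p = V V\<^sup>*\<close>. In particular a positive triple is tangent to \<open>H3\<close> at \<open>p\<close>.\<close>
definition positive_H3 :: "cmat \<Rightarrow> cmat \<Rightarrow> cmat \<Rightarrow> cmat \<Rightarrow> bool" where
  "positive_H3 p x y w \<longleftrightarrow> (\<exists>V\<in>SL2. \<exists>x' y' w'. positive_E3 x' y' w' \<and> p = V ** ctransp V \<and>
     x = V ** x' ** ctransp V \<and> y = V ** y' ** ctransp V \<and> w = V ** w' ** ctransp V)"

datatype ambient = Euclidean | Hyperbolic

primrec points :: "ambient \<Rightarrow> cmat set" where
  "points Euclidean = E3"
| "points Hyperbolic = H3"

primrec positive :: "ambient \<Rightarrow> cmat \<Rightarrow> cmat \<Rightarrow> cmat \<Rightarrow> cmat \<Rightarrow> bool" where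
  "positive Euclidean p x y w \<longleftrightarrow> positive_E3 x y w"
| "positive Hyperbolic p x y w \<longleftrightarrow> positive_H3 p x y w"

text \<open>Ambient isometries preserve orientation: reversing it changes the unit normal relative to the
  immersion, hence the signs of the Hopf differential and of the mean curvature. The isometries of
  \<open>E3\<close> are affine, those of \<open>H3\<close> are restrictions of linear isometries of the Hermitian
  matrices.\<close>
primrec ambient_isometry :: "ambient \<Rightarrow> (cmat \<Rightarrow> cmat) \<Rightarrow> bool" where
  "ambient_isometry Euclidean T \<longleftrightarrow> (\<exists>L c. linear L \<and> L ` E3 \<subseteq> E3 \<and> c \<in> E3 \<and>
     (\<forall>x\<in>E3. \<forall>y\<in>E3. ip (L x) (L y) = ip x y) \<and>
     (\<forall>x y w. positive_E3 x y w \<longrightarrow> positive_E3 (L x) (L y) (L w)) \<and>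
     (\<forall>x\<in>E3. T x = L x + c))"
| "ambient_isometry Hyperbolic T \<longleftrightarrow> (\<exists>L. linear L \<and> L ` hermitian \<subseteq> hermitian \<and> L ` H3 \<subseteq> H3 \<and>
     (\<forall>x\<in>hermitian. \<forall>y\<in>hermitian. ip (L x) (L y) = ip x y) \<and>
     (\<forall>p x y w. positive_H3 p x y w \<longrightarrow> positive_H3 (L p) (L x) (L y) (L w)) \<and>
     (\<forall>x\<in>H3. T x = L x))"

section \<open>Riemann surfaces\<close>

text \<open>An atlas is a set of local parametrisations \<open>(D, \<zeta>)\<close>, with \<open>\<zeta>\<close> mapping \<open>D \<subseteq> \<complex>\<close> to the surface,
  so that a map \<open>f\<close> on the surface has the coordinate expression \<open>f \<circ> \<zeta>\<close>.\<close>
type_synonym 'a atlas = "(complex set \<times> (complex \<Rightarrow> 'a)) set"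

definition riemann_surface :: "'a topology \<Rightarrow> 'a atlas \<Rightarrow> bool" where
  "riemann_surface X \<A> \<longleftrightarrow>
     Hausdorff_space X \<and> connected_space X \<and>
     (\<forall>(D, \<zeta>)\<in>\<A>. open D \<and> openin X (\<zeta> ` D) \<and>
        homeomorphic_map (top_of_set D) (subtopology X (\<zeta> ` D)) \<zeta>) \<and>
     topspace X = (\<Union>(D, \<zeta>)\<in>\<A>. \<zeta> ` D) \<and>
     (\<forall>(D, \<zeta>)\<in>\<A>. \<forall>(D', \<zeta>')\<in>\<A>. (inv_into D' \<zeta>' \<circ> \<zeta>) holomorphic_on (D \<inter> \<zeta> -` (\<zeta>' ` D')))"

definition restrict_atlas :: "'a atlas \<Rightarrow> 'a set \<Rightarrow> 'a atlas" where
  "restrict_atlas \<A> S = (\<lambda>(D, \<zeta>). (D \<inter> \<zeta> -` S, \<zeta>)) ` \<A>"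

section \<open>Conformal immersions\<close>

text \<open>\<open>differential h z v\<close> is \<open>dh\<^sub>z(v)\<close>; the tangent vectors \<open>1\<close> and \<open>\<i>\<close> give \<open>h\<^sub>x\<close> and \<open>h\<^sub>y\<close>.\<close>
definition differential :: "(complex \<Rightarrow> cmat) \<Rightarrow> complex \<Rightarrow> complex \<Rightarrow> cmat" where
  "differential h z v = vector_derivative (\<lambda>t::real. h (z + of_real t * v)) (at 0)"

definition d_z :: "(complex \<Rightarrow> cmat) \<Rightarrow> complex \<Rightarrow> cmat" where
  "d_z h z = (1/2) *\<^sub>C (differential h z 1 - \<i> *\<^sub>C differential h z \<i>)"

definition d_zbar :: "(complex \<Rightarrow> cmat) \<Rightarrow> complex \<Rightarrow> cmat" where
  "d_zbar h z = (1/2) *\<^sub>C (differential h z 1 + \<i> *\<^sub>C differential h z \<i>)"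

primrec Ck_on :: "nat \<Rightarrow> complex set \<Rightarrow> (complex \<Rightarrow> cmat) \<Rightarrow> bool" where
  "Ck_on 0 D h \<longleftrightarrow> continuous_on D h"
| "Ck_on (Suc k) D h \<longleftrightarrow> h differentiable_on D \<and>
     Ck_on k D (\<lambda>z. differential h z 1) \<and> Ck_on k D (\<lambda>z. differential h z \<i>)"

definition smooth_on :: "complex set \<Rightarrow> (complex \<Rightarrow> cmat) \<Rightarrow> bool" where
  "smooth_on D h \<longleftrightarrow> (\<forall>k. Ck_on k D h)"

text \<open>The factor \<open>2 ip (d_z h) (d_zbar h)\<close> of \<open>|dz|\<^sup>2\<close> in the metric. It is complex-valued only
  because \<^const>\<open>ip\<close> is.\<close>
definition metric :: "(complex \<Rightarrow> cmat) \<Rightarrow> complex \<Rightarrow> complex" where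
  "metric h z = 2 * ip (d_z h z) (d_zbar h z)"

definition conformal_immersion :: "ambient \<Rightarrow> complex set \<Rightarrow> (complex \<Rightarrow> cmat) \<Rightarrow> bool" where
  "conformal_immersion M D h \<longleftrightarrow> smooth_on D h \<and>
     (\<forall>z\<in>D. h z \<in> points M \<and>
        (\<forall>v. differential h z v = 0 \<longrightarrow> v = 0) \<and>
        (\<forall>v. ip (differential h z v) (differential h z v) = metric h z * of_real ((norm v)\<^sup>2)))"

definition unit_normal ::
    "ambient \<Rightarrow> complex set \<Rightarrow> (complex \<Rightarrow> cmat) \<Rightarrow> (complex \<Rightarrow> cmat) \<Rightarrow> bool" where
  "unit_normal M D h N \<longleftrightarrow> (\<forall>z\<in>D. ip (N z) (N z) = 1 \<and>
     ip (differential h z 1) (N z) = 0 \<and> ip (differential h z \<i>) (N z) = 0 \<and>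
     positive M (h z) (differential h z 1) (differential h z \<i>) (N z))"

text \<open>\<open>- \<langle>dh, dN\<rangle> = Q dz\<^sup>2 + H ds\<^sup>2 + cnj Q dzbar\<^sup>2\<close> as quadratic forms in the tangent vector \<open>v\<close>.\<close>
definition has_hopf_and_mean_curvature ::
    "ambient \<Rightarrow> complex set \<Rightarrow> (complex \<Rightarrow> cmat) \<Rightarrow> (complex \<Rightarrow> complex) \<Rightarrow> (complex \<Rightarrow> real) \<Rightarrow> bool" where
  "has_hopf_and_mean_curvature M D h Q H \<longleftrightarrow> (\<exists>N. unit_normal M D h N \<and>
     (\<forall>z\<in>D. \<forall>v. - ip (differential h z v) (differential N z v) =
        Q z * v\<^sup>2 + of_real (H z) * (metric h z * of_real ((norm v)\<^sup>2)) + cnj (Q z) * (cnj v)\<^sup>2))"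

text \<open>The surfaces considered are the minimal ones in \<open>E3\<close> and the CMC 1 ones in \<open>H3\<close>.\<close>
primrec mean_curvature_of :: "ambient \<Rightarrow> real" where
  "mean_curvature_of Euclidean = 0"
| "mean_curvature_of Hyperbolic = 1"

text \<open>\<open>g\<close> is a member with parameter \<open>\<mu>\<close> of the complex associated family of \<open>f\<close>; both are required
  to be minimal, respectively CMC 1, conformal immersions.\<close>
definition associated_member ::
    "ambient \<Rightarrow> 'a atlas \<Rightarrow> ('a \<Rightarrow> cmat) \<Rightarrow> complex \<Rightarrow> ('a \<Rightarrow> cmat) \<Rightarrow> bool" where
  "associated_member M \<A> f \<mu> g \<longleftrightarrow> (\<forall>(D, \<zeta>)\<in>\<A>.
     conformal_immersion M D (f \<circ> \<zeta>) \<and> conformal_immersion M D (g \<circ> \<zeta>) \<and>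
     (\<forall>z\<in>D. metric (g \<circ> \<zeta>) z = of_real ((norm \<mu>)\<^sup>2) * metric (f \<circ> \<zeta>) z) \<and>
     (\<exists>Q. has_hopf_and_mean_curvature M D (f \<circ> \<zeta>) Q (\<lambda>_. mean_curvature_of M) \<and>
          has_hopf_and_mean_curvature M D (g \<circ> \<zeta>) (\<lambda>z. \<mu> * Q z) (\<lambda>_. mean_curvature_of M)))"

section \<open>LWR frames and the induced immersions\<close>

definition holomorphic_matrix_on :: "(complex \<Rightarrow> cmat) \<Rightarrow> complex set \<Rightarrow> bool" where
  "holomorphic_matrix_on F D \<longleftrightarrow> (\<forall>i j. (\<lambda>z. F z $ i $ j) holomorphic_on D)"

definition mderiv :: "(complex \<Rightarrow> cmat) \<Rightarrow> complex \<Rightarrow> cmat" where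
  "mderiv F z = (\<chi> i j. deriv (\<lambda>w. F w $ i $ j) z)"

definition nilpotent :: "cmat \<Rightarrow> bool" where
  "nilpotent A \<longleftrightarrow> (\<exists>n. (((**) A) ^^ n) (mat 1) = 0)"

text \<open>\<open>\<xi> l z\<close> is the coefficient of \<open>dz\<close> at the parameter value \<open>l\<close>.\<close>
definition lwr_potential ::
    "complex set \<Rightarrow> (complex \<Rightarrow> complex \<Rightarrow> cmat) \<Rightarrow> (complex \<Rightarrow> cmat) \<Rightarrow> (complex \<Rightarrow> cmat) \<Rightarrow> bool" where
  "lwr_potential D \<xi> A B \<longleftrightarrow> holomorphic_matrix_on A D \<and> holomorphic_matrix_on B D \<and>
     (\<forall>z\<in>D. trace (A z) = 0 \<and> trace (B z) = 0 \<and> nilpotent (A z) \<and>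
        (\<forall>l. \<xi> l z = l *\<^sub>C A z + B z))"

text \<open>The coefficient of \<open>dz\<close> in \<open>\<Phi>\<^sup>-\<^sup>1 d\<Phi>\<close> in the coordinate \<open>\<zeta>\<close>.\<close>
definition log_derivative ::
    "(complex \<Rightarrow> 'a \<Rightarrow> cmat) \<Rightarrow> (complex \<Rightarrow> 'a) \<Rightarrow> complex \<Rightarrow> complex \<Rightarrow> cmat" where
  "log_derivative \<Phi> \<zeta> l z = matrix_inv (\<Phi> l (\<zeta> z)) ** mderiv (\<Phi> l \<circ> \<zeta>) z"

definition lwr_frame :: "'a atlas \<Rightarrow> (complex \<Rightarrow> 'a \<Rightarrow> cmat) \<Rightarrow> bool" where
  "lwr_frame \<A> \<Phi> \<longleftrightarrow> (\<forall>(D, \<zeta>)\<in>\<A>.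
     (\<forall>z\<in>D. \<forall>l. \<Phi> l (\<zeta> z) \<in> SL2) \<and>
     (\<forall>l. holomorphic_matrix_on (\<Phi> l \<circ> \<zeta>) D) \<and>
     (\<forall>z\<in>D. holomorphic_matrix_on (\<lambda>l. \<Phi> l (\<zeta> z)) UNIV) \<and>
     (\<exists>A B. lwr_potential D (log_derivative \<Phi> \<zeta>) A B))"

text \<open>\<open>A\<close> is determined by the potential, being its value at parameter 1 minus its value at 0; the
  induced immersions live on the complement of the following set.\<close>
definition zeros_of_A :: "'a atlas \<Rightarrow> (complex \<Rightarrow> 'a \<Rightarrow> cmat) \<Rightarrow> 'a set" where
  "zeros_of_A \<A> \<Phi> = {\<zeta> z | D \<zeta> z A B.
     (D, \<zeta>) \<in> \<A> \<and> z \<in> D \<and> lwr_potential D (log_derivative \<Phi> \<zeta>) A B \<and> A z = 0}"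

definition induced_E ::
    "(complex \<Rightarrow> 'a \<Rightarrow> cmat) \<Rightarrow> complex \<Rightarrow> complex \<Rightarrow> 'a \<Rightarrow> cmat" where
  "induced_E \<Phi> l0 l1 p =
     (let \<psi> = (l1 - l0) *\<^sub>C (mderiv (\<lambda>l. \<Phi> l p) l0 ** matrix_inv (\<Phi> l0 p)) in \<psi> + ctransp \<psi>)"

definition induced_H ::
    "(complex \<Rightarrow> 'a \<Rightarrow> cmat) \<Rightarrow> complex \<Rightarrow> complex \<Rightarrow> 'a \<Rightarrow> cmat" where
  "induced_H \<Phi> l0 l1 p =
     (let \<Psi> = \<Phi> l1 p ** matrix_inv (\<Phi> l0 p) in ctransp \<Psi> ** \<Psi>)"

end

theory Submission
  imports Defs
begin

text \<open>Let \<open>\<beta>\<^sub>l = (l1 - l0) \<Phi>\<^sub>l A \<Phi>\<^sub>l\<^sup>-\<^sup>1\<close>. The equation \<open>d\<Phi>\<^sub>l = \<Phi>\<^sub>l (A l + B) dz\<close> gives \<open>d\<psi> = \<beta>\<^sub>l\<^sub>0 dz\<close> for the map \<open>\<psi>\<close>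
  of the Euclidean surface \<open>\<psi> + \<psi>\<^sup>*\<close> and \<open>d\<Psi> = \<beta>\<^sub>l\<^sub>1 \<Psi> dz\<close> for the map \<open>\<Psi>\<close> of the hyperbolic surface \<open>\<Psi>\<^sup>* \<Psi>\<close>. So
  the differential of either surface is \<open>V\<^sup>* (b dz + b\<^sup>* dzbar) V\<close> with a holomorphic null matrix \<open>b\<close>: in \<open>E3\<close> with
  \<open>b = \<beta>\<^sub>l\<^sub>0\<close> and \<open>V = 1\<close>, in \<open>H3\<close> with \<open>b = \<beta>\<^sub>l\<^sub>1\<close> and \<open>V = \<Psi>\<close>. Such a surface has the metric \<open>tr (b b\<^sup>*) |dz|\<^sup>2\<close>, the
  unit normal \<open>V\<^sup>* n V\<close> with \<open>n = (b\<^sup>* b - b b\<^sup>*) / tr (b b\<^sup>*)\<close>, the Hopf differential \<open>\<langle>b', n\<rangle> dz\<^sup>2\<close>, and mean curvature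
  0 or 1 (locale \<open>null_surface\<close>). Moving \<open>l1\<close>, respectively \<open>l0\<close>, as in the theorem multiplies \<open>l1 - l0\<close> by \<open>\<mu>\<close>
  and keeps the frame \<open>\<Phi>\<^sub>l\<close> that occurs in \<open>b\<close>. Thus \<open>b\<close> is multiplied by \<open>\<mu>\<close> and \<open>n\<close> does not change, so that the
  metric is multiplied by \<open>|\<mu>|\<^sup>2\<close> and the Hopf differential by \<open>\<mu>\<close> (\<open>associated_null_surfaces\<close>).

  Conversely, a member of the associated family is determined by its metric, Hopf differential and mean
  curvature up to a motion. This is the uniqueness theorem of Bonnet, proved for both geometries at once in
  the Minkowski space of Hermitian matrices. A surface has there the orthonormal frame of its two
  normalized partial derivatives, the unit normal, and the identity (for \<open>E3\<close>) or the point itself (for \<open>H3\<close>).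
  The connection matrix of the frame depends only on the first and second fundamental forms, so the frames of
  two surfaces with the same data differ locally by a constant Lorentz matrix (\<open>moving_frame_unique\<close>,
  \<open>bonnet_uniqueness\<close>). A motion is determined by its effect on an open piece of a surface
  (\<open>rigid_motion_unique\<close>), and the complement of the zeros of \<open>A\<close> is connected because the zeros are isolated
  or are all of the surface (\<open>regular_connected\<close>). So the local motions are one motion.

  The formula for \<open>d\<psi>\<close> exchanges the derivatives of the frame in \<open>l\<close> and in \<open>z\<close>. As the frame is only
  separately holomorphic, this needs a uniform estimate for its differential equation (\<open>psi_derivative\<close>).\<close>

\<comment> \<open>\<open>$\<close> denotes matrix entries only; the same symbol for coefficients of power series makes longer formulas
  ambiguous in exponentially many ways\<close>
unbundle no Formal_Power_Series.fps_syntax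

section \<open>Two by two matrices\<close>

lemma cmat_eq_iff:
  "(M::cmat) = N \<longleftrightarrow> M$1$1 = N$1$1 \<and> M$1$2 = N$1$2 \<and> M$2$1 = N$2$1 \<and> M$2$2 = N$2$2"
  unfolding vec_eq_iff forall_2 by (simp only: conj_assoc)

lemma cscale_nth: "(c *\<^sub>C M)$i$j = c * M$i$j"
  by (simp add: cscale_def)

lemma ctransp_nth: "ctransp M$i$j = cnj (M$j$i)"
  by (simp add: ctransp_def transpose_def)

lemma adjugate_nth:
  "adjugate M$1$1 = M$2$2" "adjugate M$1$2 = - M$1$2"
  "adjugate M$2$1 = - M$2$1" "adjugate M$2$2 = M$1$1"
  by (simp_all add: adjugate_def)

lemma mult_nth_2: "((X::cmat) ** Y)$i$j = X$i$1 * Y$1$j + X$i$2 * Y$2$j"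
  by (simp add: matrix_matrix_mult_def sum_2)

lemma mat_nth_2:
  "(mat c::cmat)$1$1 = c" "(mat c::cmat)$1$2 = 0" "(mat c::cmat)$2$1 = 0" "(mat c::cmat)$2$2 = c"
  by (simp_all add: mat_def)

lemma trace_2: "trace (M::cmat) = M$1$1 + M$2$2"
  by (simp add: trace_def sum_2)

lemmas cmat_entries = cmat_eq_iff cscale_nth ctransp_nth adjugate_nth mult_nth_2 mat_nth_2 trace_2
  det_2

lemma ip_expand:
  "ip x y = - (x$1$1 * y$2$2 - x$1$2 * y$2$1 - x$2$1 * y$1$2 + x$2$2 * y$1$1) / 2"
  by (simp add: ip_def cmat_entries)

lemma ip_commute: "ip x y = ip y x"
  by (simp add: ip_expand algebra_simps)

lemma ip_self: "ip x x = - det x"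
  by (simp add: ip_expand det_2 field_simps)

lemma adjugate_mult: "adjugate (X ** Y) = adjugate Y ** adjugate X"
  by (simp add: cmat_entries algebra_simps)

lemma mult_adjugate: "X ** adjugate X = mat (det X)" "adjugate X ** X = mat (det X)"
  by (simp_all add: cmat_entries algebra_simps)

lemma det_adjugate: "det (adjugate X) = det X"
  by (simp add: cmat_entries)

lemma det_ctransp: "det (ctransp X) = cnj (det X)"
  by (simp add: cmat_entries)

lemma trace_ctransp: "trace (ctransp X) = cnj (trace X)"
  by (simp add: cmat_entries)

lemma ctransp_mult: "ctransp (X ** Y) = ctransp Y ** ctransp X"
  by (simp add: cmat_entries algebra_simps)

lemma ctransp_ctransp: "ctransp (ctransp X) = X"
  by (simp add: cmat_entries)

lemma ctransp_adjugate: "ctransp (adjugate X) = adjugate (ctransp X)"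
  by (simp add: cmat_entries)

lemma matrix_inv_SL2:
  assumes "det V = 1" shows "matrix_inv V = adjugate V"
proof -
  have V: "V ** adjugate V = mat 1" "adjugate V ** V = mat 1"
    using assms by (simp_all add: mult_adjugate)
  then have inv: "V ** matrix_inv V = mat 1"
    unfolding matrix_inv_def by (metis (mono_tags, lifting) someI_ex)
  have "matrix_inv V = adjugate V ** V ** matrix_inv V"
    using V by simp
  also have "\<dots> = adjugate V"
    using inv by (simp flip: matrix_mul_assoc)
  finally show ?thesis .
qed

lemma hermitian_iff:
  "x \<in> hermitian \<longleftrightarrow> Im (x$1$1) = 0 \<and> Im (x$2$2) = 0 \<and> x$2$1 = cnj (x$1$2)"
  by (auto simp: hermitian_def cmat_entries complex_eq_iff)

section \<open>Hermitian matrices as Minkowski space\<close>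

text \<open>Coordinates in the basis of the three Pauli matrices and the identity. In them the form \<open>ip\<close>
  becomes the Minkowski form \<open>mink\<close>, with the identity as the timelike direction.\<close>

definition coords :: "cmat \<Rightarrow> real^4" where
  "coords x = vector [Re (x$1$2 + x$2$1) / 2, Im (x$2$1 - x$1$2) / 2,
     Re (x$1$1 - x$2$2) / 2, Re (x$1$1 + x$2$2) / 2]"

definition of_coords :: "real^4 \<Rightarrow> cmat" where
  "of_coords u = vector [vector [of_real (u$4 + u$3), Complex (u$1) (- u$2)],
     vector [Complex (u$1) (u$2), of_real (u$4 - u$3)]]"

lemma vector_4:
  "(vector [a,b,c,d] :: ('a::zero)^4)$1 = a"
  "(vector [a,b,c,d] :: ('a::zero)^4)$2 = b"
  "(vector [a,b,c,d] :: ('a::zero)^4)$3 = c"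
  "(vector [a,b,c,d] :: ('a::zero)^4)$4 = d"
  unfolding vector_def by simp_all

lemma vec4_eq_iff: "(u::'a^4) = v \<longleftrightarrow> u$1 = v$1 \<and> u$2 = v$2 \<and> u$3 = v$3 \<and> u$4 = v$4"
  unfolding vec_eq_iff forall_4 by (rule refl)

lemma of_coords_hermitian: "of_coords u \<in> hermitian"
  by (simp add: hermitian_iff of_coords_def complex_eq_iff)

lemma coords_of_coords: "coords (of_coords u) = u"
  by (simp add: coords_def of_coords_def vec4_eq_iff vector_4 complex_eq_iff)

lemma of_coords_coords: "x \<in> hermitian \<Longrightarrow> of_coords (coords x) = x"
  by (simp add: coords_def of_coords_def cmat_eq_iff vector_4 complex_eq_iff hermitian_iff field_simps)

lemma linear_coords: "linear coords"
  by (rule linearI) (simp_all add: coords_def vec4_eq_iff vector_4 algebra_simps add_divide_distrib diff_divide_distrib)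

lemma linear_of_coords: "linear of_coords"
  by (rule linearI) (simp_all add: of_coords_def cmat_eq_iff complex_eq_iff algebra_simps)

definition mink :: "real^4 \<Rightarrow> real^4 \<Rightarrow> real" where
  "mink u v = u$1 * v$1 + u$2 * v$2 + u$3 * v$3 - u$4 * v$4"

lemma ip_hermitian:
  assumes "x \<in> hermitian" "y \<in> hermitian"
  shows "ip x y = of_real (mink (coords x) (coords y))"
  using assms by (simp add: ip_expand hermitian_iff coords_def mink_def vector_4 complex_eq_iff field_simps)

text \<open>On Hermitian matrices this trace has an alternating imaginary part, which is the volume form up
  to a constant (\<open>vol_eq_det\<close>). In this form, with adjugates in the even positions, its invariance under
  \<open>x \<mapsto> V x V\<^sup>*\<close> is evident.\<close>

definition vol :: "cmat \<Rightarrow> cmat \<Rightarrow> cmat \<Rightarrow> cmat \<Rightarrow> real" where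
  "vol p x y w = Im (trace (p ** adjugate x ** y ** adjugate w))"

text \<open>The vectors are the rows, so that a linear change of the frame multiplies on the right, and the
  base point comes last, in the position of the timelike coordinate.\<close>

definition frame_matrix :: "cmat \<Rightarrow> cmat \<Rightarrow> cmat \<Rightarrow> cmat \<Rightarrow> real^4^4" where
  "frame_matrix x y w p = vector [coords x, coords y, coords w, coords p]"

lemma det_4:
  "det (A::real^4^4) =
    A$1$1 * (A$2$2 * (A$3$3 * A$4$4 - A$3$4 * A$4$3) - A$2$3 * (A$3$2 * A$4$4 - A$3$4 * A$4$2)
           + A$2$4 * (A$3$2 * A$4$3 - A$3$3 * A$4$2))
  - A$1$2 * (A$2$1 * (A$3$3 * A$4$4 - A$3$4 * A$4$3) - A$2$3 * (A$3$1 * A$4$4 - A$3$4 * A$4$1)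
           + A$2$4 * (A$3$1 * A$4$3 - A$3$3 * A$4$1))
  + A$1$3 * (A$2$1 * (A$3$2 * A$4$4 - A$3$4 * A$4$2) - A$2$2 * (A$3$1 * A$4$4 - A$3$4 * A$4$1)
           + A$2$4 * (A$3$1 * A$4$2 - A$3$2 * A$4$1))
  - A$1$4 * (A$2$1 * (A$3$2 * A$4$3 - A$3$3 * A$4$2) - A$2$2 * (A$3$1 * A$4$3 - A$3$3 * A$4$1)
           + A$2$3 * (A$3$1 * A$4$2 - A$3$2 * A$4$1))"
proof -
  have f1: "finite {2::4, 3, 4}" "1 \<notin> {2::4, 3, 4}" by auto
  have f2: "finite {3::4, 4}" "2 \<notin> {3::4, 4}" by auto
  have f3: "finite {4::4}" "3 \<notin> {4::4}" by auto
  show ?thesis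
    unfolding det_def UNIV_4
    unfolding sum_over_permutations_insert[OF f1]
    unfolding sum_over_permutations_insert[OF f2]
    unfolding sum_over_permutations_insert[OF f3]
    unfolding permutes_sing
    by (simp add: sign_swap_id permutation_swap_id permutation_compose sign_compose sign_id swap_id_eq; algebra)
qed

lemma vol_eq_det:
  assumes "p \<in> hermitian" "x \<in> hermitian" "y \<in> hermitian" "w \<in> hermitian"
  shows "vol p x y w = 2 * det (frame_matrix x y w p)"
  using assms
  by (simp add: vol_def frame_matrix_def det_4 vector_4 coords_def cmat_entries hermitian_iff field_simps; algebra)

section \<open>Orientation and tangent frames\<close>

lemma det_mult_2: "det (X ** Y) = det X * det (Y::cmat)"
  by (simp add: cmat_entries algebra_simps)

lemma hermitian_congruence:
  "x \<in> hermitian \<Longrightarrow> V ** x ** ctransp V \<in> hermitian"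
  by (simp add: hermitian_def ctransp_mult ctransp_ctransp matrix_mul_assoc)

lemma adjugate_congruence:
  assumes "det V = 1"
  shows "ctransp V ** adjugate (V ** x ** ctransp V) ** V = adjugate x"
proof -
  have "ctransp V ** adjugate (V ** x ** ctransp V) ** V
      = (ctransp V ** adjugate (ctransp V)) ** adjugate x ** (adjugate V ** V)"
    by (simp add: adjugate_mult matrix_mul_assoc)
  also have "\<dots> = adjugate x"
    using assms by (simp add: mult_adjugate det_ctransp)
  finally show ?thesis .
qed

lemma trace_mult_commute: "trace (X ** Y) = trace (Y ** (X::cmat))"
  by (rule trace_mul_sym)

lemma ip_congruence:
  assumes "det V = 1"
  shows "ip (V ** x ** ctransp V) (V ** y ** ctransp V) = ip x y"
proof -
  have "trace (V ** x ** ctransp V ** adjugate (V ** y ** ctransp V))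
      = trace (V ** (x ** ctransp V ** adjugate (V ** y ** ctransp V)))"
    by (simp only: matrix_mul_assoc)
  also have "\<dots> = trace (x ** (ctransp V ** adjugate (V ** y ** ctransp V) ** V))"
    by (subst trace_mult_commute) (simp only: matrix_mul_assoc)
  finally have "trace (V ** x ** ctransp V ** adjugate (V ** y ** ctransp V))
      = trace (x ** (ctransp V ** adjugate (V ** y ** ctransp V) ** V))" .
  then show ?thesis
    using assms by (simp add: ip_def adjugate_congruence)
qed

lemma vol_congruence:
  assumes "det V = 1"
  shows "vol (V ** p ** ctransp V) (V ** x ** ctransp V) (V ** y ** ctransp V) (V ** w ** ctransp V)
    = vol p x y w"
proof -
  have "trace (V ** p ** ctransp V ** adjugate (V ** x ** ctransp V) ** (V ** y ** ctransp V)
        ** adjugate (V ** w ** ctransp V))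
      = trace (V ** (p ** ctransp V ** adjugate (V ** x ** ctransp V) ** (V ** y ** ctransp V)
        ** adjugate (V ** w ** ctransp V)))"
    by (simp only: matrix_mul_assoc)
  also have "\<dots> = trace (p ** (ctransp V ** adjugate (V ** x ** ctransp V) ** V) ** y
        ** (ctransp V ** adjugate (V ** w ** ctransp V) ** V))"
    by (subst trace_mult_commute) (simp only: matrix_mul_assoc)
  finally have "trace (V ** p ** ctransp V ** adjugate (V ** x ** ctransp V) ** (V ** y ** ctransp V)
        ** adjugate (V ** w ** ctransp V)) = \<dots>" .
  then show ?thesis
    using assms by (simp add: vol_def adjugate_congruence)
qed

lemma E3_iff: "x \<in> E3 \<longleftrightarrow> x \<in> hermitian \<and> ip (mat 1) x = 0"
  by (auto simp: E3_def ip_expand cmat_entries neg_eq_iff_add_eq_0 eq_neg_iff_add_eq_0 add.commute)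

lemma positive_E3_iff:
  "positive_E3 x y w \<longleftrightarrow> x \<in> E3 \<and> y \<in> E3 \<and> w \<in> E3 \<and> 0 < vol (mat 1) x y w"
proof -
  have "Re (ip ((- \<i> / 2) *\<^sub>C (x ** y - y ** x)) w) = vol (mat 1) x y w / 2"
    if "x \<in> E3" "y \<in> E3" "w \<in> E3"
  proof -
    have tr: "u$2$2 = - u$1$1" and cj: "u$2$1 = cnj (u$1$2)" and im: "Im (u$1$1) = 0"
      if "u \<in> E3" for u
      using that by (simp_all add: E3_def hermitian_iff trace_2 add_eq_0_iff)
    show ?thesis
      by (simp add: ip_expand vol_def cmat_entries that[THEN tr] that[THEN cj] that[THEN im] field_simps)
  qed
  then show ?thesis
    unfolding positive_E3_def by auto
qed

lemma H3_eq_square: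
  assumes "p \<in> H3"
  shows "\<exists>V\<in>SL2. p = V ** ctransp V"
proof -
  define t where "t = Re (trace p)"
  have p: "p \<in> hermitian" "det p = 1" and t: "0 < t"
    using assms by (auto simp: H3_def t_def)
  have tr: "trace p = of_real t"
    using p(1) by (simp add: t_def cmat_entries hermitian_iff complex_eq_iff)
  define c where "c = complex_of_real (1 / sqrt (t + 2))"
  have cc: "cnj c = c" "c * c * (of_real t + 2) = 1"
  proof -
    show "cnj c = c" by (simp add: c_def)
    have "complex_of_real (1 / sqrt (t + 2) * (1 / sqrt (t + 2)) * (t + 2)) = 1"
      using t by simp
    then show "c * c * (of_real t + 2) = 1"
      unfolding c_def by (metis of_real_add of_real_mult of_real_numeral)
  qed
  \<comment> \<open>the positive square root of \<open>p\<close>, found from the Cayley-Hamilton identity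
    \<open>(p + 1)\<^sup>2 = (tr p + 2) p\<close>\<close>
  define V where "V = c *\<^sub>C (p + mat 1)"
  have V: "ctransp V = V"
    using p(1) by (simp add: V_def hermitian_def cmat_entries cc)
  have sq: "(p + mat 1) ** (p + mat 1) = (of_real t + 2) *\<^sub>C p"
    using p(2) by (simp add: cmat_entries flip: tr) algebra
  have "V ** V = (c * c) *\<^sub>C ((p + mat 1) ** (p + mat 1))"
    by (simp add: V_def cmat_entries algebra_simps)
  also have "\<dots> = (c * c * (of_real t + 2)) *\<^sub>C p"
    unfolding sq by (simp add: cmat_entries algebra_simps)
  finally have "V ** V = p"
    using cc(2) by (simp add: cmat_entries)
  moreover have "det V = 1"
  proof -
    have "det (p + mat 1) = of_real t + 2"
      using p(2) by (simp add: cmat_entries flip: tr) algebra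
    then have "det V = c * c * (of_real t + 2)"
      by (simp add: V_def cmat_entries) algebra
    then show ?thesis using cc by simp
  qed
  ultimately show ?thesis
    using V by (auto simp: SL2_def)
qed

lemma square_in_H3:
  assumes "V \<in> SL2"
  shows "V ** ctransp V \<in> H3"
proof -
  have "det (V ** ctransp V) = 1"
    using assms by (simp add: det_mult_2 det_ctransp SL2_def)
  moreover have "V ** ctransp V \<in> hermitian"
    by (simp add: hermitian_def ctransp_mult ctransp_ctransp)
  moreover have "0 < Re (trace (V ** ctransp V))"
  proof -
    have "Re (trace (V ** ctransp V)) = (cmod (V$1$1))\<^sup>2 + (cmod (V$1$2))\<^sup>2 + (cmod (V$2$1))\<^sup>2 + (cmod (V$2$2))\<^sup>2"
      by (simp add: cmat_entries cmod_power2; simp add: power2_eq_square)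
    moreover have "V$1$1 \<noteq> 0 \<or> V$1$2 \<noteq> 0"
      using assms by (auto simp: SL2_def cmat_entries)
    ultimately show ?thesis
      by (elim disjE) (simp_all add: add_pos_nonneg add_nonneg_pos)
  qed
  ultimately show ?thesis by (simp add: H3_def)
qed

lemma congruence_adjugate:
  assumes "det V = 1"
  shows "V ** (adjugate V ** x ** ctransp (adjugate V)) ** ctransp V = x"
proof -
  have "V ** (adjugate V ** x ** ctransp (adjugate V)) ** ctransp V
      = (V ** adjugate V) ** x ** (adjugate (ctransp V) ** ctransp V)"
    by (simp add: ctransp_adjugate matrix_mul_assoc)
  then show ?thesis
    using assms by (simp add: mult_adjugate det_ctransp)
qed

text \<open>The condition on the existence of \<open>V\<close> becomes a condition on the triple itself: \<open>p = V V\<^sup>*\<close> has a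
  solution by \<open>H3_eq_square\<close>, and the inner product and the volume form do not change when the vectors
  are pulled back to the identity along any such \<open>V\<close>.\<close>

lemma positive_H3_iff:
  "positive_H3 p x y w \<longleftrightarrow> p \<in> H3 \<and> x \<in> hermitian \<and> y \<in> hermitian \<and> w \<in> hermitian \<and>
     ip p x = 0 \<and> ip p y = 0 \<and> ip p w = 0 \<and> 0 < vol p x y w"
proof
  assume "positive_H3 p x y w"
  then obtain V x' y' w' where V: "V \<in> SL2" and pos: "positive_E3 x' y' w'" and p: "p = V ** ctransp V"
    and eq: "x = V ** x' ** ctransp V" "y = V ** y' ** ctransp V" "w = V ** w' ** ctransp V"
    unfolding positive_H3_def by blast
  have d: "det V = 1" using V by (simp add: SL2_def)
  have "p \<in> H3" using p V by (simp add: square_in_H3)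
  then show "p \<in> H3 \<and> x \<in> hermitian \<and> y \<in> hermitian \<and> w \<in> hermitian \<and>
     ip p x = 0 \<and> ip p y = 0 \<and> ip p w = 0 \<and> 0 < vol p x y w"
    using pos ip_congruence[OF d, of "mat 1"] vol_congruence[OF d, of "mat 1"]
    unfolding eq positive_E3_iff E3_iff p by (simp add: hermitian_congruence)
next
  assume *: "p \<in> H3 \<and> x \<in> hermitian \<and> y \<in> hermitian \<and> w \<in> hermitian \<and>
     ip p x = 0 \<and> ip p y = 0 \<and> ip p w = 0 \<and> 0 < vol p x y w"
  then obtain V where V: "V \<in> SL2" and p: "p = V ** ctransp V"
    using H3_eq_square by blast
  have d: "det V = 1" using V by (simp add: SL2_def)
  define pull where "pull x = adjugate V ** x ** ctransp (adjugate V)" for x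
  have push: "V ** pull x ** ctransp V = x" for x
    unfolding pull_def using d by (rule congruence_adjugate)
  have herm: "pull x \<in> hermitian" if "x \<in> hermitian" for x
    unfolding pull_def using that by (rule hermitian_congruence)
  have "ip (mat 1) (pull x) = ip p x" for x
    using ip_congruence[OF d, of "mat 1" "pull x"] unfolding push by (simp add: p)
  moreover have "vol (mat 1) (pull x) (pull y) (pull w) = vol p x y w"
    using vol_congruence[OF d, of "mat 1" "pull x" "pull y" "pull w"] unfolding push by (simp add: p)
  ultimately have "positive_E3 (pull x) (pull y) (pull w)"
    using * herm by (simp add: positive_E3_iff E3_iff)
  then show "positive_H3 p x y w"
    unfolding positive_H3_def by (intro bexI[OF _ V] exI conjI) (assumption | rule p push[symmetric])+
qed

lemma mat_1_in_H3: "mat 1 \<in> H3"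
  by (simp add: H3_def hermitian_iff cmat_entries)

text \<open>\<open>E3\<close> is the tangent space of \<open>H3\<close> at the identity. So in both geometries a tangent vector of the
  ambient space at \<open>x\<close> is orthogonal, in the Minkowski space of Hermitian matrices, to a point of \<open>H3\<close>:
  to the identity or to \<open>x\<close>. This allows one treatment of both.\<close>

primrec base_point :: "ambient \<Rightarrow> cmat \<Rightarrow> cmat" where
  "base_point Euclidean x = mat 1"
| "base_point Hyperbolic x = x"

lemma positive_iff: "positive M p x y w \<longleftrightarrow> positive_H3 (base_point M p) x y w"
proof (cases M)
  case Euclidean
  then show ?thesis
    using mat_1_in_H3
    unfolding Euclidean positive.simps base_point.simps positive_H3_iff positive_E3_iff E3_iff
    by argo
next
  case Hyperbolic
  then show ?thesis by (simp only: positive.simps base_point.simps)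
qed

text \<open>After transport to the identity the form is the sum of the squares of the Pauli coordinates.\<close>

lemma tangent_definite:
  assumes "p \<in> H3" "x \<in> hermitian" "ip p x = 0" "x \<noteq> 0"
  shows "0 < Re (ip x x)"
proof -
  obtain V where V: "V \<in> SL2" and p: "p = V ** ctransp V"
    using assms H3_eq_square by blast
  have d: "det V = 1" using V by (simp add: SL2_def)
  define x' where "x' = adjugate V ** x ** ctransp (adjugate V)"
  have push: "V ** x' ** ctransp V = x"
    unfolding x'_def using d by (rule congruence_adjugate)
  have herm: "x' \<in> hermitian"
    unfolding x'_def using assms(2) by (rule hermitian_congruence)
  have "ip (mat 1) x' = 0"
    using ip_congruence[OF d, of "mat 1" x'] assms(3) unfolding push by (simp add: p)
  then have tr: "x'$2$2 = - x'$1$1" by (simp add: ip_expand cmat_entries eq_neg_iff_add_eq_0 neg_eq_iff_add_eq_0 add.commute)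
  define u where "u = coords x'"
  have u4: "u$4 = 0"
    using tr by (simp add: u_def coords_def vector_4)
  have "u \<noteq> 0"
  proof
    assume "u = 0"
    then have "x' = of_coords 0"
      using of_coords_coords[OF herm] by (simp add: u_def)
    then have "x' = 0"
      by (simp add: linear_0[OF linear_of_coords])
    then have "x = 0"
      unfolding push[symmetric] by (simp only: times0_left times0_right)
    then show False using assms(4) by (rule notE[rotated])
  qed
  then have "(u$1)\<^sup>2 + (u$2)\<^sup>2 + (u$3)\<^sup>2 \<noteq> 0"
    using u4 by (simp add: vec4_eq_iff add_nonneg_eq_0_iff)
  moreover have "0 \<le> (u$1)\<^sup>2 + (u$2)\<^sup>2 + (u$3)\<^sup>2"
    by simp
  moreover have "Re (ip x' x') = (u$1)\<^sup>2 + (u$2)\<^sup>2 + (u$3)\<^sup>2"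
    using u4 by (simp add: ip_hermitian herm mink_def u_def power2_eq_square)
  ultimately have "0 < Re (ip x' x')"
    by linarith
  then show ?thesis
    using ip_congruence[OF d, of x' x'] unfolding push by simp
qed

section \<open>Calculus of matrix functions\<close>

lemma bounded_bilinear_matrix_mult: "bounded_bilinear ((**) :: cmat \<Rightarrow> cmat \<Rightarrow> cmat)"
  by (rule iffD1[OF bilinear_conv_bounded_bilinear])
     (auto simp: bilinear_def linear_iff cmat_entries algebra_simps)

lemma bounded_bilinear_cscale: "bounded_bilinear (*\<^sub>C)"
  by (rule iffD1[OF bilinear_conv_bounded_bilinear])
     (auto simp: bilinear_def linear_iff cmat_entries algebra_simps)

lemma ip_add: "ip (x + x') y = ip x y + ip x' y" "ip y (x + x') = ip y x + ip y x'"
  by (simp_all add: ip_expand field_simps)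

lemma ip_scaleR: "ip (c *\<^sub>R x) y = c *\<^sub>R ip x y" "ip y (c *\<^sub>R x) = c *\<^sub>R ip y x"
proof -
  have s: "(c *\<^sub>R x)$i$j = of_real c * x$i$j" for i j
    by (simp add: scaleR_conv_of_real[where 'a=complex])
  show "ip (c *\<^sub>R x) y = c *\<^sub>R ip x y" "ip y (c *\<^sub>R x) = c *\<^sub>R ip y x"
    by (simp_all only: ip_expand s scaleR_conv_of_real[where 'a=complex]) (simp_all add: field_simps)
qed

lemma bounded_bilinear_ip: "bounded_bilinear ip"
  by (rule iffD1[OF bilinear_conv_bounded_bilinear]) (simp add: bilinear_def linear_iff ip_add ip_scaleR)

lemma bounded_linear_adjugate: "bounded_linear adjugate"
  by (rule iffD1[OF linear_conv_bounded_linear]) (auto simp: linear_iff cmat_entries)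

lemma bounded_linear_ctransp: "bounded_linear ctransp"
  by (rule iffD1[OF linear_conv_bounded_linear]) (auto simp: linear_iff cmat_entries)

lemma norm_cscale: "norm (c *\<^sub>C M) = norm c * norm M"
  by (simp add: cscale_def map_matrix_def norm_vec_def norm_mult L2_set_right_distrib)

lemmas matrix_mult_has_derivative = bounded_bilinear.FDERIV[OF bounded_bilinear_matrix_mult]
lemmas ctransp_has_derivative = bounded_linear.has_derivative[OF bounded_linear_ctransp]
lemmas cscale_has_derivative =
  bounded_linear.has_derivative[OF bounded_bilinear.bounded_linear_right[OF bounded_bilinear_cscale]]
lemmas ip_has_derivative = bounded_bilinear.FDERIV[OF bounded_bilinear_ip]

section \<open>Directional derivatives\<close>

text \<open>The directional derivative agrees with the Frechet derivative where the latter exists, which gives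
  access to the product and chain rules.\<close>

lemma differential_eq:
  assumes "(h has_derivative h') (at z)"
  shows "differential h z v = h' v"
proof -
  have l: "((\<lambda>t::real. z + of_real t * v) has_derivative (\<lambda>t. of_real t * v)) (at 0)"
    by (auto intro!: derivative_eq_intros)
  have "((\<lambda>t::real. h (z + of_real t * v)) has_derivative (\<lambda>t. h' (of_real t * v))) (at 0)"
    by (rule has_derivative_compose[OF l]) (use assms in simp)
  moreover have "h' (of_real t * v) = t *\<^sub>R h' v" for t
    using linear_scale[OF has_derivative_linear[OF assms], of t v] by (simp add: scaleR_conv_of_real)
  ultimately show ?thesis
    unfolding differential_def
    by (intro vector_derivative_at) (simp add: has_vector_derivative_def)
qed

lemma has_derivative_differential:
  assumes "h differentiable (at z)"
  shows "(h has_derivative differential h z) (at z)"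
proof -
  obtain h' where h': "(h has_derivative h') (at z)"
    using assms by (auto simp: differentiable_def)
  moreover have "differential h z = h'"
    using differential_eq[OF h'] by blast
  ultimately show ?thesis by simp
qed

lemma differential_linear:
  assumes "h differentiable (at z)"
  shows "differential h z v = Re v *\<^sub>R differential h z 1 + Im v *\<^sub>R differential h z \<i>"
proof -
  have lin: "linear (differential h z)"
    by (rule has_derivative_linear[OF has_derivative_differential[OF assms]])
  have v: "Re v *\<^sub>R 1 + Im v *\<^sub>R \<i> = v"
    by (simp add: complex_eq_iff)
  have "differential h z (Re v *\<^sub>R 1 + Im v *\<^sub>R \<i>)
      = Re v *\<^sub>R differential h z 1 + Im v *\<^sub>R differential h z \<i>"
    by (simp only: linear_add[OF lin] linear_scale[OF lin])
  then show ?thesis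
    by (simp only: v)
qed

lemma differentiable_cong_open:
  assumes "open D" "z \<in> D" "\<And>w. w \<in> D \<Longrightarrow> h w = k w" "k differentiable (at z)"
  shows "h differentiable (at z)"
proof -
  obtain k' where "(k has_derivative k') (at z)"
    using assms(4) by (auto simp: differentiable_def)
  then have "(h has_derivative k') (at z)"
    by (rule has_derivative_transform_within_open[OF _ assms(1,2)]) (simp add: assms(3))
  then show ?thesis by (auto simp: differentiable_def)
qed

lemma differential_cong_open:
  assumes "open D" "z \<in> D" "\<And>w. w \<in> D \<Longrightarrow> h w = k w" "k differentiable (at z)"
  shows "differential h z v = differential k z v"
proof (rule differential_eq)
  show "(h has_derivative differential k z) (at z)"
    by (rule has_derivative_transform_within_open[OF has_derivative_differential[OF assms(4)] assms(1,2)])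
       (simp add: assms(3))
qed

section \<open>Smooth matrix functions\<close>

lemma differentiable_on_open_iff:
  "open D \<Longrightarrow> h differentiable_on D \<longleftrightarrow> (\<forall>z\<in>D. h differentiable (at z))"
  unfolding differentiable_on_def by (rule ball_cong[OF refl]) (simp only: at_within_open)

lemma Ck_on_cong:
  assumes "open D" "\<And>z. z \<in> D \<Longrightarrow> h z = k z" "Ck_on n D k"
  shows "Ck_on n D h"
  using assms(2,3)
proof (induction n arbitrary: h k)
  case 0
  then show ?case by (simp cong: continuous_on_cong)
next
  case (Suc n)
  have k: "k differentiable (at z)" if "z \<in> D" for z
    using Suc.prems(2) that by (simp add: differentiable_on_open_iff[OF assms(1)])
  have "h differentiable_on D"
    unfolding differentiable_on_open_iff[OF assms(1)]
    using differentiable_cong_open[OF assms(1) _ Suc.prems(1) k] by blast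
  moreover have eq: "differential h z v = differential k z v" if "z \<in> D" for z v
    by (rule differential_cong_open[OF assms(1) that Suc.prems(1) k[OF that]])
  have "Ck_on n D (\<lambda>z. differential h z 1)" "Ck_on n D (\<lambda>z. differential h z \<i>)"
    by (rule Suc.IH[OF eq]; use Suc.prems(2) in simp)+
  ultimately show ?case by simp
qed

lemma Ck_on_Suc_imp:
  assumes "Ck_on (Suc n) D h" shows "Ck_on n D h"
  using assms
proof (induction n arbitrary: h)
  case 0
  then show ?case by (simp add: differentiable_imp_continuous_on)
next
  case (Suc n)
  have h: "h differentiable_on D" "Ck_on (Suc n) D (\<lambda>z. differential h z 1)"
    "Ck_on (Suc n) D (\<lambda>z. differential h z \<i>)"
    using Suc.prems unfolding Ck_on.simps(2)[of "Suc n"] by blast+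
  show ?case
    unfolding Ck_on.simps(2) by (intro conjI Suc.IH h)
qed

text \<open>The derivative may be supplied by any formula; this avoids computing with \<open>differential\<close> in the
  inductions below.\<close>

lemma Ck_on_SucI:
  assumes "open D" "\<And>z. z \<in> D \<Longrightarrow> (h has_derivative h' z) (at z)"
    and "Ck_on n D (\<lambda>z. h' z 1)" "Ck_on n D (\<lambda>z. h' z \<i>)"
  shows "Ck_on (Suc n) D h"
proof -
  have "Ck_on n D (\<lambda>z. differential h z 1)"
    by (rule Ck_on_cong[OF assms(1) _ assms(3)]) (rule differential_eq[OF assms(2)])
  moreover have "Ck_on n D (\<lambda>z. differential h z \<i>)"
    by (rule Ck_on_cong[OF assms(1) _ assms(4)]) (rule differential_eq[OF assms(2)])
  moreover have "h differentiable_on D"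
    using assms(2) unfolding differentiable_on_open_iff[OF assms(1)] differentiable_def by blast
  ultimately show ?thesis by simp
qed

lemma Ck_on_Suc_has_derivative:
  assumes "open D" "Ck_on (Suc n) D h" "z \<in> D"
  shows "(h has_derivative differential h z) (at z)"
  using assms(2,3) by (intro has_derivative_differential) (simp add: differentiable_on_open_iff[OF assms(1)])

lemma Ck_on_add:
  assumes "open D" "Ck_on n D h" "Ck_on n D k"
  shows "Ck_on n D (\<lambda>z. h z + k z)"
  using assms(2,3)
proof (induction n arbitrary: h k)
  case 0
  then show ?case by (simp add: continuous_on_add)
next
  case (Suc n)
  note der = Ck_on_Suc_has_derivative[OF assms(1)]
  show ?case
    by (rule Ck_on_SucI[OF assms(1) has_derivative_add[OF der[OF Suc.prems(1)] der[OF Suc.prems(2)]]])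
       (use Suc in simp_all)
qed

lemma Ck_on_bounded_linear:
  assumes "open D" "bounded_linear L" "Ck_on n D h"
  shows "Ck_on n D (\<lambda>z. L (h z))"
  using assms(3)
proof (induction n arbitrary: h)
  case 0
  then show ?case using assms(2) by (simp add: bounded_linear.continuous_on)
next
  case (Suc n)
  note der = Ck_on_Suc_has_derivative[OF assms(1)]
  show ?case
    by (rule Ck_on_SucI[OF assms(1) bounded_linear.has_derivative[OF assms(2) der[OF Suc.prems]]])
       (use Suc in simp_all)
qed

lemma Ck_on_mult:
  assumes "open D" "Ck_on n D h" "Ck_on n D k"
  shows "Ck_on n D (\<lambda>z. h z ** k z)"
  using assms(2,3)
proof (induction n arbitrary: h k)
  case 0
  then show ?case
    by (simp add: bounded_bilinear.continuous_on[OF bounded_bilinear_matrix_mult])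
next
  case (Suc n)
  note der = Ck_on_Suc_has_derivative[OF assms(1)]
  note lower = Suc.prems[THEN Ck_on_Suc_imp]
  show ?case
    by (rule Ck_on_SucI[OF assms(1) matrix_mult_has_derivative[OF der[OF Suc.prems(1)] der[OF Suc.prems(2)]]])
       (use Suc lower in \<open>simp_all add: Ck_on_add[OF assms(1)]\<close>)
qed

section \<open>Holomorphic matrix functions\<close>

definition matrix_unit :: "2 \<Rightarrow> 2 \<Rightarrow> cmat" where
  "matrix_unit i j = (\<chi> k l. if k = i \<and> l = j then 1 else 0)"

lemma cmat_eq_units:
  "M = M$1$1 *\<^sub>C matrix_unit 1 1 + M$1$2 *\<^sub>C matrix_unit 1 2
     + M$2$1 *\<^sub>C matrix_unit 2 1 + M$2$2 *\<^sub>C matrix_unit 2 2"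
  by (simp add: cmat_entries matrix_unit_def)

lemma cmat_has_derivativeI:
  fixes F :: "complex \<Rightarrow> cmat"
  assumes "\<And>i j. ((\<lambda>z. F z$i$j) has_derivative (\<lambda>v. F' v$i$j)) (at z)"
  shows "(F has_derivative F') (at z)"
proof -
  have l: "((\<lambda>z. F z$i$j *\<^sub>C E) has_derivative (\<lambda>v. F' v$i$j *\<^sub>C E)) (at z)" for i j E
    by (rule bounded_linear.has_derivative[OF bounded_bilinear.bounded_linear_left[OF bounded_bilinear_cscale] assms])
  have "((\<lambda>z. F z$1$1 *\<^sub>C matrix_unit 1 1 + F z$1$2 *\<^sub>C matrix_unit 1 2
     + F z$2$1 *\<^sub>C matrix_unit 2 1 + F z$2$2 *\<^sub>C matrix_unit 2 2) has_derivative
    (\<lambda>v. F' v$1$1 *\<^sub>C matrix_unit 1 1 + F' v$1$2 *\<^sub>C matrix_unit 1 2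
     + F' v$2$1 *\<^sub>C matrix_unit 2 1 + F' v$2$2 *\<^sub>C matrix_unit 2 2)) (at z)"
    by (intro has_derivative_add l)
  then show ?thesis
    unfolding cmat_eq_units[symmetric] .
qed

lemma holomorphic_matrix_has_derivative:
  assumes "open D" "holomorphic_matrix_on F D" "z \<in> D"
  shows "(F has_derivative (\<lambda>v. v *\<^sub>C mderiv F z)) (at z)"
proof (rule cmat_has_derivativeI)
  fix i j
  have "((\<lambda>z. F z$i$j) has_field_derivative deriv (\<lambda>w. F w$i$j) z) (at z)"
    using assms by (intro holomorphic_derivI) (auto simp: holomorphic_matrix_on_def)
  then show "((\<lambda>z. F z$i$j) has_derivative (\<lambda>v. (v *\<^sub>C mderiv F z)$i$j)) (at z)"
    by (simp add: has_field_derivative_def mderiv_def cscale_nth mult_commute_abs)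
qed

lemma cmat_has_derivative_entry:
  fixes F :: "complex \<Rightarrow> cmat"
  assumes "(F has_derivative (\<lambda>v. v *\<^sub>C F')) (at z)"
  shows "((\<lambda>w. F w$i$j) has_field_derivative F'$i$j) (at z)"
proof -
  have "bounded_linear (\<lambda>M::cmat. M$i$j)"
    by (intro bounded_linear_compose[OF bounded_linear_vec_nth] bounded_linear_vec_nth)
  from bounded_linear.has_derivative[OF this assms] show ?thesis
    by (simp add: has_field_derivative_def cscale_nth mult_commute_abs)
qed

lemma mderiv_eq:
  assumes "(F has_derivative (\<lambda>v. v *\<^sub>C F')) (at z)"
  shows "mderiv F z = F'"
  using DERIV_imp_deriv[OF cmat_has_derivative_entry[OF assms]]
  by (simp add: mderiv_def vec_eq_iff)

lemma holomorphic_matrixI: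
  assumes "open D" "\<And>z. z \<in> D \<Longrightarrow> (F has_derivative (\<lambda>v. v *\<^sub>C F' z)) (at z)"
  shows "holomorphic_matrix_on F D"
  unfolding holomorphic_matrix_on_def holomorphic_on_open[OF assms(1)]
  using cmat_has_derivative_entry[OF assms(2)] by blast

lemma holomorphic_mderiv:
  assumes "open D" "holomorphic_matrix_on F D"
  shows "holomorphic_matrix_on (mderiv F) D"
  using assms by (auto simp: holomorphic_matrix_on_def mderiv_def intro: holomorphic_deriv)

text \<open>The partial derivatives of \<open>F\<close> are \<open>F'\<close> and \<open>\<i> F'\<close>, again holomorphic.\<close>

lemma Ck_on_holomorphic:
  assumes "open D" "holomorphic_matrix_on F D"
  shows "Ck_on n D F"
  using assms(2)
proof (induction n arbitrary: F)
  case 0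
  have "continuous (at z) F" if "z \<in> D" for z
    using holomorphic_matrix_has_derivative[OF assms(1) 0 that] by (rule has_derivative_continuous)
  then show ?case by (simp add: continuous_at_imp_continuous_on)
next
  case (Suc n)
  have "Ck_on n D (mderiv F)"
    using holomorphic_mderiv[OF assms(1) Suc.prems] by (rule Suc.IH)
  then have scaled: "Ck_on n D (\<lambda>z. v *\<^sub>C mderiv F z)" for v
    by (rule Ck_on_bounded_linear[OF assms(1) bounded_bilinear.bounded_linear_right[OF bounded_bilinear_cscale]])
  show ?case
    by (rule Ck_on_SucI[OF assms(1) holomorphic_matrix_has_derivative[OF assms(1) Suc.prems] scaled scaled])
qed

section \<open>Lorentz transformations of the Hermitian matrices\<close>

definition eta :: "real^4^4" where
  "eta = (\<chi> i j. if i = j then if i = 4 then -1 else 1 else 0)"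

lemma eta_nth: "eta$i$j = (if i = j then if i = 4 then -1 else 1 else 0)"
  by (simp add: eta_def)

lemma transpose_eta: "transpose eta = eta"
  by (simp add: transpose_def vec_eq_iff eta_nth)

lemma eta_eta: "eta ** eta = mat 1"
  by (simp add: matrix_matrix_mult_def mat_def vec4_eq_iff sum_4 eta_nth)

lemma mult_eta_transpose_nth:
  fixes X Y :: "real^4^4"
  shows "(X ** eta ** transpose Y)$i$j = mink (X$i) (Y$j)"
  by (simp add: matrix_matrix_mult_def transpose_def sum_4 eta_nth mink_def)

text \<open>The action is by row vectors, to agree with \<open>frame_matrix\<close> (see \<open>frame_matrix_act\<close>).\<close>

definition act :: "real^4^4 \<Rightarrow> cmat \<Rightarrow> cmat" where
  "act S x = of_coords (coords x v* S)"

lemma act_hermitian: "act S x \<in> hermitian"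
  by (simp add: act_def of_coords_hermitian)

lemma coords_act: "coords (act S x) = coords x v* S"
  by (simp add: act_def coords_of_coords)

lemma linear_act: "linear (act S)"
proof -
  have "linear (\<lambda>u::real^4. u v* S)"
    by (rule linearI) (simp_all add: vector_matrix_mult_def vec_eq_iff sum.distrib algebra_simps sum_distrib_left)
  then have "linear (of_coords \<circ> ((\<lambda>u. u v* S) \<circ> coords))"
    by (intro linear_compose linear_coords linear_of_coords)
  then show ?thesis
    by (simp add: act_def[abs_def] o_def)
qed

lemma frame_matrix_act:
  "frame_matrix (act S x) (act S y) (act S w) (act S p) = frame_matrix x y w p ** S"
  by (simp add: frame_matrix_def coords_act vec4_eq_iff vector_4 vector_matrix_mult_def matrix_matrix_mult_def
      mult.commute)

definition orthonormal :: "cmat \<Rightarrow> cmat \<Rightarrow> cmat \<Rightarrow> cmat \<Rightarrow> bool" where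
  "orthonormal x y w p \<longleftrightarrow> x \<in> hermitian \<and> y \<in> hermitian \<and> w \<in> hermitian \<and> p \<in> hermitian \<and>
     ip x x = 1 \<and> ip y y = 1 \<and> ip w w = 1 \<and> ip p p = -1 \<and>
     ip x y = 0 \<and> ip x w = 0 \<and> ip y w = 0 \<and> ip p x = 0 \<and> ip p y = 0 \<and> ip p w = 0"

lemma frame_matrix_orthonormal:
  assumes "orthonormal x y w p"
  shows "frame_matrix x y w p ** eta ** transpose (frame_matrix x y w p) = eta"
proof -
  have herm: "x \<in> hermitian" "y \<in> hermitian" "w \<in> hermitian" "p \<in> hermitian"
    using assms by (auto simp: orthonormal_def)
  have m: "mink (coords a) (coords b) = Re (ip a b)" if "a \<in> hermitian" "b \<in> hermitian" for a b
    using ip_hermitian[OF that] by simp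
  have c: "ip a b = ip b a" for a b by (rule ip_commute)
  show ?thesis
    unfolding vec4_eq_iff[where 'a="real^4"] vec4_eq_iff[where 'a=real] mult_eta_transpose_nth
    using assms c[of y x] c[of w x] c[of w y] c[of x p] c[of y p] c[of w p]
    by (simp add: frame_matrix_def vector_4 m herm eta_nth orthonormal_def)
qed

text \<open>The orthonormality relations exhibit a right inverse, which for square matrices is also a left one;
  read in this order they say that the frame spans (\<open>frame_expand\<close>).\<close>

lemma frame_matrix_inverse:
  assumes "orthonormal x y w p"
  shows "eta ** transpose (frame_matrix x y w p) ** eta ** frame_matrix x y w p = mat 1"
proof -
  have "frame_matrix x y w p ** (eta ** transpose (frame_matrix x y w p) ** eta) = mat 1"
    using frame_matrix_orthonormal[OF assms] by (simp add: matrix_mul_assoc eta_eta)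
  then show ?thesis
    by (simp only: matrix_left_right_inverse)
qed

definition lorentz :: "real^4^4 \<Rightarrow> bool" where
  "lorentz S \<longleftrightarrow> S ** eta ** transpose S = eta"

lemma mink_vector_mult:
  assumes "lorentz S" shows "mink (u v* S) (v v* S) = mink u v"
proof -
  define U where "U = (\<chi> (i::4). u)"
  define V where "V = (\<chi> (i::4). v)"
  have row: "(X ** S)$i = X$i v* S" for X :: "real^4^4" and i
    by (simp add: matrix_matrix_mult_def vector_matrix_mult_def vec_eq_iff mult.commute)
  have "(U ** S) ** eta ** transpose (V ** S) = U ** (S ** eta ** transpose S) ** transpose V"
    by (simp add: matrix_transpose_mul matrix_mul_assoc)
  also have "\<dots> = U ** eta ** transpose V"
    using assms by (simp add: lorentz_def)
  finally have "((U ** S) ** eta ** transpose (V ** S))$1$1 = (U ** eta ** transpose V)$1$1"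
    by simp
  then show ?thesis
    unfolding mult_eta_transpose_nth row by (simp add: U_def V_def)
qed

lemma ip_act:
  assumes "lorentz S" "x \<in> hermitian" "y \<in> hermitian"
  shows "ip (act S x) (act S y) = ip x y"
  using assms by (simp add: ip_hermitian act_hermitian coords_act mink_vector_mult)

lemma vol_act:
  assumes "p \<in> hermitian" "x \<in> hermitian" "y \<in> hermitian" "w \<in> hermitian"
  shows "vol (act S p) (act S x) (act S y) (act S w) = det S * vol p x y w"
  using assms by (simp add: vol_eq_det act_hermitian frame_matrix_act det_mul)

lemma H3_hermitian: "p \<in> H3 \<Longrightarrow> p \<in> hermitian"
  by (simp add: H3_def)

lemma H3_ip: "p \<in> H3 \<Longrightarrow> ip p p = -1"
  by (simp add: H3_def ip_self)

lemma H3_ip_negative: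
  assumes "p \<in> H3" "q \<in> H3"
  shows "Re (ip p q) < 0"
proof -
  obtain V W where V: "V \<in> SL2" "p = V ** ctransp V" and W: "W \<in> SL2" "q = W ** ctransp W"
    using assms H3_eq_square by meson
  have d: "det V = 1" using V(1) by (simp add: SL2_def)
  define q' where "q' = adjugate V ** q ** ctransp (adjugate V)"
  have "q' = (adjugate V ** W) ** ctransp (adjugate V ** W)"
    by (simp add: q'_def W(2) ctransp_mult matrix_mul_assoc)
  moreover have "adjugate V ** W \<in> SL2"
    using V(1) W(1) by (simp add: SL2_def det_mult_2 det_adjugate)
  ultimately have "0 < Re (trace q')"
    using square_in_H3 by (simp add: H3_def)
  moreover have "ip p q = ip (mat 1) q'"
    using ip_congruence[OF d, of "mat 1" q'] congruence_adjugate[OF d, of q]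
    by (simp add: q'_def V(2))
  moreover have "ip (mat 1) q' = - trace q' / 2"
    by (simp add: ip_expand cmat_entries)
  ultimately show ?thesis by simp
qed

text \<open>A Hermitian matrix of determinant 1 or its negative lies in \<open>H3\<close>, and since points of \<open>H3\<close> have
  negative inner product with each other, the sign of \<open>ip p x\<close> tells which.\<close>

lemma H3_if_ip_negative:
  assumes "p \<in> H3" "x \<in> hermitian" "det x = 1" "Re (ip p x) < 0"
  shows "x \<in> H3"
proof -
  have e: "Re (x$1$1) * Re (x$2$2) = 1 + (cmod (x$1$2))\<^sup>2"
  proof -
    have "Re (det x) = 1" using assms(3) by simp
    then show ?thesis
      using assms(2) unfolding det_2 hermitian_iff cmod_power2
      by (simp add: power2_eq_square)
  qed
  then have pos: "0 < Re (x$1$1) * Re (x$2$2)"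
    by (smt (verit) zero_le_power2)
  have "- x \<notin> H3"
  proof
    assume "- x \<in> H3"
    then have "Re (ip p (- x)) < 0" using assms(1) by (rule H3_ip_negative[rotated])
    moreover have "ip p (- x) = - ip p x" by (simp add: ip_expand field_simps)
    ultimately show False using assms(4) by simp
  qed
  moreover have "- x \<in> hermitian"
    using assms(2) by (simp add: hermitian_iff)
  moreover have "det (- x) = 1"
    using assms(3) by (simp add: det_2)
  ultimately have "\<not> 0 < Re (trace (- x))"
    by (simp add: H3_def)
  then have "0 \<le> Re (x$1$1) + Re (x$2$2)"
    by (simp add: trace_2)
  then have "0 < Re (x$1$1) + Re (x$2$2)"
    using pos by (smt (verit) mult_nonneg_nonpos mult_nonpos_nonneg)
  then show ?thesis
    using assms by (simp add: H3_def trace_2)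
qed

text \<open>The last condition says that the transformation preserves the direction of time; by
  \<open>H3_if_ip_negative\<close> one point of \<open>H3\<close> decides this for all (\<open>act_H3\<close>).\<close>

definition proper_lorentz :: "real^4^4 \<Rightarrow> bool" where
  "proper_lorentz S \<longleftrightarrow> lorentz S \<and> 0 < det S \<and> (\<exists>p\<in>H3. act S p \<in> H3)"

lemma act_H3:
  assumes "proper_lorentz S" "q \<in> H3"
  shows "act S q \<in> H3"
proof -
  obtain p where p: "p \<in> H3" "act S p \<in> H3" and S: "lorentz S"
    using assms(1) by (auto simp: proper_lorentz_def)
  have "ip (act S q) (act S q) = ip q q"
    using S assms(2) by (simp add: ip_act H3_hermitian)
  then have "det (act S q) = 1"
    using assms(2) by (simp add: ip_self H3_def)
  moreover have "Re (ip (act S p) (act S q)) < 0"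
    using S p(1) assms(2) by (simp add: ip_act H3_hermitian H3_ip_negative)
  ultimately show ?thesis
    using H3_if_ip_negative p(2) act_hermitian by blast
qed

lemma positive_H3_act:
  assumes "proper_lorentz S" "positive_H3 p x y w"
  shows "positive_H3 (act S p) (act S x) (act S y) (act S w)"
  using assms(2) act_H3[OF assms(1)] assms(1)
  by (simp add: positive_H3_iff act_hermitian ip_act vol_act H3_hermitian proper_lorentz_def)

lemma ambient_isometry_hyperbolic:
  assumes "proper_lorentz S"
  shows "ambient_isometry Hyperbolic (act S)"
proof -
  have "lorentz S" using assms by (simp add: proper_lorentz_def)
  then show ?thesis
    unfolding ambient_isometry.simps
    by (intro exI[of _ "act S"]) (auto simp: linear_act act_hermitian act_H3[OF assms] ip_act positive_H3_act[OF assms])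
qed

lemma ambient_isometry_euclidean:
  assumes "proper_lorentz S" "act S (mat 1) = mat 1" "c \<in> E3"
  shows "ambient_isometry Euclidean (\<lambda>x. act S x + c)"
proof -
  have S: "lorentz S" using assms by (simp add: proper_lorentz_def)
  have one: "mat 1 \<in> hermitian" using mat_1_in_H3 by (rule H3_hermitian)
  have E: "act S x \<in> E3" if "x \<in> E3" for x
    using ip_act[OF S one, of x] that assms(2) by (simp add: E3_iff act_hermitian)
  have pos: "positive_E3 (act S x) (act S y) (act S w)" if "positive_E3 x y w" for x y w
    using positive_iff[of Euclidean undefined] positive_H3_act[OF assms(1), of "mat 1" x y w] that assms(2)
    by simp
  show ?thesis
    unfolding ambient_isometry.simps
    using linear_act E assms(3) ip_act[OF S] pos E3_iff
    by (intro exI[of _ "act S"] exI[of _ c]) auto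
qed

lemma frame_expand:
  assumes "orthonormal x y w p" "u \<in> hermitian"
  shows "u = Re (ip u x) *\<^sub>R x + Re (ip u y) *\<^sub>R y + Re (ip u w) *\<^sub>R w - Re (ip u p) *\<^sub>R p"
proof -
  have herm: "x \<in> hermitian" "y \<in> hermitian" "w \<in> hermitian" "p \<in> hermitian"
    using assms by (auto simp: orthonormal_def)
  define E where "E = frame_matrix x y w p"
  define U where "U = coords u v* (eta ** transpose E)"
  have U: "U$i = mink (coords u) (E$i)" for i
    by (simp add: U_def vector_matrix_mult_def matrix_matrix_mult_def transpose_def sum_4 eta_nth mink_def mult.commute)
  have "coords u v* (eta ** transpose E ** eta ** E) = coords u"
    using frame_matrix_inverse[OF assms(1)] by (simp add: E_def)
  then have "coords u = (U v* eta) v* E"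
    by (simp add: U_def vector_matrix_mul_assoc)
  then have "coords u = mink (coords u) (coords x) *\<^sub>R coords x + mink (coords u) (coords y) *\<^sub>R coords y
      + mink (coords u) (coords w) *\<^sub>R coords w - mink (coords u) (coords p) *\<^sub>R coords p"
    by (simp add: vec4_eq_iff[where 'a=real] vector_matrix_mult_def sum_4 eta_nth U E_def frame_matrix_def vector_4 mult.commute)
  also have "\<dots> = coords (Re (ip u x) *\<^sub>R x + Re (ip u y) *\<^sub>R y + Re (ip u w) *\<^sub>R w - Re (ip u p) *\<^sub>R p)"
    using herm assms(2)
    by (simp add: ip_hermitian linear_add[OF linear_coords] linear_diff[OF linear_coords] linear_scale[OF linear_coords])
  finally have "of_coords (coords u) = of_coords (coords (Re (ip u x) *\<^sub>R x + Re (ip u y) *\<^sub>R y + Re (ip u w) *\<^sub>R w - Re (ip u p) *\<^sub>R p))"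
    by simp
  moreover have "Re (ip u x) *\<^sub>R x + Re (ip u y) *\<^sub>R y + Re (ip u w) *\<^sub>R w - Re (ip u p) *\<^sub>R p \<in> hermitian"
    using herm by (simp add: hermitian_iff scaleR_conv_of_real[where 'a=complex])
  ultimately show ?thesis
    using assms(2) by (simp add: of_coords_coords)
qed

section \<open>The unit normal\<close>

lemma clifford: "x ** adjugate y + y ** adjugate x = mat (- 2 * ip x y)"
  "adjugate x ** y + adjugate y ** x = mat (- 2 * ip x y)"
  by (simp_all add: cmat_entries ip_expand algebra_simps)

lemma matrix_mult_minus: "(- X) ** Y = - ((X::cmat) ** (Y::cmat))" "X ** (- Y) = - ((X::cmat) ** (Y::cmat))"
  by (simp_all add: cmat_entries)

lemma mat_mult: "mat c ** X = c *\<^sub>C X" "X ** mat c = c *\<^sub>C X"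
  by (simp_all add: cmat_entries)

lemma cscale_mult: "(c *\<^sub>C X) ** Y = c *\<^sub>C (X ** Y)" "X ** (c *\<^sub>C Y) = c *\<^sub>C (X ** Y)"
  by (simp_all add: cmat_entries algebra_simps)

lemma trace_cscale: "trace (c *\<^sub>C X) = c * trace X"
  by (simp add: cmat_entries algebra_simps)

lemma ip_cscale: "ip (c *\<^sub>C x) y = c * ip x y" "ip x (c *\<^sub>C y) = c * ip x y"
  by (simp_all add: ip_expand cscale_nth algebra_simps)

lemma trace_minus: "trace (- X) = - trace (X::cmat)"
  by (simp add: trace_2)

lemma trace_mult_adjugate: "trace (x ** adjugate y) = - 2 * ip x y"
  by (simp add: ip_def)

lemma adjugate_hermitian: "x \<in> hermitian \<Longrightarrow> ctransp (adjugate x) = adjugate x"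
  by (simp add: hermitian_def ctransp_adjugate)

text \<open>By the Clifford relations the product \<open>q\<close> of \<open>p\<close>, the adjugate of \<open>x\<close>, and \<open>y\<close> is antisymmetric in
  the mutually orthogonal \<open>p\<close>, \<open>x\<close>, \<open>y\<close>. Hence \<open>\<i> q\<close> is Hermitian and orthogonal to all three: it is their
  cross product, of length \<open>m\<close>, and the orientation selects the sign. The formula makes the unit normal of
  a surface unique and as differentiable as the first derivatives.\<close>

lemma unit_normal_formula:
  assumes p: "p \<in> H3" and herm: "x \<in> hermitian" "y \<in> hermitian" "w \<in> hermitian"
    and orth: "ip p x = 0" "ip p y = 0" "ip p w = 0" "ip x y = 0" "ip x w = 0" "ip y w = 0"
    and m: "ip x x = of_real m" "ip y y = of_real m" "0 < m" and w: "ip w w = 1"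
    and pos: "0 < vol p x y w"
  shows "w = (\<i> / of_real m) *\<^sub>C (p ** adjugate x ** y)"
proof -
  define q where "q = p ** adjugate x ** y"
  define n where "n = (\<i> / of_real m) *\<^sub>C q"
  have ph: "p \<in> hermitian" using p by (rule H3_hermitian)
  have zero: "mat 0 = (0::cmat)" by (simp add: cmat_entries)
  have px: "p ** adjugate x = - (x ** adjugate p)" and py: "adjugate p ** y = - (adjugate y ** p)"
    and xy: "x ** adjugate y = - (y ** adjugate x)" and xy': "adjugate x ** y = - (adjugate y ** x)"
    using clifford[of p x] clifford[of p y] clifford[of x y] orth
    by (simp_all add: eq_neg_iff_add_eq_0 zero)
  have "q = - (x ** (adjugate p ** y))"
    by (simp add: q_def px matrix_mult_minus matrix_mul_assoc)
  also have "\<dots> = x ** adjugate y ** p"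
    by (simp add: py matrix_mult_minus matrix_mul_assoc)
  also have "\<dots> = - (y ** adjugate x ** p)"
    by (simp add: xy matrix_mult_minus)
  finally have rev: "y ** adjugate x ** p = - q" by simp
  have "ctransp q = y ** adjugate x ** p"
    using herm ph adjugate_hermitian[OF herm(1)]
    by (simp add: q_def ctransp_mult matrix_mul_assoc hermitian_def)
  then have "ctransp q = - q" by (simp add: rev)
  then have nh: "n \<in> hermitian"
    by (simp add: n_def hermitian_def cmat_entries)
  have trn: "ip n a = (\<i> / of_real m) * (- trace (q ** adjugate a) / 2)" for a
    by (simp add: n_def ip_cscale ip_def cscale_mult trace_cscale)
  have "trace (q ** adjugate p) = trace (adjugate p ** p ** adjugate x ** y)"
    unfolding q_def by (subst trace_mult_commute) (simp only: matrix_mul_assoc)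
  also have "\<dots> = trace (y ** adjugate x)"
    using p by (simp add: mult_adjugate H3_def trace_mult_commute[of y])
  finally have np: "ip n p = 0"
    using orth(4) by (simp add: trn trace_mult_adjugate ip_commute[of y x])
  have "q ** adjugate x = - (p ** adjugate y ** (x ** adjugate x))"
    by (simp add: q_def xy' matrix_mult_minus flip: matrix_mul_assoc)
  then have "trace (q ** adjugate x) = - (det x * trace (p ** adjugate y))"
    by (simp only: mult_adjugate mat_mult trace_minus trace_cscale)
  then have nx: "ip n x = 0"
    using orth(2) by (simp add: trn trace_mult_adjugate)
  have "q ** adjugate y = p ** adjugate x ** (y ** adjugate y)"
    by (simp add: q_def flip: matrix_mul_assoc)
  then have ny: "ip n y = 0"
    using orth(1) by (simp add: trn mult_adjugate mat_mult trace_cscale trace_mult_adjugate)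
  have "det n = (\<i> / of_real m)\<^sup>2 * (det p * det x * det y)"
    by (simp add: n_def q_def det_mult_2 det_adjugate flip: det_mult_2)
       (simp add: cmat_entries power2_eq_square algebra_simps)
  moreover have "det x = - of_real m" "det y = - of_real m" "det p = 1"
    using m p unfolding ip_self H3_def by (metis minus_minus, metis minus_minus, simp)
  ultimately have nn: "ip n n = 1"
    using m(3) by (simp add: ip_self power_divide power2_eq_square)
  define r where "r = 1 / sqrt m"
  have r: "r * r * m = 1" using m(3) by (simp add: r_def)
  have "orthonormal (r *\<^sub>R x) (r *\<^sub>R y) w p"
    using herm ph orth m w p r unfolding orthonormal_def
    by (simp add: ip_scaleR H3_ip hermitian_iff scaleR_conv_of_real[where 'a=complex] flip: of_real_mult)
  from frame_expand[OF this nh] have n: "n = Re (ip n w) *\<^sub>R w"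
    by (simp add: ip_scaleR nx ny np)
  have "ip n n = of_real (Re (ip n w) * Re (ip n w)) * ip w w"
    by (subst (1 2) n) (simp add: ip_scaleR scaleR_conv_of_real[where 'a=complex])
  then have "Re (ip n w) * Re (ip n w) = 1"
    using nn w by (simp flip: of_real_mult)
  moreover have "0 < Re (ip n w)"
    using pos m(3) by (simp add: trn vol_def q_def)
  ultimately have "Re (ip n w) = 1"
    unfolding square_eq_1_iff by auto
  then show ?thesis
    using n by (simp add: n_def q_def)
qed

section \<open>Symmetry of second derivatives\<close>

lemma along_line_has_derivative:
  assumes "h differentiable (at (c + of_real t * a))"
  shows "((\<lambda>t::real. h (c + of_real t * a)) has_derivative
    (\<lambda>s. s *\<^sub>R differential h (c + of_real t * a) a)) (at t)"
proof -
  have l: "((\<lambda>t::real. c + of_real t * a) has_derivative (\<lambda>s. of_real s * a)) (at t)"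
    by (auto intro!: derivative_eq_intros)
  have d: "(h has_derivative differential h (c + of_real t * a)) (at (c + of_real t * a))"
    using assms by (rule has_derivative_differential)
  have "differential h (c + of_real t * a) (of_real s * a) = s *\<^sub>R differential h (c + of_real t * a) a" for s
    using linear_scale[OF has_derivative_linear[OF d], of s a] by (simp add: scaleR_conv_of_real)
  then show ?thesis
    using has_derivative_compose[OF l d] by simp
qed

text \<open>The second difference of \<open>h\<close> over a square of side \<open>s\<close> is a difference of
  \<open>t \<mapsto> h (z + s b + t a) - h (z + t a)\<close>, whose derivative is \<open>s\<close> times the derivative in direction \<open>b\<close> of
  the partial derivative in direction \<open>a\<close>, up to \<open>o(s)\<close>. The mean value inequality integrates this.\<close>

lemma second_difference:
  fixes a b z :: complex
  assumes D: "open D" "z \<in> D" and h: "\<And>w. w \<in> D \<Longrightarrow> h differentiable (at w)"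
    and X: "(\<lambda>w. differential h w a) differentiable (at z)"
    and ab: "norm a = 1" "norm b = 1" and e: "0 < e"
  shows "\<exists>d>0. \<forall>s. 0 < s \<and> s < d \<longrightarrow>
    norm (h (z + of_real s * b + of_real s * a) - h (z + of_real s * b) - (h (z + of_real s * a) - h z)
      - (s * s) *\<^sub>R differential (\<lambda>w. differential h w a) z b) \<le> 3 * e * s * s"
proof -
  define X where "X = (\<lambda>w. differential h w a)"
  define X' where "X' = differential X z"
  have der: "(X has_derivative X') (at z)"
    unfolding X'_def using X by (intro has_derivative_differential) (simp add: X_def)
  have lin: "linear X'" using der by (rule has_derivative_linear)
  obtain d1 where d1: "0 < d1" "\<And>y. norm (y - z) < d1 \<Longrightarrow> norm (X y - X z - X' (y - z)) \<le> e * norm (y - z)"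
    using der e unfolding has_derivative_at_alt by blast
  obtain d2 where d2: "0 < d2" "ball z d2 \<subseteq> D"
    using D openE by blast
  \<comment> \<open>the points below are within \<open>2 s\<close> of \<open>z\<close>\<close>
  define d where "d = min d1 d2 / 2"
  have "norm (h (z + of_real s * b + of_real s * a) - h (z + of_real s * b) - (h (z + of_real s * a) - h z)
      - (s * s) *\<^sub>R X' b) \<le> 3 * e * s * s" if s: "0 < s" "s < d" for s
  proof -
    define \<phi> where "\<phi> t = h (z + of_real s * b + of_real t * a) - h (z + of_real t * a) - t *\<^sub>R (s *\<^sub>R X' b)" for t
    define \<phi>' where "\<phi>' t = X (z + of_real s * b + of_real t * a) - X (z + of_real t * a) - s *\<^sub>R X' b" for t
    have n1: "norm (of_real t * a) \<le> s" if "t \<in> {0..s}" for t :: real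
      using that ab by (simp add: norm_mult)
    have n2: "norm (of_real s * b + of_real t * a) \<le> 2 * s" if "t \<in> {0..s}" for t :: real
      using norm_triangle_ineq[of "of_real s * b" "of_real t * a"] n1[OF that] ab s by (simp add: norm_mult)
    have inD: "z + of_real s * b + of_real t * a \<in> D" "z + of_real t * a \<in> D" if "t \<in> {0..s}" for t
    proof -
      have "norm (of_real s * b + of_real t * a) < d2" "norm (of_real t * a) < d2"
        using n1[OF that] n2[OF that] s d1(1) by (auto simp: d_def)
      then have "dist z (z + of_real s * b + of_real t * a) < d2" "dist z (z + of_real t * a) < d2"
        by (simp_all add: dist_norm norm_minus_commute algebra_simps)
      then show "z + of_real s * b + of_real t * a \<in> D" "z + of_real t * a \<in> D"
        using d2(2) by (auto simp: mem_ball)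
    qed
    have "(\<phi> has_derivative (\<lambda>u. u *\<^sub>R \<phi>' t)) (at t within {0..s})" if "t \<in> {0..s}" for t
    proof -
      have "((\<lambda>t. t *\<^sub>R (s *\<^sub>R X' b)) has_derivative (\<lambda>u. u *\<^sub>R (s *\<^sub>R X' b))) (at t)"
        by (rule bounded_linear_imp_has_derivative[OF bounded_linear_scaleR_left])
      from has_derivative_diff[OF has_derivative_diff[OF
          along_line_has_derivative[of h "z + of_real s * b" t a] along_line_has_derivative[of h z t a]] this]
      have "(\<phi> has_derivative (\<lambda>u. u *\<^sub>R X (z + of_real s * b + of_real t * a)
          - u *\<^sub>R X (z + of_real t * a) - u *\<^sub>R (s *\<^sub>R X' b))) (at t)"
        using h inD[OF that] unfolding \<phi>_def X_def by blast
      then show ?thesis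
        unfolding \<phi>'_def
        by (simp add: scaleR_diff_right has_derivative_at_withinI)
    qed
    moreover have "onorm (\<lambda>u. u *\<^sub>R \<phi>' t) \<le> 3 * e * s" if "t \<in> {0..s}" for t
    proof -
      define u where "u = of_real s * b + of_real t * a"
      define w where "w = of_real t * a"
      have "norm u < d1" "norm w < d1"
        using n1[OF that] n2[OF that] s d2(1) by (auto simp: d_def u_def w_def)
      then have "norm (X (z + u) - X z - X' u) \<le> e * norm u" "norm (X (z + w) - X z - X' w) \<le> e * norm w"
        using d1(2)[of "z + u"] d1(2)[of "z + w"] by simp_all
      moreover have "\<phi>' t = (X (z + u) - X z - X' u) - (X (z + w) - X z - X' w)"
      proof -
        have "X' u = s *\<^sub>R X' b + X' w"
          using linear_scale[OF lin, of s b] by (simp add: u_def w_def linear_add[OF lin] scaleR_conv_of_real)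
        then show ?thesis
          by (simp add: \<phi>'_def u_def w_def add.assoc)
      qed
      ultimately have "norm (\<phi>' t) \<le> e * norm u + e * norm w"
        using norm_triangle_ineq4[of "X (z + u) - X z - X' u" "X (z + w) - X z - X' w"] by simp
      also have "\<dots> \<le> e * (2 * s) + e * s"
        using n1[OF that] n2[OF that] e by (intro add_mono mult_left_mono) (auto simp: u_def w_def)
      finally have "norm (\<phi>' t) \<le> 3 * e * s" by simp
      then show ?thesis
        using e s by (intro onorm_bound) (auto simp: mult.commute intro: mult_left_mono)
    qed
    ultimately have "norm (\<phi> s - \<phi> 0) \<le> 3 * e * s * norm (s - 0)"
      using s by (intro differentiable_bound[of "{0..s}"]) auto
    then show ?thesis
      using s by (simp add: \<phi>_def algebra_simps)
  qed
  moreover have "0 < d" using d1(1) d2(1) by (simp add: d_def)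
  ultimately show ?thesis
    unfolding X'_def X_def by blast
qed

text \<open>The second difference does not depend on the order of the two directions.\<close>

lemma second_derivative_symmetric:
  assumes "open D" "z \<in> D" "\<And>w. w \<in> D \<Longrightarrow> h differentiable (at w)"
    and "(\<lambda>w. differential h w 1) differentiable (at z)" "(\<lambda>w. differential h w \<i>) differentiable (at z)"
  shows "differential (\<lambda>w. differential h w 1) z \<i> = differential (\<lambda>w. differential h w \<i>) z 1"
    (is "?A = ?B")
proof (rule ccontr)
  assume "?A \<noteq> ?B"
  \<comment> \<open>each of two comparisons below has an error of at most \<open>3 e s\<^sup>2\<close>, and \<open>6 < 7\<close>\<close>
  define e where "e = norm (?A - ?B) / 7"
  have e: "0 < e" using \<open>?A \<noteq> ?B\<close> by (simp add: e_def)
  let ?\<Delta> = "\<lambda>s. h (z + of_real s * 1 + of_real s * \<i>) - h (z + of_real s * 1) - (h (z + of_real s * \<i>) - h z)"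
  obtain d1 where d1: "0 < d1" "\<And>s. 0 < s \<and> s < d1 \<Longrightarrow>
      norm (h (z + of_real s * \<i> + of_real s * 1) - h (z + of_real s * \<i>) - (h (z + of_real s * 1) - h z)
        - (s * s) *\<^sub>R ?A) \<le> 3 * e * s * s"
    using second_difference[OF assms(1-4) _ _ e, of \<i>] by auto
  obtain d2 where d2: "0 < d2" "\<And>s. 0 < s \<and> s < d2 \<Longrightarrow>
      norm (?\<Delta> s - (s * s) *\<^sub>R ?B) \<le> 3 * e * s * s"
    using second_difference[OF assms(1-3,5) _ _ e, of 1] by auto
  define s where "s = min d1 d2 / 2"
  have s: "0 < s" "s < d1" "s < d2" using d1(1) d2(1) by (auto simp: s_def)
  have eq: "h (z + of_real s * \<i> + of_real s * 1) - h (z + of_real s * \<i>) - (h (z + of_real s * 1) - h z) = ?\<Delta> s"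
    by (simp add: algebra_simps)
  have "norm (?\<Delta> s - (s * s) *\<^sub>R ?A) \<le> 3 * e * s * s"
    using d1(2)[of s] s(1,2) unfolding eq by blast
  moreover have "norm (?\<Delta> s - (s * s) *\<^sub>R ?B) \<le> 3 * e * s * s"
    using d2(2)[of s] s(1,3) by blast
  moreover have "(s * s) *\<^sub>R (?A - ?B) = (?\<Delta> s - (s * s) *\<^sub>R ?B) - (?\<Delta> s - (s * s) *\<^sub>R ?A)"
    by (simp add: scaleR_diff_right)
  ultimately have le: "norm ((s * s) *\<^sub>R (?A - ?B)) \<le> 6 * e * s * s"
    using norm_triangle_ineq4[of "?\<Delta> s - (s * s) *\<^sub>R ?B" "?\<Delta> s - (s * s) *\<^sub>R ?A"] by simp
  have "norm ((s * s) *\<^sub>R (?A - ?B)) = (s * s) * (7 * e)"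
    unfolding norm_scaleR using s by (simp add: e_def)
  then have "(s * s) * (7 * e) \<le> 6 * e * s * s"
    using le by (simp only:)
  then have "(s * s) * (7 * e) \<le> (s * s) * (6 * e)"
    by (simp only: ac_simps)
  then show False using s e by (simp add: mult_le_cancel_left)
qed

section \<open>Moving frames\<close>

lemma bounded_bilinear_matrix_mult_4:
  "bounded_bilinear ((**) :: real^4^4 \<Rightarrow> real^4^4 \<Rightarrow> real^4^4)"
  by (rule iffD1[OF bilinear_conv_bounded_bilinear])
     (simp add: bilinear_def linear_iff matrix_matrix_mult_def vec_eq_iff sum.distrib algebra_simps sum_distrib_left)

lemma bounded_linear_transpose_4: "bounded_linear (transpose :: real^4^4 \<Rightarrow> real^4^4)"
  by (rule iffD1[OF linear_conv_bounded_linear]) (simp add: linear_iff transpose_def vec_eq_iff)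

lemmas matrix_mult_4_has_derivative = bounded_bilinear.FDERIV[OF bounded_bilinear_matrix_mult_4]

lemma frame_matrix_has_derivative:
  assumes "(x has_derivative x') (at z)" "(y has_derivative y') (at z)"
    "(w has_derivative w') (at z)" "(p has_derivative p') (at z)"
  shows "((\<lambda>z. frame_matrix (x z) (y z) (w z) (p z)) has_derivative
    (\<lambda>v. frame_matrix (x' v) (y' v) (w' v) (p' v))) (at z)"
proof -
  have split: "frame_matrix a b c d
      = frame_matrix a 0 0 0 + frame_matrix 0 b 0 0 + frame_matrix 0 0 c 0 + frame_matrix 0 0 0 d" for a b c d
    by (simp add: frame_matrix_def vec4_eq_iff vector_4 linear_0[OF linear_coords])
  have lin: "bounded_linear (\<lambda>a. frame_matrix a 0 0 0)" "bounded_linear (\<lambda>a. frame_matrix 0 a 0 0)"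
    "bounded_linear (\<lambda>a. frame_matrix 0 0 a 0)" "bounded_linear (\<lambda>a. frame_matrix 0 0 0 a)"
    by (rule iffD1[OF linear_conv_bounded_linear], rule linearI,
        simp_all add: frame_matrix_def vec4_eq_iff vector_4 linear_0[OF linear_coords]
          linear_add[OF linear_coords] linear_scale[OF linear_coords])+
  show ?thesis
    by (subst split, subst (2) split)
       (intro has_derivative_add bounded_linear.has_derivative[OF lin(1)] bounded_linear.has_derivative[OF lin(2)]
         bounded_linear.has_derivative[OF lin(3)] bounded_linear.has_derivative[OF lin(4)] assms)
qed

text \<open>The derivative of the orthonormality relation.\<close>

lemma frame_skew:
  fixes E :: "complex \<Rightarrow> real^4^4"
  assumes "open D" "z \<in> D" "(E has_derivative E') (at z)"
    and "\<And>w. w \<in> D \<Longrightarrow> E w ** eta ** transpose (E w) = eta"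
  shows "E' v ** eta ** transpose (E z) + transpose (E' v ** eta ** transpose (E z)) = 0"
proof -
  have t: "((\<lambda>w. transpose (E w)) has_derivative (\<lambda>v. transpose (E' v))) (at z)"
    by (rule bounded_linear.has_derivative[OF bounded_linear_transpose_4 assms(3)])
  have "((\<lambda>w. E w ** (eta ** transpose (E w))) has_derivative
      (\<lambda>v. E z ** (eta ** transpose (E' v)) + E' v ** (eta ** transpose (E z)))) (at z)"
    by (intro matrix_mult_4_has_derivative assms(3)
        bounded_linear.has_derivative[OF bounded_bilinear.bounded_linear_right[OF bounded_bilinear_matrix_mult_4] t])
  then have "((\<lambda>w. eta) has_derivative
      (\<lambda>v. E z ** (eta ** transpose (E' v)) + E' v ** (eta ** transpose (E z)))) (at z)"
    by (rule has_derivative_transform_within_open[OF _ assms(1,2)]) (simp add: assms(4) matrix_mul_assoc)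
  then have "(\<lambda>v. E z ** (eta ** transpose (E' v)) + E' v ** (eta ** transpose (E z))) = (\<lambda>v. 0)"
    by (rule has_derivative_unique) (rule has_derivative_const)
  then have "E z ** (eta ** transpose (E' v)) + E' v ** (eta ** transpose (E z)) = 0"
    by (rule fun_cong)
  then show ?thesis
    by (simp add: matrix_transpose_mul transpose_eta matrix_mul_assoc add.commute)
qed

lemma matrix_mult_add_4:
  "(X + Y) ** Z = X ** Z + Y ** (Z::real^4^4)" "Z ** (X + Y) = Z ** X + Z ** (Y::real^4^4)"
  using bounded_bilinear.add_left[OF bounded_bilinear_matrix_mult_4] bounded_bilinear.add_right[OF bounded_bilinear_matrix_mult_4]
  by auto

text \<open>The change of frame is \<open>S = E\<^sup>-\<^sup>1 K\<close>. With the common connection matrix \<open>W\<close> the derivative of \<open>K\<close> is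
  \<open>W eta K\<close> and \<open>E S'\<close> is \<open>(W + W\<^sup>T) eta K\<close>, which vanishes because \<open>W\<close> is antisymmetric.\<close>

lemma moving_frame_unique:
  fixes E K :: "complex \<Rightarrow> real^4^4"
  assumes B: "open B" "convex B"
    and E: "\<And>z. z \<in> B \<Longrightarrow> (E has_derivative E' z) (at z)" "\<And>z. z \<in> B \<Longrightarrow> E z ** eta ** transpose (E z) = eta"
    and K: "\<And>z. z \<in> B \<Longrightarrow> (K has_derivative K' z) (at z)" "\<And>z. z \<in> B \<Longrightarrow> K z ** eta ** transpose (K z) = eta"
    and W: "\<And>z v. z \<in> B \<Longrightarrow> E' z v ** eta ** transpose (E z) = K' z v ** eta ** transpose (K z)"
  shows "\<exists>S. \<forall>z\<in>B. lorentz S \<and> K z = E z ** S"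
proof -
  have inv: "eta ** transpose F ** eta ** F = mat 1" if "F ** eta ** transpose F = eta" for F :: "real^4^4"
  proof -
    have "F ** (eta ** transpose F ** eta) = mat 1"
      using that by (simp add: matrix_mul_assoc eta_eta)
    then show ?thesis by (simp only: matrix_left_right_inverse)
  qed
  define S where "S z = eta ** transpose (E z) ** eta ** K z" for z
  have KE: "K z = E z ** S z" if "z \<in> B" for z
  proof -
    have "E z ** S z = (E z ** eta ** transpose (E z)) ** eta ** K z"
      by (simp add: S_def matrix_mul_assoc)
    then show ?thesis using E(2)[OF that] by (simp add: eta_eta)
  qed
  have lor: "lorentz (S z)" if "z \<in> B" for z
  proof -
    have "S z ** eta ** transpose (S z)
        = eta ** transpose (E z) ** eta ** (K z ** eta ** transpose (K z)) ** eta ** E z ** eta"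
      by (simp add: S_def matrix_transpose_mul transpose_eta matrix_mul_assoc)
    also have "\<dots> = eta ** transpose (E z) ** (eta ** eta) ** eta ** E z ** eta"
      by (simp add: K(2)[OF that] matrix_mul_assoc)
    also have "\<dots> = eta"
      using inv[OF E(2)[OF that]] by (simp add: eta_eta matrix_mul_assoc)
    finally show ?thesis by (simp add: lorentz_def)
  qed
  have S0: "(S has_derivative (\<lambda>v. 0)) (at z)" if z: "z \<in> B" for z
  proof -
    define S' where "S' v = eta ** transpose (E z) ** eta ** K' z v + eta ** transpose (E' z v) ** eta ** K z" for v
    note mult_eta = bounded_linear.has_derivative[OF bounded_bilinear.bounded_linear_right[OF bounded_bilinear_matrix_mult_4]]
    note eta_mult = bounded_linear.has_derivative[OF bounded_bilinear.bounded_linear_left[OF bounded_bilinear_matrix_mult_4]]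
    have "(S has_derivative S') (at z)"
      unfolding S_def S'_def
      by (intro matrix_mult_4_has_derivative eta_mult mult_eta
          bounded_linear.has_derivative[OF bounded_linear_transpose_4] E(1)[OF z] K(1)[OF z])
    moreover have "S' = (\<lambda>v. 0)"
    proof (rule ext)
      fix v
      define V where "V = E' z v ** eta ** transpose (E z)"
      have V: "V + transpose V = 0"
        unfolding V_def by (rule frame_skew[OF B(1) z E(1)[OF z] E(2)])
      have "K' z v = K' z v ** (eta ** transpose (K z) ** eta ** K z)"
        by (simp add: inv[OF K(2)[OF z]])
      also have "\<dots> = (K' z v ** eta ** transpose (K z)) ** eta ** K z"
        by (simp add: matrix_mul_assoc)
      finally have K': "K' z v = V ** eta ** K z"
        by (simp add: V_def W[OF z])
      have "E z ** S' v = (E z ** eta ** transpose (E z)) ** eta ** K' z v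
          + transpose V ** eta ** K z"
        by (simp add: S'_def V_def matrix_mult_add_4 matrix_transpose_mul transpose_eta matrix_mul_assoc)
      also have "\<dots> = (V + transpose V) ** (eta ** K z)"
        by (simp add: E(2)[OF z] eta_eta K' matrix_mult_add_4 matrix_mul_assoc)
      also have "\<dots> = 0"
        using V by (simp add: matrix_matrix_mult_def vec_eq_iff)
      finally have "E z ** S' v = 0" .
      then have "eta ** transpose (E z) ** eta ** (E z ** S' v) = 0"
        by (simp add: matrix_matrix_mult_def vec_eq_iff)
      then show "S' v = 0"
        using inv[OF E(2)[OF z]] by (simp add: matrix_mul_assoc)
    qed
    ultimately show ?thesis by simp
  qed
  have "(S has_derivative (\<lambda>v. 0)) (at z within B)" if "z \<in> B" for z
    by (rule has_derivative_at_withinI[OF S0[OF that]])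
  then have "\<exists>C. \<forall>z\<in>B. S z = C"
    by (rule has_derivative_zero_constant[OF B(2)])
  then obtain C where "\<And>z. z \<in> B \<Longrightarrow> S z = C"
    by blast
  then show ?thesis using KE lor by (intro exI[of _ C]) auto
qed

section \<open>The fundamental theorem of surfaces: uniqueness\<close>

text \<open>The base point is constant for a surface in \<open>E3\<close> and moves with the surface in \<open>H3\<close>.\<close>

primrec base_rate :: "ambient \<Rightarrow> real" where
  "base_rate Euclidean = 0"
| "base_rate Hyperbolic = 1"

lemma base_point_has_derivative:
  assumes "(h has_derivative h') (at z)"
  shows "((\<lambda>z. base_point M (h z)) has_derivative (\<lambda>v. base_rate M *\<^sub>R h' v)) (at z)"
  using assms by (cases M) simp_all

lemma hermitian_derivative:
  assumes "open D" "z \<in> D" "\<And>w. w \<in> D \<Longrightarrow> f w \<in> hermitian" "(f has_derivative f') (at z)"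
  shows "f' v \<in> hermitian"
proof -
  have "((\<lambda>w. ctransp (f w)) has_derivative (\<lambda>v. ctransp (f' v))) (at z)"
    by (rule ctransp_has_derivative[OF assms(4)])
  then have "(f has_derivative (\<lambda>v. ctransp (f' v))) (at z)"
    by (rule has_derivative_transform_within_open[OF _ assms(1,2)]) (use assms(3) in \<open>simp add: hermitian_def\<close>)
  then have "(\<lambda>v. ctransp (f' v)) = f'"
    using assms(4) by (rule has_derivative_unique)
  then show ?thesis
    unfolding hermitian_def by (simp add: fun_eq_iff)
qed

lemma mink_coords: "x \<in> hermitian \<Longrightarrow> y \<in> hermitian \<Longrightarrow> mink (coords x) (coords y) = Re (ip x y)"
  by (simp add: ip_hermitian)

text \<open>A surface with a chosen unit normal. Its metric factor is given as a real function \<open>m\<close>, so that it can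
  be shared by two surfaces and differentiated.\<close>

locale surface =
  fixes M :: ambient and D :: "complex set" and h N :: "complex \<Rightarrow> cmat" and m :: "complex \<Rightarrow> real"
  assumes open_D: "open D"
    and immersion: "conformal_immersion M D h"
    and normal: "unit_normal M D h N"
    and metric: "\<And>z. z \<in> D \<Longrightarrow> metric h z = of_real (m z)"
begin

abbreviation hx :: "complex \<Rightarrow> cmat" where "hx z \<equiv> differential h z 1"
abbreviation hy :: "complex \<Rightarrow> cmat" where "hy z \<equiv> differential h z \<i>"
abbreviation base :: "complex \<Rightarrow> cmat" where "base z \<equiv> base_point M (h z)"

lemma Ck: "Ck_on (Suc (Suc 0)) D h"
  using immersion by (simp only: conformal_immersion_def smooth_on_def)

lemma h_derivative: "z \<in> D \<Longrightarrow> (h has_derivative differential h z) (at z)"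
  using Ck_on_Suc_has_derivative[OF open_D Ck] .

lemma h_differentiable: "z \<in> D \<Longrightarrow> h differentiable (at z)"
  using h_derivative by (rule differentiableI)

lemma hx_derivative: "z \<in> D \<Longrightarrow> (hx has_derivative differential hx z) (at z)"
  by (rule Ck_on_Suc_has_derivative[OF open_D, of 0]) (use Ck in simp_all)

lemma hy_derivative: "z \<in> D \<Longrightarrow> (hy has_derivative differential hy z) (at z)"
  by (rule Ck_on_Suc_has_derivative[OF open_D, of 0]) (use Ck in simp_all)

lemma mixed: "z \<in> D \<Longrightarrow> differential hx z \<i> = differential hy z 1"
  using second_derivative_symmetric[OF open_D _ h_differentiable]
    differentiableI[OF hx_derivative] differentiableI[OF hy_derivative] by blast

lemma differential_split: "z \<in> D \<Longrightarrow> differential h z v = Re v *\<^sub>R hx z + Im v *\<^sub>R hy z"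
  by (rule differential_linear[OF h_differentiable])

lemma positive_frame: "z \<in> D \<Longrightarrow> positive_H3 (base z) (hx z) (hy z) (N z)"
  using normal by (simp add: unit_normal_def positive_iff)

lemma frame_hermitian:
  assumes "z \<in> D"
  shows "base z \<in> H3" "base z \<in> hermitian" "hx z \<in> hermitian" "hy z \<in> hermitian" "N z \<in> hermitian"
  using positive_frame[OF assms] by (auto simp: positive_H3_iff H3_hermitian)

lemma frame_products:
  assumes z: "z \<in> D"
  shows "ip (base z) (hx z) = 0" "ip (base z) (hy z) = 0" "ip (base z) (N z) = 0"
    "ip (hx z) (N z) = 0" "ip (hy z) (N z) = 0" "ip (N z) (N z) = 1" "ip (base z) (base z) = -1"
    "ip (hx z) (hx z) = of_real (m z)" "ip (hy z) (hy z) = of_real (m z)" "ip (hx z) (hy z) = 0"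
proof -
  show "ip (base z) (hx z) = 0" "ip (base z) (hy z) = 0" "ip (base z) (N z) = 0"
    using positive_frame[OF z] by (auto simp: positive_H3_iff)
  show "ip (hx z) (N z) = 0" "ip (hy z) (N z) = 0" "ip (N z) (N z) = 1"
    using normal z by (auto simp: unit_normal_def)
  show "ip (base z) (base z) = -1"
    using frame_hermitian(1)[OF z] by (rule H3_ip)
  have conf: "ip (differential h z v) (differential h z v) = of_real (m z) * of_real ((norm v)\<^sup>2)" for v
    using immersion z metric[OF z] by (simp add: conformal_immersion_def)
  show xx: "ip (hx z) (hx z) = of_real (m z)" and yy: "ip (hy z) (hy z) = of_real (m z)"
    using conf[of 1] conf[of \<i>] by simp_all
  have "(norm (1 + \<i>))\<^sup>2 = 2"
    by (simp add: cmod_power2)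
  then have "ip (hx z + hy z) (hx z + hy z) = of_real (m z) * 2"
    using conf[of "1 + \<i>"] differential_split[OF z, of "1 + \<i>"] by simp
  then show "ip (hx z) (hy z) = 0"
    using ip_commute[of "hy z" "hx z"] by (simp add: ip_add xx yy)
qed

lemma m_positive: "z \<in> D \<Longrightarrow> 0 < m z"
proof -
  assume z: "z \<in> D"
  have "differential h z v = 0 \<longrightarrow> v = 0" for v
    using immersion z by (simp add: conformal_immersion_def)
  from this[of 1] have "hx z \<noteq> 0" by simp
  then have "0 < Re (ip (hx z) (hx z))"
    by (rule tangent_definite[OF frame_hermitian(1)[OF z] frame_hermitian(3)[OF z] frame_products(1)[OF z]])
  then show "0 < m z" using frame_products(8)[OF z] by simp
qed

lemma normal_formula:
  assumes z: "z \<in> D"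
  shows "N z = (1 / m z) *\<^sub>R (\<i> *\<^sub>C (base z ** adjugate (hx z) ** hy z))"
proof -
  have "N z = (\<i> / of_real (m z)) *\<^sub>C (base z ** adjugate (hx z) ** hy z)"
    using frame_products[OF z] frame_hermitian[OF z] m_positive[OF z] positive_frame[OF z]
    by (intro unit_normal_formula) (simp_all add: positive_H3_iff)
  then show ?thesis
    by (simp add: cmat_entries scaleR_conv_of_real[where 'a=complex])
qed

lemma m_derivative: "z \<in> D \<Longrightarrow> (m has_derivative (\<lambda>v. 2 * Re (ip (differential hx z v) (hx z)))) (at z)"
proof -
  assume z: "z \<in> D"
  have "((\<lambda>w. Re (ip (hx w) (hx w))) has_derivative
      (\<lambda>v. Re (ip (hx z) (differential hx z v) + ip (differential hx z v) (hx z)))) (at z)"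
    by (intro bounded_linear.has_derivative[OF bounded_linear_Re] ip_has_derivative hx_derivative z)
  then have "(m has_derivative
      (\<lambda>v. Re (ip (hx z) (differential hx z v) + ip (differential hx z v) (hx z)))) (at z)"
    by (rule has_derivative_transform_within_open[OF _ open_D z]) (simp add: frame_products)
  then show ?thesis
    by (simp add: ip_commute[of "hx z"])
qed

lemma base_derivative:
  "z \<in> D \<Longrightarrow> ((\<lambda>z. base z) has_derivative (\<lambda>v. base_rate M *\<^sub>R differential h z v)) (at z)"
  by (rule base_point_has_derivative[OF h_derivative])

lemma N_derivative: "z \<in> D \<Longrightarrow> (N has_derivative differential N z) (at z)"
proof (rule has_derivative_differential)
  assume z: "z \<in> D"
  have "(\<lambda>z. base z ** adjugate (hx z) ** hy z) differentiable (at z)"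
    by (rule differentiableI[OF matrix_mult_has_derivative[OF matrix_mult_has_derivative[OF base_derivative[OF z]
        bounded_linear.has_derivative[OF bounded_linear_adjugate hx_derivative[OF z]]] hy_derivative[OF z]]])
  then obtain q' where "((\<lambda>z. base z ** adjugate (hx z) ** hy z) has_derivative q') (at z)"
    by (auto simp: differentiable_def)
  from cscale_has_derivative[OF this]
  have "(\<lambda>z. \<i> *\<^sub>C (base z ** adjugate (hx z) ** hy z)) differentiable (at z)"
    by (rule differentiableI)
  moreover have "(\<lambda>z. 1 / m z) differentiable (at z)"
    using differentiableI[OF m_derivative[OF z]] m_positive[OF z] by (intro differentiable_divide) auto
  ultimately have diff: "(\<lambda>z. (1 / m z) *\<^sub>R (\<i> *\<^sub>C (base z ** adjugate (hx z) ** hy z))) differentiable (at z)"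
    by (rule differentiable_scaleR[rotated])
  show "N differentiable (at z)"
    by (rule differentiable_cong_open[OF open_D z _ diff]) (rule normal_formula)
qed

text \<open>All connection coefficients of the frame come from this product rule.\<close>

lemma ip_derivative_constant:
  assumes "z \<in> D" "(f has_derivative f') (at z)" "(g has_derivative g') (at z)"
    and "\<And>w. w \<in> D \<Longrightarrow> ip (f w) (g w) = c"
  shows "ip (f z) (g' v) = - ip (f' v) (g z)"
proof -
  have "((\<lambda>w. ip (f w) (g w)) has_derivative (\<lambda>v. ip (f z) (g' v) + ip (f' v) (g z))) (at z)"
    by (rule ip_has_derivative[OF assms(2,3)])
  then have "((\<lambda>w. c) has_derivative (\<lambda>v. ip (f z) (g' v) + ip (f' v) (g z))) (at z)"
    by (rule has_derivative_transform_within_open[OF _ open_D assms(1)]) (rule assms(4))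
  then have "(\<lambda>v. ip (f z) (g' v) + ip (f' v) (g z)) = (\<lambda>v. 0)"
    by (rule has_derivative_unique) (rule has_derivative_const)
  then have "ip (f z) (g' v) + ip (f' v) (g z) = 0"
    by (rule fun_cong)
  then show ?thesis by (simp add: eq_neg_iff_add_eq_0)
qed

lemma second_form:
  assumes z: "z \<in> D"
  shows "- ip (differential h z w) (differential N z v)
    = Re w *\<^sub>R ip (differential hx z v) (N z) + Im w *\<^sub>R ip (differential hy z v) (N z)"
  using ip_derivative_constant[OF z hx_derivative[OF z] N_derivative[OF z] frame_products(4)]
    ip_derivative_constant[OF z hy_derivative[OF z] N_derivative[OF z] frame_products(5)]
  by (simp add: differential_split[OF z, of w] ip_add ip_scaleR)

text \<open>Dividing by \<open>sqrt m\<close> makes the frame orthonormal, with constant Gram matrix \<open>eta\<close>, as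
  \<open>moving_frame_unique\<close> demands.\<close>

definition adapted_frame :: "complex \<Rightarrow> real^4^4" where
  "adapted_frame z = frame_matrix ((1 / sqrt (m z)) *\<^sub>R hx z) ((1 / sqrt (m z)) *\<^sub>R hy z) (N z) (base z)"

lemma orthonormal_frame:
  assumes z: "z \<in> D"
  shows "orthonormal ((1 / sqrt (m z)) *\<^sub>R hx z) ((1 / sqrt (m z)) *\<^sub>R hy z) (N z) (base z)"
proof -
  have "1 / sqrt (m z) * (1 / sqrt (m z)) * m z = 1"
    using m_positive[OF z] by simp
  then have *: "(1 / sqrt (m z)) *\<^sub>R (1 / sqrt (m z)) *\<^sub>R complex_of_real (m z) = 1"
    by (simp only: scaleR_conv_of_real flip: of_real_mult mult.assoc) simp
  have "(1 / sqrt (m z)) *\<^sub>R x \<in> hermitian" if "x \<in> hermitian" for x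
    using that by (simp add: hermitian_iff scaleR_conv_of_real[where 'a=complex])
  then show ?thesis
    unfolding orthonormal_def ip_scaleR frame_products[OF z] *
    using frame_hermitian[OF z] by simp
qed

lemma adapted_frame_orthonormal:
  "z \<in> D \<Longrightarrow> adapted_frame z ** eta ** transpose (adapted_frame z) = eta"
  unfolding adapted_frame_def by (rule frame_matrix_orthonormal[OF orthonormal_frame])

end

text \<open>The connection matrix of the adapted frame in the direction \<open>v\<close>, in terms of the metric factor \<open>m\<close>, its
  differential \<open>dm\<close>, and the values \<open>b1\<close> and \<open>b2\<close> of the second fundamental form on \<open>(v, 1)\<close> and \<open>(v, \<i>)\<close>.
  The function \<open>c\<close> lists the entries above the diagonal.\<close>

definition connection_matrix :: "ambient \<Rightarrow> real \<Rightarrow> (complex \<Rightarrow> real) \<Rightarrow> real \<Rightarrow> real \<Rightarrow> complex \<Rightarrow> real^4^4" where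
  "connection_matrix M m dm b1 b2 v = (\<chi> i j.
     let c = (\<lambda>k l. if k = 1 \<and> l = 2 then (Im v * dm 1 - Re v * dm \<i>) / (2 * m)
       else if k = 1 \<and> l = 3 then b1 / sqrt m else if k = 2 \<and> l = 3 then b2 / sqrt m
       else if k = 1 \<and> l = 4 then - base_rate M * Re v * sqrt m
       else if k = 2 \<and> l = 4 then - base_rate M * Im v * sqrt m else 0)
     in c i j - c j i)"

lemma skew_eqI:
  fixes V W :: "real^4^4"
  assumes "V + transpose V = 0" "W + transpose W = 0"
    and "V$1$2 = W$1$2" "V$1$3 = W$1$3" "V$1$4 = W$1$4" "V$2$3 = W$2$3" "V$2$4 = W$2$4" "V$3$4 = W$3$4"
  shows "V = W"
proof -
  have e: "V$i$j = - V$j$i" "W$i$j = - W$j$i" for i j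
    using assms(1,2) by (simp_all add: vec_eq_iff transpose_def eq_neg_iff_add_eq_0)
  have d: "V$i$i = 0" "W$i$i = 0" for i
    using e[of i i] by simp_all
  show ?thesis
    unfolding vec4_eq_iff[where 'a="real^4"] vec4_eq_iff[where 'a=real]
    using assms(3-) e[of 2 1] e[of 3 1] e[of 4 1] e[of 3 2] e[of 4 2] e[of 4 3] by (simp add: d)
qed

context surface
begin

text \<open>The tangential coefficient comes from the metric alone by the Koszul formula, the coefficients with
  the normal form the second fundamental form, and those with the base point are given by the metric,
  since the derivative of the base point is tangent to the surface.\<close>

lemma adapted_frame_derivative:
  assumes z: "z \<in> D"
  obtains E' where "(adapted_frame has_derivative E') (at z)"
    and "\<And>v dm. (m has_derivative dm) (at z) \<Longrightarrow> E' v ** eta ** transpose (adapted_frame z)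
      = connection_matrix M (m z) dm (Re (ip (differential hx z v) (N z))) (Re (ip (differential hy z v) (N z))) v"
proof -
  define r where "r w = 1 / sqrt (m w)" for w
  have mp: "0 < m z" by (rule m_positive[OF z])
  have rr: "r z * r z = 1 / m z" "r z * m z = sqrt (m z)"
    using mp by (simp_all add: r_def real_div_sqrt)
  obtain r' where r': "(r has_derivative r') (at z)"
  proof -
    have "((\<lambda>w. 1 / sqrt (m w)) has_derivative (\<lambda>v. - (inverse (sqrt (m z)) / 2
        * (2 * Re (ip (differential hx z v) (hx z))) / (sqrt (m z) * sqrt (m z))))) (at z)"
      using mp by (auto intro!: derivative_eq_intros m_derivative z simp: field_simps)
    then show ?thesis using that unfolding r_def by blast
  qed
  define f1 where "f1 v = r z *\<^sub>R differential hx z v + r' v *\<^sub>R hx z" for v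
  define f2 where "f2 v = r z *\<^sub>R differential hy z v + r' v *\<^sub>R hy z" for v
  define f3 where "f3 v = differential N z v" for v
  define f4 where "f4 v = base_rate M *\<^sub>R differential h z v" for v
  define E' where "E' v = frame_matrix (f1 v) (f2 v) (f3 v) (f4 v)" for v
  have f1: "((\<lambda>w. r w *\<^sub>R hx w) has_derivative f1) (at z)"
    unfolding f1_def by (rule has_derivative_scaleR[OF r' hx_derivative[OF z]])
  have f2: "((\<lambda>w. r w *\<^sub>R hy w) has_derivative f2) (at z)"
    unfolding f2_def by (rule has_derivative_scaleR[OF r' hy_derivative[OF z]])
  have f3: "(N has_derivative f3) (at z)"
    unfolding f3_def by (rule N_derivative[OF z])
  have f4: "((\<lambda>w. base w) has_derivative f4) (at z)"
    unfolding f4_def by (rule base_derivative[OF z])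
  have E': "(adapted_frame has_derivative E') (at z)"
    using frame_matrix_has_derivative[OF f1 f2 f3 f4]
    unfolding E'_def adapted_frame_def r_def .
  have on: "orthonormal (r w *\<^sub>R hx w) (r w *\<^sub>R hy w) (N w) (base w)" if "w \<in> D" for w
    unfolding r_def by (rule orthonormal_frame[OF that])
  have onh: "r w *\<^sub>R hx w \<in> hermitian" "r w *\<^sub>R hy w \<in> hermitian" "N w \<in> hermitian" "base w \<in> hermitian"
    if "w \<in> D" for w
    using on[OF that] by (auto simp: orthonormal_def)
  have fh: "f1 v \<in> hermitian" "f2 v \<in> hermitian" "f3 v \<in> hermitian" "f4 v \<in> hermitian" for v
    by (rule hermitian_derivative[OF open_D z onh(1) f1] hermitian_derivative[OF open_D z onh(2) f2]
        hermitian_derivative[OF open_D z onh(3) f3] hermitian_derivative[OF open_D z onh(4) f4]; assumption)+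
  have "E' v ** eta ** transpose (adapted_frame z)
      = connection_matrix M (m z) dm (Re (ip (differential hx z v) (N z))) (Re (ip (differential hy z v) (N z))) v"
    if dm: "(m has_derivative dm) (at z)" for v dm
  proof (rule skew_eqI)
    let ?W = "connection_matrix M (m z) dm (Re (ip (differential hx z v) (N z))) (Re (ip (differential hy z v) (N z))) v"
    show "E' v ** eta ** transpose (adapted_frame z) + transpose (E' v ** eta ** transpose (adapted_frame z)) = 0"
      by (rule frame_skew[OF open_D z E' adapted_frame_orthonormal])
    show "?W + transpose ?W = 0"
      by (simp add: connection_matrix_def Let_def vec_eq_iff transpose_def)
    have rows: "(E' v ** eta ** transpose (adapted_frame z))$i$j = mink (E' v$i) (adapted_frame z$j)" for i j
      by (rule mult_eta_transpose_nth)
    note E'_rows = E'_def adapted_frame_def frame_matrix_def vector_4 r_def[symmetric]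
    have xN: "(E' v ** eta ** transpose (adapted_frame z))$1$3 = Re (ip (f1 v) (N z))"
      and yN: "(E' v ** eta ** transpose (adapted_frame z))$2$3 = Re (ip (f2 v) (N z))"
      and xy: "(E' v ** eta ** transpose (adapted_frame z))$1$2 = Re (ip (f1 v) (r z *\<^sub>R hy z))"
      and xp: "(E' v ** eta ** transpose (adapted_frame z))$1$4 = Re (ip (f1 v) (base z))"
      and yp: "(E' v ** eta ** transpose (adapted_frame z))$2$4 = Re (ip (f2 v) (base z))"
      and Np: "(E' v ** eta ** transpose (adapted_frame z))$3$4 = Re (ip (f3 v) (base z))"
      unfolding rows unfolding E'_rows by (rule mink_coords[OF fh(1) onh(3)[OF z]] mink_coords[OF fh(2) onh(3)[OF z]]
        mink_coords[OF fh(1) onh(2)[OF z]] mink_coords[OF fh(1) onh(4)[OF z]] mink_coords[OF fh(2) onh(4)[OF z]]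
        mink_coords[OF fh(3) onh(4)[OF z]])+
    have dmv: "dm u = 2 * Re (ip (differential hx z u) (hx z))" "dm u = 2 * Re (ip (differential hy z u) (hy z))" for u
    proof -
      have "dm = (\<lambda>v. 2 * Re (ip (differential hx z v) (hx z)))"
        by (rule has_derivative_unique[OF dm m_derivative[OF z]])
      then show x: "dm u = 2 * Re (ip (differential hx z u) (hx z))" by simp
      have "((\<lambda>w. Re (ip (hy w) (hy w))) has_derivative
          (\<lambda>v. Re (ip (hy z) (differential hy z v) + ip (differential hy z v) (hy z)))) (at z)"
        by (intro bounded_linear.has_derivative[OF bounded_linear_Re] ip_has_derivative hy_derivative z)
      then have "(m has_derivative
          (\<lambda>v. Re (ip (hy z) (differential hy z v) + ip (differential hy z v) (hy z)))) (at z)"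
        by (rule has_derivative_transform_within_open[OF _ open_D z]) (simp add: frame_products)
      then have "dm = (\<lambda>v. Re (ip (hy z) (differential hy z v) + ip (differential hy z v) (hy z)))"
        by (rule has_derivative_unique[OF dm])
      then show "dm u = 2 * Re (ip (differential hy z u) (hy z))"
        by (simp add: ip_commute[of "hy z"])
    qed
    \<comment> \<open>the Koszul formula: only the symmetry of mixed derivatives and the derivatives of the metric enter\<close>
    have "ip (differential hx z v) (hy z) = Re v *\<^sub>R ip (differential hx z 1) (hy z) + Im v *\<^sub>R ip (differential hx z \<i>) (hy z)"
      using differential_linear[OF differentiableI[OF hx_derivative[OF z]], of v] by (simp add: ip_add ip_scaleR)
    moreover have "Re (ip (differential hx z 1) (hy z)) = - dm \<i> / 2"
      using ip_derivative_constant[OF z hx_derivative[OF z] hy_derivative[OF z] frame_products(10), of 1]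
        mixed[OF z] dmv(1)[of \<i>] by (simp add: ip_commute[of "hx z"])
    moreover have "Re (ip (differential hx z \<i>) (hy z)) = dm 1 / 2"
      using mixed[OF z] dmv(2)[of 1] by simp
    ultimately have koszul: "Re (ip (differential hx z v) (hy z)) = (Im v * dm 1 - Re v * dm \<i>) / 2"
      by (simp add: field_simps)
    show "(E' v ** eta ** transpose (adapted_frame z))$1$2 = ?W$1$2"
    proof -
      have "Re (ip (f1 v) (r z *\<^sub>R hy z)) = (r z * r z) * Re (ip (differential hx z v) (hy z))"
        using frame_products(10)[OF z] by (simp add: f1_def ip_add ip_scaleR)
      then show ?thesis
        unfolding xy rr(1) koszul by (simp add: connection_matrix_def)
    qed
    show "(E' v ** eta ** transpose (adapted_frame z))$1$3 = ?W$1$3"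
      unfolding xN using frame_products(4)[OF z]
      by (simp add: f1_def ip_add ip_scaleR connection_matrix_def r_def)
    show "(E' v ** eta ** transpose (adapted_frame z))$2$3 = ?W$2$3"
      unfolding yN using frame_products(5)[OF z]
      by (simp add: f2_def ip_add ip_scaleR connection_matrix_def r_def)
    have px: "ip (differential hx z v) (base z) = - (base_rate M * Re v * m z)"
      using ip_derivative_constant[OF z base_derivative[OF z] hx_derivative[OF z] frame_products(1), of v]
        frame_products(8,10)[OF z]
      by (simp add: ip_commute[of _ "base z"] differential_split[OF z, of v] ip_add ip_scaleR scaleR_conv_of_real[where 'a=complex]
          ip_commute[of "hy z" "hx z"])
    have py: "ip (differential hy z v) (base z) = - (base_rate M * Im v * m z)"
      using ip_derivative_constant[OF z base_derivative[OF z] hy_derivative[OF z] frame_products(2), of v]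
        frame_products(9,10)[OF z]
      by (simp add: ip_commute[of _ "base z"] differential_split[OF z, of v] ip_add ip_scaleR scaleR_conv_of_real[where 'a=complex])
    show "(E' v ** eta ** transpose (adapted_frame z))$1$4 = ?W$1$4"
      unfolding xp using frame_products(1)[OF z] px rr(2)
      by (simp add: f1_def ip_add ip_scaleR connection_matrix_def ip_commute[of _ "base z"])
    show "(E' v ** eta ** transpose (adapted_frame z))$2$4 = ?W$2$4"
      unfolding yp using frame_products(2)[OF z] py rr(2)
      by (simp add: f2_def ip_add ip_scaleR connection_matrix_def ip_commute[of _ "base z"])
    have "ip (differential N z v) (base z) = 0"
      using ip_derivative_constant[OF z base_derivative[OF z] N_derivative[OF z] frame_products(3), of v]
        frame_products(4,5)[OF z]
      by (simp add: ip_commute[of _ "base z"] differential_split[OF z, of v] ip_add ip_scaleR)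
    then show "(E' v ** eta ** transpose (adapted_frame z))$3$4 = ?W$3$4"
      unfolding Np by (simp add: f3_def connection_matrix_def)
  qed
  with E' show ?thesis by (rule that)
qed

text \<open>The mean curvature and the Hopf differential prescribe only the quadratic form \<open>q\<close>. The bilinear form
  follows by polarization because mixed second derivatives agree.\<close>

lemma second_form_polarized:
  assumes z: "z \<in> D"
  defines "q \<equiv> \<lambda>v. - ip (differential h z v) (differential N z v)"
  shows "ip (differential hx z v) (N z) = Re v *\<^sub>R q 1 + Im v *\<^sub>R ((q (1 + \<i>) - q 1 - q \<i>) / 2)"
    and "ip (differential hy z v) (N z) = Re v *\<^sub>R ((q (1 + \<i>) - q 1 - q \<i>) / 2) + Im v *\<^sub>R q \<i>"
proof -
  define a where "a v = ip (differential hx z v) (N z)" for v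
  define b where "b v = ip (differential hy z v) (N z)" for v
  have q: "q v = Re v *\<^sub>R a v + Im v *\<^sub>R b v" for v
    unfolding q_def a_def b_def by (rule second_form[OF z])
  have a: "a v = Re v *\<^sub>R a 1 + Im v *\<^sub>R a \<i>" for v
    using differential_linear[OF differentiableI[OF hx_derivative[OF z]], of v] by (simp add: a_def ip_add ip_scaleR)
  have b: "b v = Re v *\<^sub>R b 1 + Im v *\<^sub>R b \<i>" for v
    using differential_linear[OF differentiableI[OF hy_derivative[OF z]], of v] by (simp add: b_def ip_add ip_scaleR)
  have ab: "a \<i> = b 1"
    by (simp add: a_def b_def mixed[OF z])
  have "q (1 + \<i>) = (a 1 + a \<i>) + (b 1 + b \<i>)"
    using q[of "1 + \<i>"] a[of "1 + \<i>"] b[of "1 + \<i>"] by simp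
  moreover have "q 1 = a 1" "q \<i> = b \<i>"
    using q[of 1] q[of \<i>] by simp_all
  ultimately have s: "(q (1 + \<i>) - q 1 - q \<i>) / 2 = a \<i>" "q 1 = a 1" "q \<i> = b \<i>"
    by (simp_all add: ab)
  show "ip (differential hx z v) (N z) = Re v *\<^sub>R q 1 + Im v *\<^sub>R ((q (1 + \<i>) - q 1 - q \<i>) / 2)"
    unfolding s(1) unfolding s(2) using a[of v] by (simp only: a_def)
  show "ip (differential hy z v) (N z) = Re v *\<^sub>R ((q (1 + \<i>) - q 1 - q \<i>) / 2) + Im v *\<^sub>R q \<i>"
    unfolding s(1) unfolding s(3) using b[of v] by (simp only: b_def ab)
qed

end

text \<open>The isometries \<open>x \<mapsto> act S x + c\<close> that arise below. For \<open>E3\<close> the linear part is extended to all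
  Hermitian matrices by fixing the identity, so that it acts on frames including the base point.\<close>

definition rigid_motion :: "ambient \<Rightarrow> real^4^4 \<Rightarrow> cmat \<Rightarrow> bool" where
  "rigid_motion M S c \<longleftrightarrow> proper_lorentz S \<and>
     (case M of Euclidean \<Rightarrow> act S (mat 1) = mat 1 \<and> c \<in> E3 | Hyperbolic \<Rightarrow> c = 0)"

lemma rigid_motion_isometry:
  "rigid_motion M S c \<Longrightarrow> ambient_isometry M (\<lambda>x. act S x + c)"
  by (cases M) (use ambient_isometry_euclidean ambient_isometry_hyperbolic in \<open>auto simp: rigid_motion_def\<close>)

lemma frame_matrix_cancel:
  assumes "frame_matrix x y w p = frame_matrix x' y' w' p'"
    and "x \<in> hermitian" "y \<in> hermitian" "w \<in> hermitian" "p \<in> hermitian"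
    and "x' \<in> hermitian" "y' \<in> hermitian" "w' \<in> hermitian" "p' \<in> hermitian"
  shows "x = x'" "y = y'" "w = w'" "p = p'"
proof -
  have "coords x = coords x'" "coords y = coords y'" "coords w = coords w'" "coords p = coords p'"
    using assms(1) unfolding frame_matrix_def vec4_eq_iff[where 'a="real^4"] by (simp_all add: vector_4)
  then have "of_coords (coords x) = of_coords (coords x')" "of_coords (coords y) = of_coords (coords y')" "of_coords (coords w) = of_coords (coords w')"
    "of_coords (coords p) = of_coords (coords p')" by simp_all
  then show "x = x'" "y = y'" "w = w'" "p = p'"
    using assms(2-) by (simp_all add: of_coords_coords)
qed

lemma E3_diff: "x \<in> E3 \<Longrightarrow> y \<in> E3 \<Longrightarrow> x - y \<in> E3"
  by (simp add: E3_def hermitian_iff trace_sub)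

lemma act_has_derivative:
  "(h has_derivative h') (at z) \<Longrightarrow> ((\<lambda>z. act S (h z)) has_derivative (\<lambda>v. act S (h' v))) (at z)"
  by (rule bounded_linear.has_derivative[OF iffD1[OF linear_conv_bounded_linear linear_act]])

text \<open>The adapted frames of the two surfaces have the same connection matrix and so differ by a constant
  Lorentz matrix \<open>S\<close>, which is proper because both frames are positive. In \<open>H3\<close> the point of the surface
  is itself a vector of the frame; in \<open>E3\<close> the difference \<open>k - act S h\<close> has zero derivative.\<close>

lemma bonnet_uniqueness:
  assumes h: "surface M D h N m" and k: "surface M D k N' m"
    and II: "\<And>z v. z \<in> D \<Longrightarrow>
      ip (differential h z v) (differential N z v) = ip (differential k z v) (differential N' z v)"
    and B: "B \<subseteq> D" "open B" "convex B" "z0 \<in> B"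
  shows "\<exists>S c. rigid_motion M S c \<and> (\<forall>z\<in>B. k z = act S (h z) + c)"
proof -
  interpret h: surface M D h N m by (rule h)
  interpret k: surface M D k N' m by (rule k)
  have inD: "z \<in> D" if "z \<in> B" for z using B(1) that by blast
  have "\<exists>E'. (h.adapted_frame has_derivative E') (at z) \<and> (\<forall>v dm. (m has_derivative dm) (at z) \<longrightarrow>
      E' v ** eta ** transpose (h.adapted_frame z) = connection_matrix M (m z) dm
        (Re (ip (differential h.hx z v) (N z))) (Re (ip (differential h.hy z v) (N z))) v)" if "z \<in> D" for z
    using h.adapted_frame_derivative[OF that] by metis
  then obtain E' where E': "\<And>z. z \<in> D \<Longrightarrow> (h.adapted_frame has_derivative E' z) (at z)"
    "\<And>z v dm. z \<in> D \<Longrightarrow> (m has_derivative dm) (at z) \<Longrightarrow>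
      E' z v ** eta ** transpose (h.adapted_frame z) = connection_matrix M (m z) dm
        (Re (ip (differential h.hx z v) (N z))) (Re (ip (differential h.hy z v) (N z))) v"
    by metis
  have "\<exists>K'. (k.adapted_frame has_derivative K') (at z) \<and> (\<forall>v dm. (m has_derivative dm) (at z) \<longrightarrow>
      K' v ** eta ** transpose (k.adapted_frame z) = connection_matrix M (m z) dm
        (Re (ip (differential k.hx z v) (N' z))) (Re (ip (differential k.hy z v) (N' z))) v)" if "z \<in> D" for z
    using k.adapted_frame_derivative[OF that] by metis
  then obtain K' where K': "\<And>z. z \<in> D \<Longrightarrow> (k.adapted_frame has_derivative K' z) (at z)"
    "\<And>z v dm. z \<in> D \<Longrightarrow> (m has_derivative dm) (at z) \<Longrightarrow>
      K' z v ** eta ** transpose (k.adapted_frame z) = connection_matrix M (m z) dm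
        (Re (ip (differential k.hx z v) (N' z))) (Re (ip (differential k.hy z v) (N' z))) v"
    by metis
  have second: "ip (differential h.hx z v) (N z) = ip (differential k.hx z v) (N' z)"
    "ip (differential h.hy z v) (N z) = ip (differential k.hy z v) (N' z)" if "z \<in> D" for z v
    unfolding h.second_form_polarized[OF that] k.second_form_polarized[OF that] II[OF that] by (rule refl)+
  have "\<exists>S. \<forall>z\<in>B. lorentz S \<and> k.adapted_frame z = h.adapted_frame z ** S"
  proof (rule moving_frame_unique[OF B(2,3) E'(1)[OF inD] h.adapted_frame_orthonormal[OF inD] K'(1)[OF inD]
        k.adapted_frame_orthonormal[OF inD]])
    fix z v assume "z \<in> B"
    then have z: "z \<in> D" by (rule inD)
    show "E' z v ** eta ** transpose (h.adapted_frame z) = K' z v ** eta ** transpose (k.adapted_frame z)"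
      unfolding E'(2)[OF z h.m_derivative[OF z]] K'(2)[OF z h.m_derivative[OF z]] second[OF z] by (rule refl)
  qed
  then obtain S where S: "\<And>z. z \<in> B \<Longrightarrow> lorentz S" "\<And>z. z \<in> B \<Longrightarrow> k.adapted_frame z = h.adapted_frame z ** S"
    by blast
  have rows: "k.hx z = act S (h.hx z)" "k.hy z = act S (h.hy z)" "N' z = act S (N z)"
    "k.base z = act S (h.base z)" if "z \<in> B" for z
  proof -
    have z: "z \<in> D" using that by (rule inD)
    have r: "1 / sqrt (m z) \<noteq> 0" using h.m_positive[OF z] by simp
    have sc: "c *\<^sub>R x \<in> hermitian" if "x \<in> hermitian" for c x
      using that by (simp add: hermitian_iff scaleR_conv_of_real[where 'a=complex])
    note eq = frame_matrix_cancel[OF S(2)[OF that, unfolded h.adapted_frame_def k.adapted_frame_def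
        frame_matrix_act[symmetric]] sc[OF k.frame_hermitian(3)[OF z]] sc[OF k.frame_hermitian(4)[OF z]]
        k.frame_hermitian(5)[OF z] k.frame_hermitian(2)[OF z] act_hermitian act_hermitian act_hermitian act_hermitian]
    show "N' z = act S (N z)" "k.base z = act S (h.base z)"
      by (rule eq(3), rule eq(4))
    show "k.hx z = act S (h.hx z)" "k.hy z = act S (h.hy z)"
      using eq(1,2) r by (simp_all only: linear_scale[OF linear_act] scaleR_left_imp_eq[OF r])
  qed
  have z0: "z0 \<in> D" by (rule inD[OF B(4)])
  have "0 < det S"
  proof -
    have "vol (k.base z0) (k.hx z0) (k.hy z0) (N' z0) = det S * vol (h.base z0) (h.hx z0) (h.hy z0) (N z0)"
      unfolding rows[OF B(4)] using h.frame_hermitian[OF z0] by (intro vol_act)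
    moreover have "0 < vol (k.base z0) (k.hx z0) (k.hy z0) (N' z0)" "0 < vol (h.base z0) (h.hx z0) (h.hy z0) (N z0)"
      using h.positive_frame[OF z0] k.positive_frame[OF z0] by (simp_all add: positive_H3_iff)
    ultimately show ?thesis by (simp add: zero_less_mult_iff)
  qed
  moreover have "\<exists>p\<in>H3. act S p \<in> H3"
    using h.frame_hermitian(1)[OF z0] k.frame_hermitian(1)[OF z0] rows(4)[OF B(4)] by auto
  ultimately have proper: "proper_lorentz S"
    using S(1)[OF B(4)] by (simp add: proper_lorentz_def)
  show ?thesis
  proof (cases M)
    case Hyperbolic
    then show ?thesis
      using rows(4) proper by (intro exI[of _ S] exI[of _ 0]) (simp add: rigid_motion_def)
  next
    case Euclidean
    have one: "act S (mat 1) = mat 1"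
      using rows(4)[OF B(4)] Euclidean by simp
    have "((\<lambda>w. k w - act S (h w)) has_derivative (\<lambda>v. 0)) (at z)" if "z \<in> B" for z
    proof -
      have z: "z \<in> D" using that by (rule inD)
      have "differential k z v - act S (differential h z v) = 0" for v
        unfolding h.differential_split[OF z, of v] k.differential_split[OF z, of v] rows[OF that]
        by (simp add: linear_add[OF linear_act] linear_scale[OF linear_act])
      then show ?thesis
        using has_derivative_diff[OF k.h_derivative[OF z] act_has_derivative[OF h.h_derivative[OF z], of S]] by simp
    qed
    then have "((\<lambda>w. k w - act S (h w)) has_derivative (\<lambda>v. 0)) (at z within B)" if "z \<in> B" for z
      by (rule has_derivative_at_withinI) (rule that)
    then have "\<exists>c. \<forall>z\<in>B. k z - act S (h z) = c"
      by (rule has_derivative_zero_constant[OF B(3)])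
    then obtain c where c: "\<And>z. z \<in> B \<Longrightarrow> k z - act S (h z) = c" by blast
    have "h z0 \<in> E3" "k z0 \<in> E3"
      using h.immersion k.immersion z0 Euclidean by (auto simp: conformal_immersion_def)
    moreover have "act S (h z0) \<in> E3"
      using ip_act[OF S(1)[OF B(4)] H3_hermitian[OF mat_1_in_H3], of "h z0"] one \<open>h z0 \<in> E3\<close>
      by (simp add: E3_iff act_hermitian)
    ultimately have "c \<in> E3"
      using c[OF B(4)] E3_diff by blast
    moreover have "k z = act S (h z) + c" if "z \<in> B" for z
      using c[OF that] by (simp add: algebra_simps)
    ultimately show ?thesis
      using proper one Euclidean by (intro exI[of _ S] exI[of _ c]) (simp add: rigid_motion_def)
  qed
qed

text \<open>The images of the point and of its tangent vectors determine the image of the unit normal by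
  \<open>unit_normal_formula\<close>, hence the image of a whole frame, hence \<open>S\<close>.\<close>

lemma rigid_motion_unique:
  assumes h: "surface M D h N m"
    and S: "rigid_motion M S c" "rigid_motion M S' c'"
    and B: "B \<subseteq> D" "open B" "z \<in> B"
    and eq: "\<And>w. w \<in> B \<Longrightarrow> act S (h w) + c = act S' (h w) + c'"
  shows "S = S' \<and> c = c'"
proof -
  interpret h: surface M D h N m by (rule h)
  have z: "z \<in> D" using B by blast
  have d: "((\<lambda>w. act T (h w) + a) has_derivative (\<lambda>v. act T (differential h z v))) (at z)" for T a
    using has_derivative_add[OF act_has_derivative[OF h.h_derivative[OF z], of T] has_derivative_const[of a]] by simp
  have "((\<lambda>w. act S' (h w) + c') has_derivative (\<lambda>v. act S (differential h z v))) (at z)"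
    by (rule has_derivative_transform_within_open[OF d B(2,3)]) (rule eq)
  then have "(\<lambda>v. act S (differential h z v)) = (\<lambda>v. act S' (differential h z v))"
    by (rule has_derivative_unique) (rule d)
  then have tangent: "act S (differential h z v) = act S' (differential h z v)" for v
    by (rule fun_cong)
  have base: "act S (h.base z) = act S' (h.base z)"
    using S eq[OF B(3)] by (cases M) (simp_all add: rigid_motion_def)
  have N: "act T (N z) = (\<i> / of_real (m z)) *\<^sub>C (act T (h.base z) ** adjugate (act T (h.hx z)) ** act T (h.hy z))"
    if T: "proper_lorentz T" for T
  proof (rule unit_normal_formula)
    have l: "lorentz T" using T by (simp add: proper_lorentz_def)
    have "positive_H3 (act T (h.base z)) (act T (h.hx z)) (act T (h.hy z)) (act T (N z))"
      by (rule positive_H3_act[OF T h.positive_frame[OF z]])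
    then show "act T (h.base z) \<in> H3" "0 < vol (act T (h.base z)) (act T (h.hx z)) (act T (h.hy z)) (act T (N z))"
      by (simp_all add: positive_H3_iff)
  qed (use T in \<open>simp_all add: act_hermitian ip_act h.frame_hermitian[OF z] h.frame_products[OF z]
      h.m_positive[OF z] proper_lorentz_def\<close>)
  have "act S (N z) = act S' (N z)"
    using N S by (simp add: rigid_motion_def base tangent)
  then have "frame_matrix (h.hx z) (h.hy z) (N z) (h.base z) ** S = frame_matrix (h.hx z) (h.hy z) (N z) (h.base z) ** S'"
    unfolding frame_matrix_act[symmetric] by (simp add: base tangent)
  then have "h.adapted_frame z ** S = h.adapted_frame z ** S'"
    unfolding h.adapted_frame_def frame_matrix_act[symmetric] linear_scale[OF linear_act]
    using \<open>act S (N z) = act S' (N z)\<close> by (simp add: base tangent)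
  then have "eta ** transpose (h.adapted_frame z) ** eta ** h.adapted_frame z ** S
      = eta ** transpose (h.adapted_frame z) ** eta ** h.adapted_frame z ** S'"
    by (simp flip: matrix_mul_assoc)
  then have "S = S'"
    unfolding h.adapted_frame_def frame_matrix_inverse[OF h.orthonormal_frame[OF z]] by simp
  then show ?thesis
    using eq[OF B(3)] by simp
qed

section \<open>Minimal and CMC 1 surfaces from null matrices\<close>

lemma cmat_distrib:
  "(X + Y) ** Z = X ** Z + Y ** (Z::cmat)" "Z ** (X + Y) = Z ** X + Z ** (Y::cmat)"
  "(X - Y) ** Z = X ** Z - Y ** (Z::cmat)" "Z ** (X - Y) = Z ** X - Z ** (Y::cmat)"
  "(a *\<^sub>R X) ** Z = a *\<^sub>R (X ** Z)" "Z ** (a *\<^sub>R X) = a *\<^sub>R (Z ** X)" for X Y Z :: cmat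
  by (rule bounded_bilinear.add_left[OF bounded_bilinear_matrix_mult]
      bounded_bilinear.add_right[OF bounded_bilinear_matrix_mult]
      bounded_bilinear.diff_left[OF bounded_bilinear_matrix_mult]
      bounded_bilinear.diff_right[OF bounded_bilinear_matrix_mult]
      bounded_bilinear.scaleR_left[OF bounded_bilinear_matrix_mult]
      bounded_bilinear.scaleR_right[OF bounded_bilinear_matrix_mult])+

lemma cscale_distrib: "c *\<^sub>C (X + Y) = c *\<^sub>C X + c *\<^sub>C Y" "c *\<^sub>C (X - Y) = c *\<^sub>C X - c *\<^sub>C Y"
  "(a + b) *\<^sub>C X = a *\<^sub>C X + b *\<^sub>C X" "a *\<^sub>C b *\<^sub>C X = (a * b) *\<^sub>C X" "1 *\<^sub>C X = X" "0 *\<^sub>C X = 0" "c *\<^sub>C 0 = 0"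
  by (simp_all add: cmat_entries algebra_simps)

lemma ctransp_linear: "ctransp (X + Y) = ctransp X + ctransp Y" "ctransp (X - Y) = ctransp X - ctransp Y"
  "ctransp (c *\<^sub>C X) = cnj c *\<^sub>C ctransp X" "ctransp 0 = 0"
  by (simp_all add: cmat_entries)

lemma trace_linear: "trace (X + Y) = trace X + trace (Y::cmat)" "trace (X - Y) = trace X - trace (Y::cmat)"
  "trace (a *\<^sub>R X) = a *\<^sub>R trace (X::cmat)" "trace (0::cmat) = 0"
  by (simp_all add: trace_2 scaleR_add_right)

lemma adjugate_traceless: "trace x = 0 \<Longrightarrow> adjugate x = - x"
  by (simp add: cmat_entries eq_neg_iff_add_eq_0 add.commute)

lemma ip_traceless: "trace y = 0 \<Longrightarrow> ip x y = trace (x ** y) / 2"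
  by (simp add: ip_def adjugate_traceless matrix_mult_minus trace_minus)

lemma ip_ctransp: "ip (ctransp x) (ctransp y) = cnj (ip x y)"
  by (simp add: ip_expand ctransp_nth algebra_simps)

lemma trace_square: "trace (X ** X) = (trace X)\<^sup>2 - 2 * det (X::cmat)"
  by (simp add: cmat_entries power2_eq_square algebra_simps)

text \<open>Let \<open>b\<close> be a nonzero null matrix, that is, \<open>tr b = 0\<close> and \<open>b\<^sup>2 = 0\<close>. In an orthonormal basis adapted to
  its kernel only the upper right entry \<open>c\<close> of \<open>b\<close> is not zero, and the commutator \<open>b\<^sup>* b - b b\<^sup>*\<close> is
  \<open>|c|\<^sup>2 diag(-1, 1)\<close>: a unit vector of \<open>E3\<close>, up to the factor \<open>|c|\<^sup>2 = tr (b b\<^sup>*)\<close>, that is orthogonal to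
  \<open>b\<close> and \<open>b\<^sup>*\<close>.\<close>

definition null_length :: "cmat \<Rightarrow> real" where
  "null_length b = Re (trace (b ** ctransp b))"

definition null_normal :: "cmat \<Rightarrow> cmat" where
  "null_normal b = (1 / null_length b) *\<^sub>R (ctransp b ** b - b ** ctransp b)"

lemma trace_mult_ctransp: "trace (b ** ctransp b) = of_real (null_length b)"
  by (simp add: null_length_def cmat_entries complex_eq_iff)

lemma null_length_pos: "b \<noteq> 0 \<Longrightarrow> 0 < null_length b"
proof -
  assume "b \<noteq> 0"
  then have "(cmod (b$1$1))\<^sup>2 + (cmod (b$1$2))\<^sup>2 + ((cmod (b$2$1))\<^sup>2 + (cmod (b$2$2))\<^sup>2) \<noteq> 0"
    by (simp add: cmat_eq_iff add_nonneg_eq_0_iff)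
  moreover have "null_length b = (cmod (b$1$1))\<^sup>2 + (cmod (b$1$2))\<^sup>2 + ((cmod (b$2$1))\<^sup>2 + (cmod (b$2$2))\<^sup>2)"
    unfolding null_length_def cmod_power2 by (simp add: cmat_entries power2_eq_square)
  moreover have "0 \<le> (cmod (b$1$1))\<^sup>2 + (cmod (b$1$2))\<^sup>2 + ((cmod (b$2$1))\<^sup>2 + (cmod (b$2$2))\<^sup>2)"
    by simp
  ultimately show "0 < null_length b" by linarith
qed

lemma null_cscale:
  assumes "c \<noteq> 0"
  shows "null_length (c *\<^sub>C b) = (norm c)\<^sup>2 * null_length b" "null_normal (c *\<^sub>C b) = null_normal b"
proof -
  have "trace (c *\<^sub>C b ** ctransp (c *\<^sub>C b)) = (c * cnj c) * trace (b ** ctransp b)"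
    by (simp add: ctransp_linear cscale_mult trace_cscale)
  then show l: "null_length (c *\<^sub>C b) = (norm c)\<^sup>2 * null_length b"
    by (simp add: trace_mult_ctransp complex_mult_cnj cmod_power2 flip: of_real_mult of_real_power of_real_add)
  have "ctransp (c *\<^sub>C b) ** (c *\<^sub>C b) - (c *\<^sub>C b) ** ctransp (c *\<^sub>C b)
      = (c * cnj c) *\<^sub>C (ctransp b ** b - b ** ctransp b)"
    by (simp add: ctransp_linear cscale_mult cscale_distrib mult.commute)
  also have "\<dots> = (norm c)\<^sup>2 *\<^sub>R (ctransp b ** b - b ** ctransp b)"
    by (simp add: cmat_entries complex_mult_cnj cmod_power2 scaleR_conv_of_real[where 'a=complex])
  finally show "null_normal (c *\<^sub>C b) = null_normal b"
    unfolding null_normal_def l using assms by simp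
qed

lemma null_matrix:
  assumes b: "trace b = 0" "b ** b = 0" "b \<noteq> 0"
  shows "ip b b = 0" "ip b (ctransp b) = of_real (null_length b) / 2"
    "ip b (null_normal b) = 0" "ip (ctransp b) (null_normal b) = 0"
    "ip (null_normal b) (null_normal b) = 1" "ip (ctransp b ** b) (null_normal b) = of_real (null_length b) / 2"
    "positive_E3 (b + ctransp b) (\<i> *\<^sub>C (b - ctransp b)) (null_normal b)"
proof -
  let ?b = "ctransp b" and ?m = "null_length b"
  define k where "k = ?b ** b - b ** ?b"
  have m: "0 < ?m" using b(3) by (rule null_length_pos)
  have b': "?b ** ?b = 0" "trace ?b = 0"
    using b by (simp_all add: trace_ctransp ctransp_linear flip: ctransp_mult)
  show bb: "ip b b = 0"
    by (simp add: ip_traceless b trace_linear)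
  then have det: "det b = 0" by (simp add: ip_self)
  show "ip b ?b = of_real ?m / 2"
    by (simp add: ip_traceless b' trace_mult_ctransp)
  have n: "null_normal b = (1 / ?m) *\<^sub>R k"
    by (simp add: null_normal_def k_def)
  have k0: "trace k = 0"
    by (simp add: k_def trace_linear trace_mult_commute[of "?b"])
  have n0: "trace (null_normal b) = 0"
    by (simp add: n trace_linear k0)
  have ipn: "ip x (null_normal b) = (1 / ?m) *\<^sub>R (trace (x ** k) / 2)" for x
    by (simp add: n ip_scaleR ip_traceless k0)
  have z: "X ** b ** b = 0" "X ** ?b ** ?b = 0" for X :: cmat
    using b(2) b'(1) by (simp_all flip: matrix_mul_assoc)
  have z2: "trace (b ** X ** b) = 0" "trace (?b ** X ** ?b) = 0" for X :: cmat
    by (subst trace_mult_commute, simp add: matrix_mul_assoc b(2) b'(1) trace_linear)+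
  show "ip b (null_normal b) = 0"
    by (simp add: ipn k_def cmat_distrib trace_linear matrix_mul_assoc b(2) z2 matrix_mult_minus trace_minus)
  show "ip ?b (null_normal b) = 0"
    by (simp add: ipn k_def cmat_distrib trace_linear matrix_mul_assoc b'(1) z2 matrix_mult_minus trace_minus)
  have four: "trace (b ** ?b ** b ** ?b) = (of_real ?m)\<^sup>2"
    using trace_square[of "b ** ?b"] det by (simp add: trace_mult_ctransp det_mult_2 matrix_mul_assoc)
  have four': "trace (?b ** b ** ?b ** b) = (of_real ?m)\<^sup>2"
    using four trace_mult_commute[of "?b" "b ** ?b ** b"] by (simp add: matrix_mul_assoc)
  have "trace (?b ** b ** k) = (of_real ?m)\<^sup>2"
    by (simp add: k_def cmat_distrib trace_linear matrix_mul_assoc four' z matrix_mult_minus trace_minus)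
  then show "ip (?b ** b) (null_normal b) = of_real ?m / 2"
    using m by (simp add: ipn power2_eq_square scaleR_conv_of_real[where 'a=complex])
  have kk: "trace (k ** k) = 2 * (of_real ?m)\<^sup>2"
  proof -
    have "trace (b ** ?b ** ?b ** b) = 0" by (simp add: z trace_linear)
    then show ?thesis
      by (simp add: k_def cmat_distrib trace_linear matrix_mul_assoc four four' z matrix_mult_minus trace_minus)
  qed
  show "ip (null_normal b) (null_normal b) = 1"
    using m by (subst ipn) (simp add: n cmat_distrib trace_linear kk power2_eq_square scaleR_conv_of_real[where 'a=complex])
  have kh: "k \<in> hermitian"
    by (simp add: k_def hermitian_def ctransp_linear ctransp_mult ctransp_ctransp)
  have nE: "null_normal b \<in> E3"
    using kh n0 by (simp add: E3_def) (simp add: n hermitian_iff scaleR_conv_of_real[where 'a=complex])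
  have xE: "b + ?b \<in> E3" and yE: "\<i> *\<^sub>C (b - ?b) \<in> E3"
    using b b' by (simp_all add: E3_def hermitian_def ctransp_linear ctransp_ctransp trace_linear trace_cscale)
      (simp add: cmat_entries algebra_simps)
  have "(b + ?b) ** (\<i> *\<^sub>C (b - ?b)) = \<i> *\<^sub>C k"
    by (simp add: k_def cscale_mult cmat_distrib b b')
  then have xy: "(b + ?b) ** (\<i> *\<^sub>C (b - ?b)) ** null_normal b = \<i> *\<^sub>C (k ** null_normal b)"
    by (simp only: cscale_mult)
  have "trace (mat 1 ** adjugate x ** y ** adjugate w) = trace (x ** y ** w)" if "trace x = 0" "trace w = 0" for x y w
    using that by (simp add: adjugate_traceless matrix_mult_minus)
  then have "trace (mat 1 ** adjugate (b + ?b) ** (\<i> *\<^sub>C (b - ?b)) ** adjugate (null_normal b)) = \<i> * trace (k ** null_normal b)"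
    using xE nE xy by (simp only: E3_def mem_Collect_eq trace_cscale)
  also have "\<dots> = 2 * \<i> * of_real ?m"
    using m by (simp add: n cmat_distrib trace_linear kk power2_eq_square scaleR_conv_of_real[where 'a=complex])
  finally show "positive_E3 (b + ?b) (\<i> *\<^sub>C (b - ?b)) (null_normal b)"
    using m xE yE nE by (simp add: positive_E3_iff vol_def)
qed

text \<open>A map whose differential is \<open>V\<^sup>* (b dz + b\<^sup>* dzbar) V\<close> for a holomorphic null matrix \<open>b\<close>. Here \<open>V\<close>
  carries the identity to the base point: it is constant for \<open>E3\<close> and satisfies \<open>dV = b V dz\<close> for \<open>H3\<close>. These
  are the representations of Weierstrass and of Bryant.\<close>

locale null_surface =
  fixes M :: ambient and D :: "complex set" and h V b :: "complex \<Rightarrow> cmat"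
  assumes open_D: "open D"
    and smooth: "smooth_on D h"
    and points: "\<And>z. z \<in> D \<Longrightarrow> h z \<in> points M"
    and V_det: "\<And>z. z \<in> D \<Longrightarrow> det (V z) = 1"
    and V_base: "\<And>z. z \<in> D \<Longrightarrow> base_point M (h z) = ctransp (V z) ** V z"
    and V_derivative: "\<And>z. z \<in> D \<Longrightarrow>
      (V has_derivative (\<lambda>v. (of_real (base_rate M) * v) *\<^sub>C (b z ** V z))) (at z)"
    and h_derivative: "\<And>z. z \<in> D \<Longrightarrow>
      (h has_derivative (\<lambda>v. ctransp (V z) ** (v *\<^sub>C b z + cnj v *\<^sub>C ctransp (b z)) ** V z)) (at z)"
    and b_holomorphic: "holomorphic_matrix_on b D"
    and b_null: "\<And>z. z \<in> D \<Longrightarrow> trace (b z) = 0" "\<And>z. z \<in> D \<Longrightarrow> b z ** b z = 0" "\<And>z. z \<in> D \<Longrightarrow> b z \<noteq> 0"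
begin

definition unit_normal_field :: "complex \<Rightarrow> cmat" where
  "unit_normal_field z = ctransp (V z) ** null_normal (b z) ** V z"

lemma ip_V: "z \<in> D \<Longrightarrow> ip (ctransp (V z) ** x ** V z) (ctransp (V z) ** y ** V z) = ip x y"
  using ip_congruence[of "ctransp (V z)" x y] V_det[of z] by (simp add: ctransp_ctransp det_ctransp)

lemma differential_h: "z \<in> D \<Longrightarrow>
    differential h z v = ctransp (V z) ** (v *\<^sub>C b z + cnj v *\<^sub>C ctransp (b z)) ** V z"
  by (rule differential_eq[OF h_derivative])

lemma differential_h_1: "z \<in> D \<Longrightarrow> differential h z 1 = ctransp (V z) ** (b z + ctransp (b z)) ** V z"
  by (simp add: differential_h cscale_distrib)

lemma differential_h_i: "z \<in> D \<Longrightarrow> differential h z \<i> = ctransp (V z) ** (\<i> *\<^sub>C (b z - ctransp (b z))) ** V z"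
proof -
  assume z: "z \<in> D"
  have "\<i> *\<^sub>C b z + cnj \<i> *\<^sub>C ctransp (b z) = \<i> *\<^sub>C (b z - ctransp (b z))"
    by (simp add: cmat_entries algebra_simps)
  then show ?thesis by (simp only: differential_h[OF z])
qed

lemma metric_h:
  assumes z: "z \<in> D"
  shows "metric h z = of_real (null_length (b z))"
proof -
  have "d_z h z = ctransp (V z) ** b z ** V z" "d_zbar h z = ctransp (V z) ** ctransp (b z) ** V z"
    unfolding d_z_def d_zbar_def differential_h_1[OF z] differential_h_i[OF z]
    by (simp_all add: cmat_entries algebra_simps)
  then show ?thesis
    using null_matrix(2)[OF b_null[OF z]] by (simp add: metric_def ip_V[OF z] mult.commute)
qed

lemma ip_differential_h:
  assumes z: "z \<in> D"
  shows "ip (differential h z v) (differential h z v) = metric h z * of_real ((norm v)\<^sup>2)"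
proof -
  have "ip (differential h z v) (differential h z v)
      = v * v * ip (b z) (b z) + cnj v * cnj v * cnj (ip (b z) (b z)) + 2 * v * cnj v * ip (b z) (ctransp (b z))"
    by (simp add: differential_h[OF z] ip_V[OF z] ip_add ip_cscale ip_ctransp ip_commute[of "ctransp (b z)" "b z"] algebra_simps)
  also have "\<dots> = metric h z * (v * cnj v)"
    using null_matrix(1,2)[OF b_null[OF z]] by (simp add: metric_h[OF z] mult.commute)
  finally show ?thesis
    unfolding complex_norm_square .
qed

lemma conformal: "conformal_immersion M D h"
proof -
  have "v = 0" if "z \<in> D" "differential h z v = 0" for z v
  proof -
    have "metric h z * of_real ((norm v)\<^sup>2) = ip 0 0"
      using ip_differential_h[OF that(1), of v] that(2) by simp
    then have "of_real (null_length (b z) * (norm v)\<^sup>2) = (0::complex)"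
      by (simp add: metric_h[OF that(1)] ip_expand)
    then show ?thesis
      using null_length_pos[OF b_null(3)[OF that(1)]] by (simp only: of_real_eq_0_iff) simp
  qed
  then show ?thesis
    unfolding conformal_immersion_def using smooth points ip_differential_h by blast
qed

lemma normal: "unit_normal M D h unit_normal_field"
  unfolding unit_normal_def
proof (intro ballI conjI)
  fix z assume z: "z \<in> D"
  note null = null_matrix[OF b_null[OF z]]
  show "ip (unit_normal_field z) (unit_normal_field z) = 1"
    by (simp add: unit_normal_field_def ip_V[OF z] null(5))
  show "ip (differential h z 1) (unit_normal_field z) = 0"
    by (simp add: unit_normal_field_def differential_h[OF z] ip_V[OF z] ip_add ip_cscale null(3,4))
  show "ip (differential h z \<i>) (unit_normal_field z) = 0"
    by (simp add: unit_normal_field_def differential_h[OF z] ip_V[OF z] ip_add ip_cscale null(3,4))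
  have "positive_H3 (base_point M (h z)) (differential h z 1) (differential h z \<i>) (unit_normal_field z)"
    unfolding positive_H3_def
    by (rule bexI[of _ "ctransp (V z)"])
       (use null(7) V_det[OF z] V_base[OF z] in \<open>auto simp: SL2_def det_ctransp ctransp_ctransp
          unit_normal_field_def differential_h_1[OF z] differential_h_i[OF z] intro!: exI\<close>)
  then show "positive M (h z) (differential h z 1) (differential h z \<i>) (unit_normal_field z)"
    by (simp add: positive_iff)
qed

sublocale surface M D h unit_normal_field "\<lambda>z. null_length (b z)"
  by unfold_locales (rule open_D conformal normal metric_h; assumption?)+

lemma conjugated_derivative:
  assumes z: "z \<in> D" and x: "(x has_derivative x') (at z)"
  shows "((\<lambda>w. ctransp (V w) ** x w ** V w) has_derivative (\<lambda>v. ctransp (V z) **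
    (x' v + of_real (base_rate M) *\<^sub>C (v *\<^sub>C (x z ** b z) + cnj v *\<^sub>C (ctransp (b z) ** x z))) ** V z)) (at z)"
proof -
  let ?e = "complex_of_real (base_rate M)"
  have V: "((\<lambda>w. ctransp (V w)) has_derivative (\<lambda>v. ctransp ((?e * v) *\<^sub>C (b z ** V z)))) (at z)"
    by (rule ctransp_has_derivative[OF V_derivative[OF z]])
  have "(\<lambda>v. ctransp (V z) ** x z ** ((?e * v) *\<^sub>C (b z ** V z))
        + (ctransp (V z) ** x' v + ctransp ((?e * v) *\<^sub>C (b z ** V z)) ** x z) ** V z)
      = (\<lambda>v. ctransp (V z) ** (x' v + ?e *\<^sub>C (v *\<^sub>C (x z ** b z) + cnj v *\<^sub>C (ctransp (b z) ** x z))) ** V z)"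
    by (simp add: ctransp_linear ctransp_mult cmat_distrib cscale_distrib cscale_mult matrix_mul_assoc fun_eq_iff)
  then show ?thesis
    using matrix_mult_has_derivative[OF matrix_mult_has_derivative[OF V x] V_derivative[OF z]] by simp
qed

lemma second_derivatives:
  assumes z: "z \<in> D"
  defines "k \<equiv> of_real (base_rate M) *\<^sub>C (ctransp (b z) ** b z)"
  shows "differential hx z v = ctransp (V z) **
      (v *\<^sub>C mderiv b z + cnj v *\<^sub>C ctransp (mderiv b z) + (v + cnj v) *\<^sub>C k) ** V z"
    and "differential hy z v = ctransp (V z) **
      (\<i> *\<^sub>C (v *\<^sub>C mderiv b z - cnj v *\<^sub>C ctransp (mderiv b z) + (cnj v - v) *\<^sub>C k)) ** V z"
proof -
  let ?b' = "mderiv b z" and ?e = "complex_of_real (base_rate M)"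
  have bd: "(b has_derivative (\<lambda>v. v *\<^sub>C ?b')) (at z)"
    by (rule holomorphic_matrix_has_derivative[OF open_D b_holomorphic z])
  have cbd: "((\<lambda>w. ctransp (b w)) has_derivative (\<lambda>v. ctransp (v *\<^sub>C ?b'))) (at z)"
    by (rule ctransp_has_derivative[OF bd])
  have bb: "ctransp (b z) ** ctransp (b z) = 0"
    using b_null(2)[OF z] by (simp add: ctransp_linear flip: ctransp_mult)
  have "(hx has_derivative (\<lambda>v. ctransp (V z) ** (v *\<^sub>C ?b' + ctransp (v *\<^sub>C ?b')
      + ?e *\<^sub>C (v *\<^sub>C ((b z + ctransp (b z)) ** b z) + cnj v *\<^sub>C (ctransp (b z) ** (b z + ctransp (b z))))) ** V z)) (at z)"
    by (rule has_derivative_transform_within_open[OF conjugated_derivative[OF z has_derivative_add[OF bd cbd]] open_D z])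
       (simp add: differential_h_1)
  then have dx: "differential hx z v = ctransp (V z) ** (v *\<^sub>C ?b' + ctransp (v *\<^sub>C ?b')
      + ?e *\<^sub>C (v *\<^sub>C ((b z + ctransp (b z)) ** b z) + cnj v *\<^sub>C (ctransp (b z) ** (b z + ctransp (b z))))) ** V z"
    by (rule differential_eq)
  have "v *\<^sub>C ?b' + ctransp (v *\<^sub>C ?b')
      + ?e *\<^sub>C (v *\<^sub>C ((b z + ctransp (b z)) ** b z) + cnj v *\<^sub>C (ctransp (b z) ** (b z + ctransp (b z))))
    = v *\<^sub>C ?b' + cnj v *\<^sub>C ctransp ?b' + (v + cnj v) *\<^sub>C k"
    by (simp add: k_def ctransp_linear cmat_distrib cscale_distrib bb b_null(2)[OF z] distrib_left mult.commute)
  then show "differential hx z v = ctransp (V z) **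
      (v *\<^sub>C ?b' + cnj v *\<^sub>C ctransp ?b' + (v + cnj v) *\<^sub>C k) ** V z"
    by (simp only: dx)
  have "((\<lambda>w. \<i> *\<^sub>C (b w - ctransp (b w))) has_derivative (\<lambda>v. \<i> *\<^sub>C (v *\<^sub>C ?b' - ctransp (v *\<^sub>C ?b')))) (at z)"
    by (rule cscale_has_derivative[OF
        has_derivative_diff[OF bd cbd]])
  from has_derivative_transform_within_open[OF conjugated_derivative[OF z this] open_D z, of hy]
  have "(hy has_derivative (\<lambda>v. ctransp (V z) ** (\<i> *\<^sub>C (v *\<^sub>C ?b' - ctransp (v *\<^sub>C ?b'))
      + ?e *\<^sub>C (v *\<^sub>C ((\<i> *\<^sub>C (b z - ctransp (b z))) ** b z)
        + cnj v *\<^sub>C (ctransp (b z) ** (\<i> *\<^sub>C (b z - ctransp (b z)))))) ** V z)) (at z)"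
    by (simp add: differential_h_i)
  then have dy: "differential hy z v = ctransp (V z) ** (\<i> *\<^sub>C (v *\<^sub>C ?b' - ctransp (v *\<^sub>C ?b'))
      + ?e *\<^sub>C (v *\<^sub>C ((\<i> *\<^sub>C (b z - ctransp (b z))) ** b z)
        + cnj v *\<^sub>C (ctransp (b z) ** (\<i> *\<^sub>C (b z - ctransp (b z)))))) ** V z"
    by (rule differential_eq)
  have "(\<i> *\<^sub>C (b z - ctransp (b z))) ** b z = - (\<i> *\<^sub>C (ctransp (b z) ** b z))"
    "ctransp (b z) ** (\<i> *\<^sub>C (b z - ctransp (b z))) = \<i> *\<^sub>C (ctransp (b z) ** b z)"
    by (simp_all add: cscale_mult cmat_distrib bb b_null(2)[OF z]) (simp add: cmat_entries algebra_simps)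
  then have "\<i> *\<^sub>C (v *\<^sub>C ?b' - ctransp (v *\<^sub>C ?b'))
      + ?e *\<^sub>C (v *\<^sub>C ((\<i> *\<^sub>C (b z - ctransp (b z))) ** b z)
        + cnj v *\<^sub>C (ctransp (b z) ** (\<i> *\<^sub>C (b z - ctransp (b z)))))
    = \<i> *\<^sub>C (v *\<^sub>C ?b' - cnj v *\<^sub>C ctransp ?b' + (cnj v - v) *\<^sub>C k)"
    unfolding k_def by (simp add: cmat_eq_iff cscale_nth ctransp_nth algebra_simps)
  then show "differential hy z v = ctransp (V z) **
      (\<i> *\<^sub>C (v *\<^sub>C ?b' - cnj v *\<^sub>C ctransp ?b' + (cnj v - v) *\<^sub>C k)) ** V z"
    by (simp only: dy)
qed

text \<open>Besides the terms with \<open>b'\<close>, which give the Hopf differential, differentiating \<open>V\<close> contributes twice the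
  inner product of \<open>b\<^sup>* b\<close> with the normal of \<open>b\<close>, that is \<open>m\<close>: this is the mean curvature 1 of the surfaces
  in \<open>H3\<close>.\<close>

lemma second_form_null:
  assumes z: "z \<in> D"
  defines "q \<equiv> ip (mderiv b z) (null_normal (b z))"
  shows "- ip (differential h z v) (differential unit_normal_field z v)
    = q * v\<^sup>2 + of_real (base_rate M) * (metric h z * of_real ((norm v)\<^sup>2)) + cnj q * (cnj v)\<^sup>2"
proof -
  let ?n = "null_normal (b z)" and ?e = "complex_of_real (base_rate M)"
  let ?m = "complex_of_real (null_length (b z))"
  note null = null_matrix[OF b_null[OF z]]
  have "?n \<in> hermitian"
    using null(7) by (simp add: positive_E3_def E3_def)
  then have conj_q: "ip (ctransp (mderiv b z)) ?n = cnj q"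
    using ip_ctransp[of "mderiv b z" ?n] by (simp add: q_def hermitian_def)
  have a: "ip (differential hx z v) (unit_normal_field z) = v * q + cnj v * cnj q + (v + cnj v) * (?e * (?m / 2))"
    by (simp add: second_derivatives[OF z] unit_normal_field_def ip_V[OF z] ip_add ip_cscale null(6) conj_q flip: q_def)
  have d: "ip (x - y) w = ip x w - ip y w" for x y w
    by (simp add: ip_expand field_simps)
  have c: "ip (differential hy z v) (unit_normal_field z) = \<i> * (v * q - cnj v * cnj q + (cnj v - v) * (?e * (?m / 2)))"
    by (simp add: second_derivatives[OF z] unit_normal_field_def ip_V[OF z] ip_add ip_cscale d null(6) conj_q flip: q_def)
  define x where "x = complex_of_real (Re v)"
  define y where "y = complex_of_real (Im v)"
  have v: "v = x + \<i> * y" "cnj v = x - \<i> * y"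
    by (simp_all add: x_def y_def complex_eq_iff)
  have "- ip (differential h z v) (differential unit_normal_field z v)
      = x * (v * q + cnj v * cnj q + (v + cnj v) * (?e * (?m / 2)))
      + y * (\<i> * (v * q - cnj v * cnj q + (cnj v - v) * (?e * (?m / 2))))"
    unfolding second_form[OF z] a c by (simp only: scaleR_conv_of_real x_def y_def)
  also have "\<dots> = v * v * q + cnj v * cnj v * cnj q + 2 * (?e * (?m / 2)) * (v * cnj v)"
  proof -
    have "x * ((x + \<i> * y) * q + (x - \<i> * y) * r + ((x + \<i> * y) + (x - \<i> * y)) * t)
        + y * (\<i> * ((x + \<i> * y) * q - (x - \<i> * y) * r + ((x - \<i> * y) - (x + \<i> * y)) * t))
      = (x + \<i> * y) * (x + \<i> * y) * q + (x - \<i> * y) * (x - \<i> * y) * r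
        + 2 * t * ((x + \<i> * y) * (x - \<i> * y))" for r t
      by (simp add: algebra_simps)
    then show ?thesis
      unfolding v(2) unfolding v(1) .
  qed
  finally show ?thesis
    unfolding complex_norm_square metric_h[OF z] by (simp add: power2_eq_square mult_ac)
qed

lemma hopf_and_mean_curvature:
  "has_hopf_and_mean_curvature M D h (\<lambda>z. ip (mderiv b z) (null_normal (b z))) (\<lambda>_. mean_curvature_of M)"
proof -
  have "mean_curvature_of M = base_rate M"
    by (cases M) simp_all
  then show ?thesis
    unfolding has_hopf_and_mean_curvature_def
    by (intro exI[of _ unit_normal_field] conjI normal ballI allI) (simp only: second_form_null)
qed

end

section \<open>Congruence of surfaces with equal data\<close>

lemma surfaceI:
  assumes "open D" "conformal_immersion M D h" "unit_normal M D h N" "\<And>z. z \<in> D \<Longrightarrow> metric h z = of_real (m z)"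
  shows "surface M D h N m"
  using assms by unfold_locales

lemma hopf_form:
  assumes "has_hopf_and_mean_curvature M D h Q H"
  obtains N where "unit_normal M D h N"
    "\<And>z v. z \<in> D \<Longrightarrow> - ip (differential h z v) (differential N z v) =
      Q z * v\<^sup>2 + of_real (H z) * (metric h z * of_real ((norm v)\<^sup>2)) + cnj (Q z) * (cnj v)\<^sup>2"
  using assms unfolding has_hopf_and_mean_curvature_def by blast

lemma hopf_cong:
  assumes "has_hopf_and_mean_curvature M D h Q H" "\<And>z. z \<in> D \<Longrightarrow> Q' z = Q z"
  shows "has_hopf_and_mean_curvature M D h Q' H"
proof -
  obtain N where N: "unit_normal M D h N"
    "\<And>z v. z \<in> D \<Longrightarrow> - ip (differential h z v) (differential N z v) =
      Q z * v\<^sup>2 + of_real (H z) * (metric h z * of_real ((norm v)\<^sup>2)) + cnj (Q z) * (cnj v)\<^sup>2"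
    using assms(1) by (rule hopf_form) blast
  show ?thesis
    unfolding has_hopf_and_mean_curvature_def
    by (intro exI[of _ N] conjI N(1) ballI allI) (simp only: N(2) assms(2))
qed

text \<open>The values at \<open>1\<close> and \<open>1 + \<i>\<close> give the real and the imaginary part of \<open>q\<close>.\<close>

lemma quadratic_form_injective:
  assumes "\<And>v. q * v\<^sup>2 + c v + cnj q * (cnj v)\<^sup>2 = q' * v\<^sup>2 + c v + cnj q' * (cnj v)\<^sup>2"
  shows "q = (q' :: complex)"
proof -
  have "q + cnj q = q' + cnj q'" using assms[of 1] by simp
  moreover have "q * (1 + \<i>)\<^sup>2 + cnj q * (cnj (1 + \<i>))\<^sup>2 = q' * (1 + \<i>)\<^sup>2 + cnj q' * (cnj (1 + \<i>))\<^sup>2"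
    using assms[of "1 + \<i>"] by simp
  ultimately show ?thesis
    by (simp add: complex_eq_iff power2_eq_square)
qed

text \<open>Two members of the associated family of \<open>f\<close> may come with different witnesses for the Hopf differential
  of \<open>f\<close>; since the unit normal is unique, the witnesses agree.\<close>

lemma hopf_differential_unique:
  assumes D: "open D" "conformal_immersion M D h" "\<And>z. z \<in> D \<Longrightarrow> metric h z = of_real (m z)"
    and "has_hopf_and_mean_curvature M D h Q H" "has_hopf_and_mean_curvature M D h Q' H" and z: "z \<in> D"
  shows "Q z = Q' z"
proof -
  obtain N where N: "unit_normal M D h N"
    "\<And>z v. z \<in> D \<Longrightarrow> - ip (differential h z v) (differential N z v) =
      Q z * v\<^sup>2 + of_real (H z) * (metric h z * of_real ((norm v)\<^sup>2)) + cnj (Q z) * (cnj v)\<^sup>2"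
    using assms(4) by (rule hopf_form) blast
  obtain N' where N': "unit_normal M D h N'"
    "\<And>z v. z \<in> D \<Longrightarrow> - ip (differential h z v) (differential N' z v) =
      Q' z * v\<^sup>2 + of_real (H z) * (metric h z * of_real ((norm v)\<^sup>2)) + cnj (Q' z) * (cnj v)\<^sup>2"
    using assms(5) by (rule hopf_form) blast
  interpret N: surface M D h N m using D(1,2) N(1) D(3) by (rule surfaceI)
  interpret N': surface M D h N' m using D(1,2) N'(1) D(3) by (rule surfaceI)
  have "N w = N' w" if "w \<in> D" for w
    unfolding N.normal_formula[OF that] N'.normal_formula[OF that] by (rule refl)
  then have "differential N z v = differential N' z v" for v
    by (rule differential_cong_open[OF D(1) z _ differentiableI[OF N'.N_derivative[OF z]]])
  then have "Q z * v\<^sup>2 + of_real (H z) * (metric h z * of_real ((norm v)\<^sup>2)) + cnj (Q z) * (cnj v)\<^sup>2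
      = Q' z * v\<^sup>2 + of_real (H z) * (metric h z * of_real ((norm v)\<^sup>2)) + cnj (Q' z) * (cnj v)\<^sup>2" for v
    unfolding N(2)[OF z, symmetric] N'(2)[OF z, symmetric] by (simp only:)
  then show ?thesis by (rule quadratic_form_injective)
qed

lemma local_congruence:
  assumes D: "open D" and h: "conformal_immersion M D h" "\<And>z. z \<in> D \<Longrightarrow> metric h z = of_real (m z)"
    and k: "conformal_immersion M D k" "\<And>z. z \<in> D \<Longrightarrow> metric k z = of_real (m z)"
    and hopf: "has_hopf_and_mean_curvature M D h Q H" "has_hopf_and_mean_curvature M D k Q' H"
    and Q: "\<And>z. z \<in> D \<Longrightarrow> Q z = Q' z"
    and B: "B \<subseteq> D" "open B" "convex B" "z0 \<in> B"
  shows "\<exists>S c. rigid_motion M S c \<and> (\<forall>z\<in>B. k z = act S (h z) + c)"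
proof -
  obtain N where N: "unit_normal M D h N"
    "\<And>z v. z \<in> D \<Longrightarrow> - ip (differential h z v) (differential N z v) =
      Q z * v\<^sup>2 + of_real (H z) * (metric h z * of_real ((norm v)\<^sup>2)) + cnj (Q z) * (cnj v)\<^sup>2"
    using hopf(1) by (rule hopf_form) blast
  obtain N' where N': "unit_normal M D k N'"
    "\<And>z v. z \<in> D \<Longrightarrow> - ip (differential k z v) (differential N' z v) =
      Q' z * v\<^sup>2 + of_real (H z) * (metric k z * of_real ((norm v)\<^sup>2)) + cnj (Q' z) * (cnj v)\<^sup>2"
    using hopf(2) by (rule hopf_form) blast
  have II: "ip (differential h z v) (differential N z v) = ip (differential k z v) (differential N' z v)"
    if "z \<in> D" for z v
  proof -
    have "- ip (differential h z v) (differential N z v) = - ip (differential k z v) (differential N' z v)"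
      unfolding N(2)[OF that] N'(2)[OF that] Q[OF that] h(2)[OF that] k(2)[OF that] by (rule refl)
    then show ?thesis by (simp only: neg_equal_iff_equal)
  qed
  show ?thesis
    by (rule bonnet_uniqueness[OF surfaceI[OF D h(1) N(1) h(2)] surfaceI[OF D k(1) N'(1) k(2)] II B])
qed

text \<open>A factor \<open>\<mu>\<close> in \<open>b\<close> leaves the unit normal of \<open>b\<close> unchanged and multiplies \<open>b'\<close> by \<open>\<mu>\<close>, hence the Hopf
  differential too.\<close>

lemma associated_null_surfaces:
  assumes f: "null_surface M D f V b" and g: "null_surface M D g W (\<lambda>z. \<mu> *\<^sub>C b z)" and \<mu>: "\<mu> \<noteq> 0"
  shows "conformal_immersion M D f" "conformal_immersion M D g"
    "\<And>z. z \<in> D \<Longrightarrow> metric f z = of_real (null_length (b z))"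
    "\<And>z. z \<in> D \<Longrightarrow> metric g z = of_real ((norm \<mu>)\<^sup>2) * metric f z"
    "\<exists>Q. has_hopf_and_mean_curvature M D f Q (\<lambda>_. mean_curvature_of M) \<and>
       has_hopf_and_mean_curvature M D g (\<lambda>z. \<mu> * Q z) (\<lambda>_. mean_curvature_of M)"
proof -
  interpret f: null_surface M D f V b by (rule f)
  interpret g: null_surface M D g W "\<lambda>z. \<mu> *\<^sub>C b z" by (rule g)
  show "conformal_immersion M D f" "conformal_immersion M D g"
    by (rule f.conformal, rule g.conformal)
  show "metric f z = of_real (null_length (b z))" if "z \<in> D" for z
    by (rule f.metric_h[OF that])
  show "metric g z = of_real ((norm \<mu>)\<^sup>2) * metric f z" if "z \<in> D" for z
    by (simp add: f.metric_h[OF that] g.metric_h[OF that] null_cscale[OF \<mu>])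
  have "mderiv (\<lambda>z. \<mu> *\<^sub>C b z) z = \<mu> *\<^sub>C mderiv b z" if "z \<in> D" for z
  proof (rule mderiv_eq)
    have "((\<lambda>z. \<mu> *\<^sub>C b z) has_derivative (\<lambda>v. \<mu> *\<^sub>C (v *\<^sub>C mderiv b z))) (at z)"
      by (rule cscale_has_derivative[OF
          holomorphic_matrix_has_derivative[OF f.open_D f.b_holomorphic that]])
    then show "((\<lambda>z. \<mu> *\<^sub>C b z) has_derivative (\<lambda>v. v *\<^sub>C \<mu> *\<^sub>C mderiv b z)) (at z)"
      by (simp add: cscale_distrib mult.commute)
  qed
  then have "has_hopf_and_mean_curvature M D g (\<lambda>z. \<mu> * ip (mderiv b z) (null_normal (b z))) (\<lambda>_. mean_curvature_of M)"
    by (intro hopf_cong[OF g.hopf_and_mean_curvature]) (simp add: null_cscale[OF \<mu>] ip_cscale)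
  with f.hopf_and_mean_curvature
  show "\<exists>Q. has_hopf_and_mean_curvature M D f Q (\<lambda>_. mean_curvature_of M) \<and>
       has_hopf_and_mean_curvature M D g (\<lambda>z. \<mu> * Q z) (\<lambda>_. mean_curvature_of M)"
    by blast
qed

section \<open>LWR frames in a coordinate\<close>

lemma nilpotent_square:
  assumes "nilpotent A" "trace A = 0"
  shows "A ** A = 0"
proof -
  obtain n where n: "(((**) A) ^^ n) (mat 1) = 0"
    using assms(1) by (auto simp: nilpotent_def)
  have "det ((((**) A) ^^ n) (mat 1)) = det A ^ n"
    by (induction n) (simp_all add: det_mult_2)
  then have "det A ^ n = 0"
    using n by (simp add: det_2)
  then have "det A = 0" by simp
  moreover have "A ** A = trace A *\<^sub>C A - det A *\<^sub>C mat 1"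
    by (simp add: cmat_entries algebra_simps)
  ultimately show ?thesis
    using assms(2) by (simp add: cscale_distrib)
qed

locale lwr_chart =
  fixes D :: "complex set" and F :: "complex \<Rightarrow> complex \<Rightarrow> cmat" and A B :: "complex \<Rightarrow> cmat"
  assumes open_D: "open D"
    and F_det: "\<And>z l. z \<in> D \<Longrightarrow> det (F l z) = 1"
    and F_holomorphic: "\<And>l. holomorphic_matrix_on (F l) D"
    and F_parameter: "\<And>z. z \<in> D \<Longrightarrow> holomorphic_matrix_on (\<lambda>l. F l z) UNIV"
    and A_holomorphic: "holomorphic_matrix_on A D"
    and A_null: "\<And>z. z \<in> D \<Longrightarrow> trace (A z) = 0" "\<And>z. z \<in> D \<Longrightarrow> A z ** A z = 0"
    and B_trace: "\<And>z. z \<in> D \<Longrightarrow> trace (B z) = 0"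
    and F_mderiv: "\<And>l z. z \<in> D \<Longrightarrow> mderiv (F l) z = F l z ** (l *\<^sub>C A z + B z)"
begin

text \<open>Up to the factor \<open>l1 - l0\<close> this is the null matrix of both induced surfaces, with \<open>l = l0\<close> in \<open>E3\<close> and
  \<open>l = l1\<close> in \<open>H3\<close>.\<close>

definition conj_A :: "complex \<Rightarrow> complex \<Rightarrow> cmat" where
  "conj_A l z = F l z ** A z ** adjugate (F l z)"

lemma F_inverse: "z \<in> D \<Longrightarrow> F l z ** adjugate (F l z) = mat 1" "z \<in> D \<Longrightarrow> adjugate (F l z) ** F l z = mat 1"
  by (simp_all add: mult_adjugate F_det)

lemma F_cancel: "z \<in> D \<Longrightarrow> X ** F l z ** adjugate (F l z) = X" "z \<in> D \<Longrightarrow> X ** adjugate (F l z) ** F l z = X"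
  by (simp_all add: F_inverse flip: matrix_mul_assoc)

lemma F_derivative: "z \<in> D \<Longrightarrow> (F l has_derivative (\<lambda>v. v *\<^sub>C (F l z ** (l *\<^sub>C A z + B z)))) (at z)"
  using holomorphic_matrix_has_derivative[OF open_D F_holomorphic] by (simp add: F_mderiv)

lemma adjugate_F_derivative:
  "z \<in> D \<Longrightarrow> ((\<lambda>z. adjugate (F l z)) has_derivative
    (\<lambda>v. v *\<^sub>C (- ((l *\<^sub>C A z + B z) ** adjugate (F l z))))) (at z)"
proof -
  assume z: "z \<in> D"
  have t: "trace (l *\<^sub>C A z + B z) = 0"
    using A_null(1)[OF z] B_trace[OF z] by (simp add: trace_linear trace_cscale)
  have "adjugate (v *\<^sub>C X) = v *\<^sub>C adjugate X" for v X
    by (simp add: cmat_entries)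
  then have "adjugate (v *\<^sub>C (F l z ** (l *\<^sub>C A z + B z))) = v *\<^sub>C (- ((l *\<^sub>C A z + B z) ** adjugate (F l z)))" for v
    by (simp only: adjugate_mult adjugate_traceless[OF t] matrix_mult_minus)
  then show ?thesis
    using bounded_linear.has_derivative[OF bounded_linear_adjugate F_derivative[OF z, of l]] by simp
qed

text \<open>The terms with \<open>B\<close> cancel in the difference of the potentials at \<open>l1\<close> and \<open>l0\<close>.\<close>

lemma quotient_derivative:
  assumes z: "z \<in> D"
  shows "((\<lambda>z. F l1 z ** adjugate (F l0 z)) has_derivative
    (\<lambda>v. v *\<^sub>C ((l1 - l0) *\<^sub>C (F l1 z ** A z ** adjugate (F l0 z))))) (at z)"
proof -
  have "F l1 z ** (v *\<^sub>C (- ((l0 *\<^sub>C A z + B z) ** adjugate (F l0 z))))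
      + v *\<^sub>C (F l1 z ** (l1 *\<^sub>C A z + B z)) ** adjugate (F l0 z)
      = v *\<^sub>C ((l1 - l0) *\<^sub>C (F l1 z ** A z ** adjugate (F l0 z)))" for v
  proof -
    have "l1 *\<^sub>C A z + B z = (l0 *\<^sub>C A z + B z) + (l1 - l0) *\<^sub>C A z"
      by (simp add: cmat_entries algebra_simps)
    moreover have "X ** (v *\<^sub>C (- (Y ** Z))) + v *\<^sub>C (X ** (Y + c *\<^sub>C W)) ** Z = v *\<^sub>C (c *\<^sub>C (X ** W ** Z))"
      for X Y Z W :: cmat and c
      by (simp add: cscale_mult cmat_distrib cscale_distrib matrix_mult_minus matrix_mul_assoc)
         (simp add: cmat_eq_iff cscale_nth)
    ultimately show ?thesis by (simp only:)
  qed
  then show ?thesis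
    using matrix_mult_has_derivative[OF F_derivative[OF z, of l1] adjugate_F_derivative[OF z, of l0]] by simp
qed

lemma conj_A_holomorphic: "holomorphic_matrix_on (conj_A l) D"
proof -
  have "\<exists>c'. (conj_A l has_derivative (\<lambda>v. v *\<^sub>C c')) (at z)" if z: "z \<in> D" for z
  proof -
    note A = holomorphic_matrix_has_derivative[OF open_D A_holomorphic z]
    have "X ** Y ** (v *\<^sub>C Z') + (X ** (v *\<^sub>C Y') + v *\<^sub>C X' ** Y) ** Z
        = v *\<^sub>C (X ** Y ** Z' + (X ** Y' + X' ** Y) ** Z)" for X X' Y Y' Z Z' v
      by (simp add: cscale_mult cmat_distrib cscale_distrib)
    with matrix_mult_has_derivative[OF matrix_mult_has_derivative[OF F_derivative[OF z, of l] A] adjugate_F_derivative[OF z, of l]]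
    show ?thesis unfolding conj_A_def by (simp only:) blast
  qed
  then obtain c' where "\<And>z. z \<in> D \<Longrightarrow> (conj_A l has_derivative (\<lambda>v. v *\<^sub>C c' z)) (at z)"
    by metis
  then show ?thesis by (rule holomorphic_matrixI[OF open_D])
qed

lemma conj_A_null:
  assumes z: "z \<in> D"
  shows "trace (conj_A l z) = 0" "conj_A l z ** conj_A l z = 0" "A z \<noteq> 0 \<Longrightarrow> conj_A l z \<noteq> 0"
proof -
  have "trace (conj_A l z) = trace (adjugate (F l z) ** (F l z ** A z))"
    unfolding conj_A_def by (rule trace_mult_commute)
  then show "trace (conj_A l z) = 0"
    using A_null(1)[OF z] by (simp add: matrix_mul_assoc F_inverse[OF z])
  have "conj_A l z ** conj_A l z = F l z ** (A z ** A z) ** adjugate (F l z)"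
    unfolding conj_A_def by (simp add: matrix_mul_assoc F_cancel[OF z])
  then show "conj_A l z ** conj_A l z = 0"
    using A_null(2)[OF z] by simp
  have "adjugate (F l z) ** conj_A l z ** F l z = A z"
    unfolding conj_A_def by (simp add: matrix_mul_assoc F_cancel[OF z] F_inverse[OF z])
  then show "A z \<noteq> 0 \<Longrightarrow> conj_A l z \<noteq> 0" by auto
qed

text \<open>The equation \<open>dV = b V dz\<close> of the hyperbolic surface.\<close>

lemma quotient_derivative_left:
  assumes z: "z \<in> D"
  shows "((\<lambda>z. F l1 z ** adjugate (F l0 z)) has_derivative
    (\<lambda>v. v *\<^sub>C ((l1 - l0) *\<^sub>C (conj_A l1 z ** (F l1 z ** adjugate (F l0 z)))))) (at z)"
  using quotient_derivative[OF z, of l1 l0] by (simp add: conj_A_def matrix_mul_assoc F_cancel[OF z])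

text \<open>A linear equation for the quotient whose coefficient, apart from the factor \<open>l1 - l0\<close>, does not depend
  on \<open>l1\<close>.\<close>

lemma quotient_derivative_right:
  assumes z: "z \<in> D"
  shows "((\<lambda>z. F l1 z ** adjugate (F l0 z)) has_derivative
    (\<lambda>v. v *\<^sub>C ((l1 - l0) *\<^sub>C (F l1 z ** adjugate (F l0 z) ** conj_A l0 z)))) (at z)"
  using quotient_derivative[OF z, of l1 l0] by (simp add: conj_A_def matrix_mul_assoc F_cancel[OF z])

end

context lwr_chart
begin

lemma F_parameter_derivative:
  "z \<in> D \<Longrightarrow> ((\<lambda>l. F l z) has_derivative (\<lambda>v. v *\<^sub>C mderiv (\<lambda>l. F l z) l0)) (at l0)"
  by (rule holomorphic_matrix_has_derivative[OF open_UNIV F_parameter]) simp_all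

text \<open>The quotient solves a linear equation with coefficient proportional to \<open>l - l0\<close>. If \<open>m\<close> is the maximum
  of its norm on the disk, the mean value inequality bounds its oscillation by \<open>norm (l - l0) * c * m\<close>. For \<open>l\<close>
  near \<open>l0\<close> this is at most \<open>m / 2\<close>, which bounds \<open>m\<close> by the value at the centre; and there continuity in \<open>l\<close>
  suffices.\<close>

lemma quotient_uniformly_close:
  assumes S: "cball z0 r \<subseteq> D" "0 < r" and e: "0 < e"
  shows "\<forall>\<^sub>F l in at l0. \<forall>z\<in>cball z0 r. norm (F l z ** adjugate (F l0 z) - mat 1) \<le> e"
proof -
  define S where "S = cball z0 r"
  have SD: "z \<in> D" if "z \<in> S" for z using S(1) that by (auto simp: S_def)
  have z0: "z0 \<in> S" using S(2) by (simp add: S_def)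
  have "compact S" "S \<noteq> {}" using z0 by (auto simp: S_def)
  define \<theta> where "\<theta> l z = F l z ** adjugate (F l0 z)" for l z
  obtain K where K: "0 < K" "\<And>(X::cmat) (Y::cmat). norm (X ** Y) \<le> norm X * norm Y * K"
    using bounded_bilinear.pos_bounded[OF bounded_bilinear_matrix_mult] by blast
  have "continuous_on S (conj_A l0)"
    using holomorphic_matrix_has_derivative[OF open_D conj_A_holomorphic SD]
    by (intro continuous_at_imp_continuous_on ballI has_derivative_continuous) blast
  then have "bounded (conj_A l0 ` S)"
    using \<open>compact S\<close> compact_continuous_image compact_imp_bounded by blast
  then obtain C where C: "0 < C" "\<And>z. z \<in> S \<Longrightarrow> norm (conj_A l0 z) \<le> C"
    unfolding bounded_pos by auto
  define c where "c = K * C * r"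
  have c: "0 < c" using K C S(2) by (simp add: c_def)
  have close: "norm (\<theta> l z - mat 1) \<le> norm (\<theta> l z0 - mat 1) + norm (l - l0) * c * (2 * norm (\<theta> l z0))"
    if l: "norm (l - l0) * c \<le> 1/2" and z: "z \<in> S" for l z
  proof -
    have der: "(\<theta> l has_derivative (\<lambda>v. v *\<^sub>C ((l - l0) *\<^sub>C (\<theta> l z ** conj_A l0 z)))) (at z)" if "z \<in> S" for z
      unfolding \<theta>_def by (rule quotient_derivative_right[OF SD[OF that]])
    have "continuous_on S (\<lambda>z. norm (\<theta> l z))"
      using der by (intro continuous_on_norm continuous_at_imp_continuous_on ballI has_derivative_continuous) blast
    then obtain x where x: "x \<in> S" "\<And>y. y \<in> S \<Longrightarrow> norm (\<theta> l y) \<le> norm (\<theta> l x)"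
      using continuous_attains_sup[OF \<open>compact S\<close> \<open>S \<noteq> {}\<close>] by blast
    define m where "m = norm (\<theta> l x)"
    have m0: "0 \<le> m" by (simp add: m_def)
    have bound: "norm (\<theta> l y - \<theta> l z0) \<le> norm (l - l0) * c * m" if y: "y \<in> S" for y
    proof -
      have "norm (\<theta> l y - \<theta> l z0) \<le> (norm (l - l0) * (m * C * K)) * norm (y - z0)"
      proof (rule differentiable_bound[of S])
        show "convex S" by (simp add: S_def)
        show "(\<theta> l has_derivative (\<lambda>v. v *\<^sub>C ((l - l0) *\<^sub>C (\<theta> l z ** conj_A l0 z)))) (at z within S)" if "z \<in> S" for z
          by (rule has_derivative_at_withinI[OF der[OF that]])
        show "onorm (\<lambda>v. v *\<^sub>C ((l - l0) *\<^sub>C (\<theta> l z ** conj_A l0 z))) \<le> norm (l - l0) * (m * C * K)" if "z \<in> S" for z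
        proof (rule onorm_bound)
          have "norm (\<theta> l z ** conj_A l0 z) \<le> norm (\<theta> l z) * norm (conj_A l0 z) * K" by (rule K(2))
          also have "\<dots> \<le> m * C * K"
            using x(2)[OF that] C(2)[OF that] K(1) m0 by (intro mult_right_mono mult_mono) (auto simp: m_def)
          finally have n: "norm (\<theta> l z ** conj_A l0 z) \<le> m * C * K" .
          fix v
          have "norm (v *\<^sub>C ((l - l0) *\<^sub>C (\<theta> l z ** conj_A l0 z))) = norm v * (norm (l - l0) * norm (\<theta> l z ** conj_A l0 z))"
            by (simp only: norm_cscale)
          also have "\<dots> \<le> norm v * (norm (l - l0) * (m * C * K))"
            by (intro mult_left_mono n) auto
          finally show "norm (v *\<^sub>C ((l - l0) *\<^sub>C (\<theta> l z ** conj_A l0 z))) \<le> norm (l - l0) * (m * C * K) * norm v"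
            by (simp only: mult.commute)
        qed (use m0 C(1) K(1) in simp)
      qed (use y z0 in auto)
      also have "\<dots> \<le> (norm (l - l0) * (m * C * K)) * r"
        using y m0 C(1) K(1) by (intro mult_left_mono) (auto simp: S_def dist_norm norm_minus_commute)
      also have "\<dots> = norm (l - l0) * c * m" by (simp only: c_def mult_ac)
      finally show ?thesis .
    qed
    have "m \<le> norm (\<theta> l z0) + norm (\<theta> l x - \<theta> l z0)"
      using norm_triangle_sub[of "\<theta> l x" "\<theta> l z0"] by (simp add: m_def)
    also have "\<dots> \<le> norm (\<theta> l z0) + norm (l - l0) * c * m"
      using bound[OF x(1)] by simp
    also have "\<dots> \<le> norm (\<theta> l z0) + 1/2 * m"
      using l m0 by (intro add_left_mono mult_right_mono)
    finally have "m \<le> 2 * norm (\<theta> l z0)" by simp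
    then have "norm (l - l0) * c * m \<le> norm (l - l0) * c * (2 * norm (\<theta> l z0))"
      using c by (intro mult_left_mono) auto
    then show ?thesis
      using bound[OF z] norm_triangle_ineq[of "\<theta> l z0 - mat 1" "\<theta> l z - \<theta> l z0"] by simp
  qed
  have "continuous (at l0) (\<lambda>l. F l z0)"
    using F_parameter_derivative[OF SD[OF z0]] by (rule has_derivative_continuous)
  then have "((\<lambda>l. F l z0 ** adjugate (F l0 z0)) \<longlongrightarrow> F l0 z0 ** adjugate (F l0 z0)) (at l0)"
    by (intro bounded_bilinear.tendsto[OF bounded_bilinear_matrix_mult] tendsto_const) (simp add: continuous_at)
  then have lim: "((\<lambda>l. \<theta> l z0) \<longlongrightarrow> mat 1) (at l0)"
    by (simp add: \<theta>_def F_inverse[OF SD[OF z0]])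
  have "((\<lambda>l. norm (\<theta> l z0 - mat 1) + norm (l - l0) * c * (2 * norm (\<theta> l z0)))
      \<longlongrightarrow> norm (mat 1 - mat 1 :: cmat) + norm (l0 - l0) * c * (2 * norm (mat 1 :: cmat))) (at l0)"
    by (intro tendsto_intros lim)
  then have ev1: "\<forall>\<^sub>F l in at l0. norm (\<theta> l z0 - mat 1) + norm (l - l0) * c * (2 * norm (\<theta> l z0)) < e"
    using e by (intro order_tendstoD) auto
  have "((\<lambda>l. norm (l - l0) * c) \<longlongrightarrow> norm (l0 - l0) * c) (at l0)"
    by (intro tendsto_intros)
  then have ev2: "\<forall>\<^sub>F l in at l0. norm (l - l0) * c < 1/2"
    by (intro order_tendstoD) auto
  show "\<forall>\<^sub>F l in at l0. \<forall>z\<in>cball z0 r. norm (F l z ** adjugate (F l0 z) - mat 1) \<le> e"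
    using ev1 ev2
  proof eventually_elim
    case (elim l)
    show ?case
    proof
      fix z assume "z \<in> cball z0 r"
      then have z: "z \<in> S" by (simp add: S_def)
      have "norm (\<theta> l z - mat 1) \<le> e"
        using close[OF less_imp_le[OF elim(2)] z] elim(1) by linarith
      then show "norm (F l z ** adjugate (F l0 z) - mat 1) \<le> e"
        by (simp only: \<theta>_def)
    qed
  qed
qed

definition psi :: "complex \<Rightarrow> complex \<Rightarrow> cmat" where
  "psi l0 z = mderiv (\<lambda>l. F l z) l0 ** adjugate (F l0 z)"

text \<open>The frame is only known to be holomorphic in \<open>l\<close> and in \<open>z\<close> separately. The difference quotients in \<open>l\<close>
  converge to \<open>psi\<close>, and by \<open>quotient_derivative_right\<close> their derivatives in \<open>z\<close> are the quotient of frames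
  times \<open>conj_A\<close>, which converge uniformly by
  \<open>quotient_uniformly_close\<close>; so the two derivatives may be exchanged.\<close>

lemma psi_derivative:
  assumes z0: "z0 \<in> D"
  shows "(psi l0 has_derivative (\<lambda>v. v *\<^sub>C conj_A l0 z0)) (at z0)"
proof -
  obtain r where r: "0 < r" "cball z0 r \<subseteq> D"
    using open_D z0 open_contains_cball by blast
  define S where "S = cball z0 r"
  have SD: "z \<in> D" if "z \<in> S" for z using r(2) that by (auto simp: S_def)
  define e where "e n = inverse (real (Suc n))" for n
  have e: "0 < e n" for n by (simp add: e_def)
  have e0: "e \<longlonglongrightarrow> 0" unfolding e_def by (rule LIMSEQ_inverse_real_of_nat)
  define l where "l n = l0 + of_real (e n)" for n
  have l: "filterlim l (at l0) sequentially"
  proof (rule filterlim_atI)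
    have "(\<lambda>n. l0 + of_real (e n)) \<longlonglongrightarrow> l0 + of_real 0"
      by (intro tendsto_intros e0)
    then show "l \<longlonglongrightarrow> l0" by (simp add: l_def[abs_def])
    show "\<forall>\<^sub>F n in sequentially. l n \<noteq> l0"
      using e by (simp add: l_def less_imp_neq[symmetric])
  qed
  define f where "f n z = inverse (of_real (e n)) *\<^sub>C (F (l n) z ** adjugate (F l0 z) - mat 1)" for n z
  obtain K where K: "0 < K" "\<And>(X::cmat) (Y::cmat). norm (X ** Y) \<le> norm X * norm Y * K"
    using bounded_bilinear.pos_bounded[OF bounded_bilinear_matrix_mult] by blast
  have "continuous_on S (conj_A l0)"
    using holomorphic_matrix_has_derivative[OF open_D conj_A_holomorphic SD]
    by (intro continuous_at_imp_continuous_on ballI has_derivative_continuous) blast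
  then have "bounded (conj_A l0 ` S)"
    using compact_continuous_image[OF _ compact_cball] compact_imp_bounded unfolding S_def by blast
  then obtain C where C: "0 < C" "\<And>z. z \<in> S \<Longrightarrow> norm (conj_A l0 z) \<le> C"
    unfolding bounded_pos by auto
  have lim: "(\<lambda>n. f n z) \<longlonglongrightarrow> psi l0 z" if "z \<in> S" for z
  proof -
    have z: "z \<in> D" using that by (rule SD)
    have entry: "(\<lambda>n. (inverse (of_real (e n)) *\<^sub>C (F (l n) z - F l0 z))$i$j) \<longlonglongrightarrow> mderiv (\<lambda>l. F l z) l0$i$j" for i j
    proof -
      have "((\<lambda>l. F l z$i$j) has_field_derivative mderiv (\<lambda>l. F l z) l0$i$j) (at l0)"
        by (rule cmat_has_derivative_entry[OF F_parameter_derivative[OF z]])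
      then have "((\<lambda>x. (F x z$i$j - F l0 z$i$j) / (x - l0)) \<longlongrightarrow> mderiv (\<lambda>l. F l z) l0$i$j) (at l0)"
        by (simp only: has_field_derivative_iff)
      from filterlim_compose[OF this l] show ?thesis
        by (simp add: l_def cscale_nth field_simps)
    qed
    have "(\<lambda>n. inverse (of_real (e n)) *\<^sub>C (F (l n) z - F l0 z)) \<longlonglongrightarrow> mderiv (\<lambda>l. F l z) l0"
      by (intro vec_tendstoI entry)
    then have "(\<lambda>n. inverse (of_real (e n)) *\<^sub>C (F (l n) z - F l0 z) ** adjugate (F l0 z)) \<longlonglongrightarrow> psi l0 z"
      unfolding psi_def
      by (intro bounded_bilinear.tendsto[OF bounded_bilinear_matrix_mult] tendsto_const)
    then show ?thesis
      by (simp add: f_def cscale_mult cmat_distrib F_inverse[OF z])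
  qed
  have der: "(f n has_derivative (\<lambda>v. v *\<^sub>C (F (l n) z ** adjugate (F l0 z) ** conj_A l0 z))) (at z within S)" if "z \<in> S" for n z
  proof -
    have "((\<lambda>z. F (l n) z ** adjugate (F l0 z) - mat 1) has_derivative
        (\<lambda>v. v *\<^sub>C (of_real (e n) *\<^sub>C (F (l n) z ** adjugate (F l0 z) ** conj_A l0 z)) - 0)) (at z)"
      using quotient_derivative_right[OF SD[OF that], of "l n" l0]
      by (intro has_derivative_diff has_derivative_const) (simp add: l_def)
    from cscale_has_derivative[OF this]
    have "(f n has_derivative (\<lambda>v. inverse (of_real (e n)) *\<^sub>C (v *\<^sub>C
        (of_real (e n) *\<^sub>C (F (l n) z ** adjugate (F l0 z) ** conj_A l0 z)) - 0))) (at z)"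
      unfolding f_def .
    moreover have "inverse (of_real (e n)) *\<^sub>C (v *\<^sub>C (of_real (e n) *\<^sub>C X) - 0) = v *\<^sub>C X" for v X
      using less_imp_neq[OF e[of n]] by (simp add: cscale_distrib field_simps)
    ultimately show ?thesis
      by (simp only: has_derivative_at_withinI)
  qed
  have "\<exists>g. \<forall>z\<in>S. (\<lambda>n. f n z) \<longlonglongrightarrow> g z \<and> (g has_derivative (\<lambda>v. v *\<^sub>C conj_A l0 z)) (at z within S)"
  proof (rule has_derivative_sequence[OF _ der])
    show "convex S" by (simp add: S_def)
    show "z0 \<in> S" using r by (simp add: S_def)
    then show "(\<lambda>n. f n z0) \<longlonglongrightarrow> psi l0 z0" by (rule lim)
    fix d :: real assume d: "0 < d"
    have "\<forall>\<^sub>F n in sequentially. \<forall>z\<in>cball z0 r. norm (F (l n) z ** adjugate (F l0 z) - mat 1) \<le> d / (C * K)"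
    proof -
      have "0 < d / (C * K)" using d C(1) K(1) by simp
      then have "\<forall>\<^sub>F l in at l0. \<forall>z\<in>cball z0 r. norm (F l z ** adjugate (F l0 z) - mat 1) \<le> d / (C * K)"
        by (rule quotient_uniformly_close[OF r(2,1)])
      then show ?thesis
        using l by (rule eventually_compose_filterlim)
    qed
    then show "\<forall>\<^sub>F n in sequentially. \<forall>z\<in>S. \<forall>v. norm (v *\<^sub>C (F (l n) z ** adjugate (F l0 z) ** conj_A l0 z)
        - v *\<^sub>C conj_A l0 z) \<le> d * norm v"
    proof eventually_elim
      case (elim n)
      show ?case
      proof (intro ballI allI)
        fix z v assume z: "z \<in> S"
        let ?X = "F (l n) z ** adjugate (F l0 z)"
        have "v *\<^sub>C (?X ** conj_A l0 z) - v *\<^sub>C conj_A l0 z = v *\<^sub>C ((?X - mat 1) ** conj_A l0 z)"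
          by (simp add: cmat_distrib cscale_distrib)
        then have "norm (v *\<^sub>C (?X ** conj_A l0 z) - v *\<^sub>C conj_A l0 z) = norm v * norm ((?X - mat 1) ** conj_A l0 z)"
          by (simp only: norm_cscale)
        also have "\<dots> \<le> norm v * (norm (?X - mat 1) * norm (conj_A l0 z) * K)"
          by (intro mult_left_mono K(2)) simp
        also have "\<dots> \<le> norm v * (d / (C * K) * C * K)"
          using elim z C K d by (intro mult_left_mono mult_right_mono mult_mono) (auto simp: S_def)
        also have "\<dots> = d * norm v"
          using C K by simp
        finally show "norm (v *\<^sub>C (?X ** conj_A l0 z) - v *\<^sub>C conj_A l0 z) \<le> d * norm v" .
      qed
    qed
  qed
  then obtain g where gall: "\<forall>z\<in>S. (\<lambda>n. f n z) \<longlonglongrightarrow> g z \<and> (g has_derivative (\<lambda>v. v *\<^sub>C conj_A l0 z)) (at z within S)" ..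
  note g = bspec[OF gall, THEN conjunct1] bspec[OF gall, THEN conjunct2]
  have sub: "ball z0 r \<subseteq> S"
    unfolding S_def by (rule ball_subset_cball)
  have eq: "g z = psi l0 z" if "z \<in> ball z0 r" for z
  proof (rule LIMSEQ_unique)
    have z: "z \<in> S" using sub that by blast
    show "(\<lambda>n. f n z) \<longlonglongrightarrow> g z" by (rule g(1)[OF z])
    show "(\<lambda>n. f n z) \<longlonglongrightarrow> psi l0 z" by (rule lim[OF z])
  qed
  have "z0 \<in> ball z0 r" using r(1) by simp
  then have "z0 \<in> interior S" "z0 \<in> S"
    using sub interior_maximal[OF sub open_ball] by blast+
  then have "(g has_derivative (\<lambda>v. v *\<^sub>C conj_A l0 z0)) (at z0)"
    using g(2)[of z0] at_within_interior[of z0 S] by simp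
  then show ?thesis
    by (rule has_derivative_transform_within_open[OF _ open_ball \<open>z0 \<in> ball z0 r\<close> eq])
qed

text \<open>This trace is the derivative in \<open>l\<close> of the constant determinant.\<close>

lemma trace_psi:
  assumes z: "z \<in> D"
  shows "trace (psi l0 z) = 0"
proof -
  have d: "((\<lambda>l. F l z$i$j) has_field_derivative mderiv (\<lambda>l. F l z) l0$i$j) (at l0)" for i j
    by (rule cmat_has_derivative_entry[OF F_parameter_derivative[OF z]])
  have "((\<lambda>l. F l z$1$1 * F l z$2$2 - F l z$1$2 * F l z$2$1) has_field_derivative trace (psi l0 z)) (at l0)"
    by (rule DERIV_cong[OF DERIV_diff[OF DERIV_mult[OF d d] DERIV_mult[OF d d]]])
       (simp add: psi_def cmat_entries algebra_simps)
  then have "((\<lambda>l. 1) has_field_derivative trace (psi l0 z)) (at l0)"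
    using F_det[OF z] by (simp add: det_2)
  then show ?thesis
    by (rule DERIV_unique) (rule DERIV_const)
qed

end

lemma holomorphic_matrix_on_subset: "holomorphic_matrix_on F D \<Longrightarrow> D' \<subseteq> D \<Longrightarrow> holomorphic_matrix_on F D'"
  unfolding holomorphic_matrix_on_def using holomorphic_on_subset by blast

lemma holomorphic_matrix_cscale:
  assumes "holomorphic_matrix_on F D"
  shows "holomorphic_matrix_on (\<lambda>z. c *\<^sub>C F z) D"
  using assms unfolding holomorphic_matrix_on_def cscale_nth by (auto intro: holomorphic_intros)

context lwr_chart
begin

lemma scaled_conj_A:
  assumes "D' \<subseteq> D" "\<And>z. z \<in> D' \<Longrightarrow> A z \<noteq> 0" "c \<noteq> 0"
  shows "holomorphic_matrix_on (\<lambda>z. c *\<^sub>C conj_A l z) D'"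
    "\<And>z. z \<in> D' \<Longrightarrow> trace (c *\<^sub>C conj_A l z) = 0"
    "\<And>z. z \<in> D' \<Longrightarrow> (c *\<^sub>C conj_A l z) ** (c *\<^sub>C conj_A l z) = 0"
    "\<And>z. z \<in> D' \<Longrightarrow> c *\<^sub>C conj_A l z \<noteq> 0"
proof -
  show "holomorphic_matrix_on (\<lambda>z. c *\<^sub>C conj_A l z) D'"
    by (rule holomorphic_matrix_cscale[OF holomorphic_matrix_on_subset[OF conj_A_holomorphic assms(1)]])
  fix z assume z': "z \<in> D'"
  then have z: "z \<in> D" using assms(1) by blast
  show "trace (c *\<^sub>C conj_A l z) = 0" "(c *\<^sub>C conj_A l z) ** (c *\<^sub>C conj_A l z) = 0"
    using conj_A_null(1,2)[OF z] by (simp_all add: trace_cscale cscale_mult cscale_distrib)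
  show "c *\<^sub>C conj_A l z \<noteq> 0"
  proof
    assume "c *\<^sub>C conj_A l z = 0"
    then have "inverse c *\<^sub>C (c *\<^sub>C conj_A l z) = 0" by (simp add: cscale_distrib)
    then have "conj_A l z = 0" using assms(3) by (simp add: cscale_distrib)
    then show False using conj_A_null(3)[OF z assms(2)[OF z']] by blast
  qed
qed

lemma matrix_inv_F: "z \<in> D \<Longrightarrow> matrix_inv (F l z) = adjugate (F l z)"
  by (rule matrix_inv_SL2[OF F_det])

lemma null_surface_euclidean:
  assumes D': "open D'" "D' \<subseteq> D" "\<And>z. z \<in> D' \<Longrightarrow> A z \<noteq> 0" and l: "l0 \<noteq> l1"
  shows "null_surface Euclidean D' (induced_E F l0 l1) (\<lambda>_. mat 1) (\<lambda>z. (l1 - l0) *\<^sub>C conj_A l0 z)"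
proof -
  define \<psi> where "\<psi> z = (l1 - l0) *\<^sub>C psi l0 z" for z
  have f: "induced_E F l0 l1 z = \<psi> z + ctransp (\<psi> z)" if "z \<in> D'" for z
    using that D'(2) by (auto simp: induced_E_def Let_def \<psi>_def psi_def matrix_inv_F)
  have \<psi>: "(\<psi> has_derivative (\<lambda>v. v *\<^sub>C ((l1 - l0) *\<^sub>C conj_A l0 z))) (at z)" if "z \<in> D'" for z
  proof -
    have z: "z \<in> D" using that D'(2) by blast
    have "(\<psi> has_derivative (\<lambda>v. (l1 - l0) *\<^sub>C (v *\<^sub>C conj_A l0 z))) (at z)"
      unfolding \<psi>_def
      by (rule cscale_has_derivative[OF
          psi_derivative[OF z]])
    then show ?thesis by (simp add: cscale_distrib mult.commute)
  qed
  have one: "ctransp (mat 1) = mat 1" by (simp add: cmat_entries)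
  show ?thesis
  proof
    show "open D'" by (rule D'(1))
    have ck: "Ck_on n D' (\<lambda>z. \<psi> z + ctransp (\<psi> z))" for n
      by (intro Ck_on_add[OF D'(1)] Ck_on_bounded_linear[OF D'(1) bounded_linear_ctransp]
          Ck_on_holomorphic[OF D'(1)] holomorphic_matrixI[OF D'(1) \<psi>])
    show "smooth_on D' (induced_E F l0 l1)"
      unfolding smooth_on_def by (intro allI Ck_on_cong[OF D'(1) _ ck]) (rule f)
    show "induced_E F l0 l1 z \<in> points Euclidean" if "z \<in> D'" for z
    proof -
      have "trace (\<psi> z) = 0"
        using trace_psi[of z l0] that D'(2) by (auto simp: \<psi>_def trace_cscale)
      then show ?thesis
        unfolding f[OF that]
        by (simp add: E3_def hermitian_def ctransp_linear ctransp_ctransp trace_linear trace_ctransp add.commute)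
    qed
    show "(induced_E F l0 l1 has_derivative (\<lambda>v. ctransp (mat 1) ** (v *\<^sub>C ((l1 - l0) *\<^sub>C conj_A l0 z)
        + cnj v *\<^sub>C ctransp ((l1 - l0) *\<^sub>C conj_A l0 z)) ** mat 1)) (at z)" if "z \<in> D'" for z
    proof -
      have "((\<lambda>z. \<psi> z + ctransp (\<psi> z)) has_derivative (\<lambda>v. v *\<^sub>C ((l1 - l0) *\<^sub>C conj_A l0 z)
          + ctransp (v *\<^sub>C ((l1 - l0) *\<^sub>C conj_A l0 z)))) (at z)"
        by (rule has_derivative_add[OF \<psi>[OF that] ctransp_has_derivative[OF \<psi>[OF that]]])
      then have "(induced_E F l0 l1 has_derivative (\<lambda>v. v *\<^sub>C ((l1 - l0) *\<^sub>C conj_A l0 z)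
          + ctransp (v *\<^sub>C ((l1 - l0) *\<^sub>C conj_A l0 z)))) (at z)"
        by (rule has_derivative_transform_within_open[OF _ D'(1) that]) (simp add: f)
      then show ?thesis by (simp add: one ctransp_linear(3))
    qed
    show "((\<lambda>_. mat 1) has_derivative (\<lambda>v. (of_real (base_rate Euclidean) * v) *\<^sub>C
        ((l1 - l0) *\<^sub>C conj_A l0 z ** mat 1))) (at z)" for z
      by (simp add: cscale_distrib)
    show "base_point Euclidean (induced_E F l0 l1 z) = ctransp (mat 1) ** mat 1" for z
      by (simp add: one)
  qed (use scaled_conj_A[OF D'(2,3)] l in simp_all)
qed

lemma null_surface_hyperbolic:
  assumes D': "open D'" "D' \<subseteq> D" "\<And>z. z \<in> D' \<Longrightarrow> A z \<noteq> 0" and l: "l0 \<noteq> l1"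
  shows "null_surface Hyperbolic D' (induced_H F l0 l1) (\<lambda>z. F l1 z ** adjugate (F l0 z))
    (\<lambda>z. (l1 - l0) *\<^sub>C conj_A l1 z)"
proof -
  define \<Psi> where "\<Psi> z = F l1 z ** adjugate (F l0 z)" for z
  have f: "induced_H F l0 l1 z = ctransp (\<Psi> z) ** \<Psi> z" if "z \<in> D'" for z
    using that D'(2) by (auto simp: induced_H_def Let_def \<Psi>_def matrix_inv_F)
  have \<Psi>: "(\<Psi> has_derivative (\<lambda>v. v *\<^sub>C ((l1 - l0) *\<^sub>C conj_A l1 z ** \<Psi> z))) (at z)" if "z \<in> D'" for z
    using quotient_derivative_left[of z l1 l0] that D'(2) unfolding \<Psi>_def by (auto simp: cscale_mult)
  have det: "det (\<Psi> z) = 1" if "z \<in> D'" for z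
    using that D'(2) by (auto simp: \<Psi>_def det_mult_2 det_adjugate F_det)
  show ?thesis
    unfolding \<Psi>_def[symmetric]
  proof
    show "open D'" by (rule D'(1))
    have ck: "Ck_on n D' (\<lambda>z. ctransp (\<Psi> z) ** \<Psi> z)" for n
      by (intro Ck_on_mult[OF D'(1)] Ck_on_bounded_linear[OF D'(1) bounded_linear_ctransp]
          Ck_on_holomorphic[OF D'(1)] holomorphic_matrixI[OF D'(1) \<Psi>])
    show "smooth_on D' (induced_H F l0 l1)"
      unfolding smooth_on_def by (intro allI Ck_on_cong[OF D'(1) _ ck]) (rule f)
    show "induced_H F l0 l1 z \<in> points Hyperbolic" if "z \<in> D'" for z
      using square_in_H3[of "ctransp (\<Psi> z)"] det[OF that]
      by (simp add: f[OF that] SL2_def det_ctransp ctransp_ctransp)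
    show "(induced_H F l0 l1 has_derivative (\<lambda>v. ctransp (\<Psi> z) ** (v *\<^sub>C ((l1 - l0) *\<^sub>C conj_A l1 z)
        + cnj v *\<^sub>C ctransp ((l1 - l0) *\<^sub>C conj_A l1 z)) ** \<Psi> z)) (at z)" if "z \<in> D'" for z
    proof -
      let ?b = "(l1 - l0) *\<^sub>C conj_A l1 z"
      have "((\<lambda>z. ctransp (\<Psi> z) ** \<Psi> z) has_derivative
          (\<lambda>v. ctransp (\<Psi> z) ** (v *\<^sub>C (?b ** \<Psi> z)) + ctransp (v *\<^sub>C (?b ** \<Psi> z)) ** \<Psi> z)) (at z)"
        by (rule matrix_mult_has_derivative[OF ctransp_has_derivative[OF \<Psi>[OF that]] \<Psi>[OF that]])
      then have "(induced_H F l0 l1 has_derivative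
          (\<lambda>v. ctransp (\<Psi> z) ** (v *\<^sub>C (?b ** \<Psi> z)) + ctransp (v *\<^sub>C (?b ** \<Psi> z)) ** \<Psi> z)) (at z)"
        by (rule has_derivative_transform_within_open[OF _ D'(1) that]) (simp add: f)
      moreover have "ctransp X ** (v *\<^sub>C (Y ** X)) + ctransp (v *\<^sub>C (Y ** X)) ** X
          = ctransp X ** (v *\<^sub>C Y + cnj v *\<^sub>C ctransp Y) ** X" for X Y v
        by (simp add: ctransp_linear(3) ctransp_mult cscale_mult cmat_distrib matrix_mul_assoc)
      ultimately show ?thesis by (simp only:)
    qed
    show "(\<Psi> has_derivative (\<lambda>v. (of_real (base_rate Hyperbolic) * v) *\<^sub>C
        ((l1 - l0) *\<^sub>C conj_A l1 z ** \<Psi> z))) (at z)" if "z \<in> D'" for z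
      using \<Psi>[OF that] by simp
    show "base_point Hyperbolic (induced_H F l0 l1 z) = ctransp (\<Psi> z) ** \<Psi> z" if "z \<in> D'" for z
      by (simp add: f[OF that])
  qed (use scaled_conj_A[OF D'(2,3)] l det in simp_all)
qed

end

section \<open>Connectedness and gluing\<close>

text \<open>The interior of \<open>Z\<close> is open and closed, so it is empty unless \<open>Z\<close> is everything. Then every point has a
  neighbourhood in which the complement of \<open>Z\<close> is connected and accumulates at the point, so a separation of
  the complement extends to one of \<open>X\<close>.\<close>

lemma connected_complement_of_isolated:
  assumes X: "connected_space X"
    and Z: "\<And>p. p \<in> topspace X \<Longrightarrow> (\<exists>U. openin X U \<and> p \<in> U \<and> U \<subseteq> Z) \<or>
      (\<exists>U. openin X U \<and> p \<in> U \<and> U \<inter> Z \<subseteq> {p} \<and> connectedin X (U - Z))"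
  shows "connectedin X (topspace X - Z)"
  unfolding connectedin
proof (intro conjI notI)
  show "topspace X - Z \<subseteq> topspace X" by blast
  assume "\<exists>E1 E2. openin X E1 \<and> openin X E2 \<and> topspace X - Z \<subseteq> E1 \<union> E2 \<and> E1 \<inter> E2 \<inter> (topspace X - Z) = {} \<and>
    E1 \<inter> (topspace X - Z) \<noteq> {} \<and> E2 \<inter> (topspace X - Z) \<noteq> {}"
  then obtain E1 E2 where E: "openin X E1" "openin X E2" "topspace X - Z \<subseteq> E1 \<union> E2"
    "E1 \<inter> E2 \<inter> (topspace X - Z) = {}" "E1 \<inter> (topspace X - Z) \<noteq> {}" "E2 \<inter> (topspace X - Z) \<noteq> {}"
    by blast
  have no_clopen: "A = {} \<or> B = {}" if "openin X A" "openin X B" "topspace X \<subseteq> A \<union> B" "A \<inter> B = {}" for A B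
    using X that unfolding connected_space_def by blast
  define inner where "inner = \<Union>{U. openin X U \<and> U \<subseteq> Z}"
  define outer where "outer = \<Union>{U. openin X U \<and> U \<inter> inner = {}}"
  have "topspace X \<subseteq> inner \<union> outer"
  proof
    fix p assume p: "p \<in> topspace X"
    show "p \<in> inner \<union> outer"
    proof (cases "p \<in> inner")
      case False
      then obtain U where U: "openin X U" "p \<in> U" "U \<inter> Z \<subseteq> {p}"
        using Z[OF p] unfolding inner_def by blast
      have "q \<notin> inner" if "q \<in> U" for q
        using that U(3) False unfolding inner_def by blast
      then have "U \<inter> inner = {}" by blast
      then show ?thesis using U unfolding outer_def by blast
    qed simp
  qed
  moreover have "openin X inner" "openin X outer" "inner \<inter> outer = {}"
    unfolding inner_def outer_def by (auto intro!: openin_Union)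
  ultimately have "inner = {} \<or> outer = {}"
    by (intro no_clopen)
  moreover have "outer \<noteq> {}"
  proof -
    obtain p where p: "p \<in> topspace X" "p \<notin> Z" using E(5) by blast
    then have "p \<notin> inner" by (auto simp: inner_def)
    then show ?thesis using \<open>topspace X \<subseteq> inner \<union> outer\<close> p by blast
  qed
  ultimately have dense: "U = {}" if "openin X U" "U \<subseteq> Z" for U
    using that unfolding inner_def by blast
  define V where "V E = \<Union>{U. openin X U \<and> U - Z \<subseteq> E}" for E
  have "openin X (V E)" for E
    unfolding V_def by (auto intro!: openin_Union)
  moreover have "topspace X \<subseteq> V E1 \<union> V E2"
  proof
    fix p assume p: "p \<in> topspace X"
    obtain U where U: "openin X U" "p \<in> U" "connectedin X (U - Z)"
      using Z[OF p] dense by blast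
    have "U \<subseteq> topspace X" using U(1) by (rule openin_subset)
    then have sub: "U - Z \<subseteq> E1 \<union> E2" "E1 \<inter> E2 \<inter> (U - Z) = {}"
      using E(3,4) by blast+
    have "E1 \<inter> (U - Z) = {} \<or> E2 \<inter> (U - Z) = {}"
      using U(3) E(1,2) sub unfolding connectedin by blast
    then have "U - Z \<subseteq> E1 \<or> U - Z \<subseteq> E2"
      using sub(1) by blast
    then show "p \<in> V E1 \<union> V E2" using U(1,2) unfolding V_def by blast
  qed
  moreover have "V E1 \<inter> V E2 = {}"
  proof (rule ccontr)
    assume "V E1 \<inter> V E2 \<noteq> {}"
    then obtain p U U' where U: "openin X U" "U - Z \<subseteq> E1" "openin X U'" "U' - Z \<subseteq> E2" "p \<in> U \<inter> U'"
      unfolding V_def by blast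
    have "U \<inter> U' \<subseteq> topspace X" using openin_subset[OF U(1)] by blast
    then have "U \<inter> U' \<subseteq> Z" using U(2,4) E(4) by blast
    then show False using dense[of "U \<inter> U'"] U(1,3,5) by (auto simp: openin_Int)
  qed
  ultimately have "V E1 = {} \<or> V E2 = {}"
    by (intro no_clopen)
  moreover have "E1 \<subseteq> V E1" "E2 \<subseteq> V E2"
    using E(1,2) unfolding V_def by blast+
  ultimately show False using E(5,6) by blast
qed

text \<open>The sets in which a given \<open>t\<close> solves the problem locally are open, and disjoint for different \<open>t\<close> by
  uniqueness.\<close>

lemma rigid_solutions_glue:
  assumes R: "connectedin X R" "openin X R" "R \<noteq> {}"
    and ex: "\<And>p. p \<in> R \<Longrightarrow> \<exists>U t. openin X U \<and> p \<in> U \<and> U \<subseteq> R \<and> (\<forall>q\<in>U. P t q)"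
    and unique: "\<And>U t t'. openin X U \<Longrightarrow> U \<noteq> {} \<Longrightarrow> U \<subseteq> R \<Longrightarrow> \<forall>q\<in>U. P t q \<and> P t' q \<Longrightarrow> t = t'"
  shows "\<exists>t. \<forall>p\<in>R. P t p"
proof -
  define V where "V t = \<Union>{U. openin X U \<and> U \<subseteq> R \<and> (\<forall>q\<in>U. P t q)}" for t
  have V: "openin X (V t)" for t
    unfolding V_def by (auto intro!: openin_Union)
  have disj: "t = t'" if p: "p \<in> V t" "p \<in> V t'" for p t t'
  proof -
    obtain U U' where U: "openin X U" "p \<in> U" "U \<subseteq> R" "\<forall>q\<in>U. P t q"
      "openin X U'" "p \<in> U'" "\<forall>q\<in>U'. P t' q"
      using p unfolding V_def by blast
    show ?thesis
      by (rule unique[of "U \<inter> U'"]) (use U in \<open>auto simp: openin_Int\<close>)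
  qed
  obtain p0 where "p0 \<in> R" using R(3) by blast
  then obtain t0 where t0: "p0 \<in> V t0"
    using ex[of p0] unfolding V_def by blast
  define W where "W = \<Union>(V ` (- {t0}))"
  have "openin X W" unfolding W_def using V by blast
  moreover have "R \<subseteq> V t0 \<union> W"
  proof
    fix p assume "p \<in> R"
    then obtain t where "p \<in> V t" using ex[of p] unfolding V_def by blast
    then show "p \<in> V t0 \<union> W" unfolding W_def by (cases "t = t0") auto
  qed
  moreover have "V t0 \<inter> W = {}"
    unfolding W_def using disj by blast
  ultimately have "V t0 \<inter> R = {} \<or> W \<inter> R = {}"
    using R(1) V unfolding connectedin by blast
  then have "R \<subseteq> V t0"
    using \<open>R \<subseteq> V t0 \<union> W\<close> t0 \<open>p0 \<in> R\<close> by blast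
  then have "\<forall>p\<in>R. P t0 p" unfolding V_def by blast
  then show ?thesis ..
qed

section \<open>LWR frames on a Riemann surface\<close>

locale lwr_surface =
  fixes X :: "'a topology" and \<A> :: "'a atlas" and \<Phi> :: "complex \<Rightarrow> 'a \<Rightarrow> cmat"
  assumes surface: "riemann_surface X \<A>" and frame: "lwr_frame \<A> \<Phi>"
begin

lemmas surface_conditions = surface[unfolded riemann_surface_def]

lemma chart:
  assumes "(D, \<zeta>) \<in> \<A>"
  shows "open D" "openin X (\<zeta> ` D)" "homeomorphic_map (top_of_set D) (subtopology X (\<zeta> ` D)) \<zeta>"
proof -
  have "open D \<and> openin X (\<zeta> ` D) \<and> homeomorphic_map (top_of_set D) (subtopology X (\<zeta> ` D)) \<zeta>"
    using bspec[OF surface_conditions[THEN conjunct2, THEN conjunct2, THEN conjunct1] assms]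
    by (simp only: prod.case)
  then show "open D" "openin X (\<zeta> ` D)" "homeomorphic_map (top_of_set D) (subtopology X (\<zeta> ` D)) \<zeta>"
    by blast+
qed

lemma topspace_charts: "p \<in> topspace X \<Longrightarrow> \<exists>D \<zeta> z. (D, \<zeta>) \<in> \<A> \<and> z \<in> D \<and> \<zeta> z = p"
proof -
  assume "p \<in> topspace X"
  then have "p \<in> (\<Union>(D, \<zeta>)\<in>\<A>. \<zeta> ` D)"
    using surface_conditions[THEN conjunct2, THEN conjunct2, THEN conjunct2, THEN conjunct1] by (simp only:)
  then obtain c where c: "c \<in> \<A>" "p \<in> snd c ` fst c"
    by (auto simp: case_prod_unfold)
  then show ?thesis
    by (intro exI[of _ "fst c"] exI[of _ "snd c"]) auto
qed

lemma transition_holomorphic: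
  assumes "(D, \<zeta>) \<in> \<A>" "(D', \<zeta>') \<in> \<A>"
  shows "(inv_into D' \<zeta>' \<circ> \<zeta>) holomorphic_on (D \<inter> \<zeta> -` (\<zeta>' ` D'))"
  using bspec[OF bspec[OF surface_conditions[THEN conjunct2, THEN conjunct2, THEN conjunct2, THEN conjunct2]
    assms(1), unfolded prod.case] assms(2)]
  by (simp only: prod.case)

lemma chart_inj: "(D, \<zeta>) \<in> \<A> \<Longrightarrow> inj_on \<zeta> D"
  using homeomorphic_imp_injective_map[OF chart(3)] by simp

lemma chart_open_image:
  assumes c: "(D, \<zeta>) \<in> \<A>" and B: "open B" "B \<subseteq> D"
  shows "openin X (\<zeta> ` B)"
proof -
  have "openin (top_of_set D) B"
    using B by (simp add: openin_open_eq chart(1)[OF c])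
  then have "openin (subtopology X (\<zeta> ` D)) (\<zeta> ` B)"
    using homeomorphic_imp_open_map[OF chart(3)[OF c]] unfolding open_map_def by blast
  then show ?thesis
    using chart(2)[OF c] by (rule openin_trans_full)
qed

lemma chart_continuous: "(D, \<zeta>) \<in> \<A> \<Longrightarrow> continuous_map (top_of_set D) X \<zeta>"
  using homeomorphic_imp_continuous_map[OF chart(3)] continuous_map_into_fulltopology by blast

lemma chart_open_preimage:
  assumes c: "(D, \<zeta>) \<in> \<A>" and U: "openin X U"
  shows "open (D \<inter> \<zeta> -` U)"
proof -
  have "openin (top_of_set D) {z \<in> topspace (top_of_set D). \<zeta> z \<in> U}"
    using chart_continuous[OF c] U by (rule openin_continuous_map_preimage)
  moreover have "{z \<in> topspace (top_of_set D). \<zeta> z \<in> U} = D \<inter> \<zeta> -` U" by auto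
  ultimately show ?thesis
    using chart(1)[OF c] by (simp add: openin_open_eq)
qed

lemma frame_chart:
  assumes c: "(D, \<zeta>) \<in> \<A>"
  obtains A B where "lwr_potential D (log_derivative \<Phi> \<zeta>) A B" "lwr_chart D (\<lambda>l z. \<Phi> l (\<zeta> z)) A B"
proof -
  have f: "\<forall>z\<in>D. \<forall>l. \<Phi> l (\<zeta> z) \<in> SL2" "\<forall>l. holomorphic_matrix_on (\<Phi> l \<circ> \<zeta>) D"
    "\<forall>z\<in>D. holomorphic_matrix_on (\<lambda>l. \<Phi> l (\<zeta> z)) UNIV" "\<exists>A B. lwr_potential D (log_derivative \<Phi> \<zeta>) A B"
    using bspec[OF frame[unfolded lwr_frame_def] c] unfolding prod.case by blast+
  from f(4) obtain A B where AB: "lwr_potential D (log_derivative \<Phi> \<zeta>) A B" by blast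
  have "lwr_chart D (\<lambda>l z. \<Phi> l (\<zeta> z)) A B"
  proof
    show "open D" by (rule chart(1)[OF c])
    show det: "det (\<Phi> l (\<zeta> z)) = 1" if "z \<in> D" for z l
      using f(1) that by (simp add: SL2_def)
    show "holomorphic_matrix_on (\<lambda>z. \<Phi> l (\<zeta> z)) D" for l
      using f(2) by (simp add: o_def)
    show "holomorphic_matrix_on (\<lambda>l. \<Phi> l (\<zeta> z)) UNIV" if "z \<in> D" for z
      using f(3) that by blast
    show "holomorphic_matrix_on A D"
      using AB by (simp add: lwr_potential_def)
    show "trace (A z) = 0" "trace (B z) = 0" "A z ** A z = 0" if "z \<in> D" for z
      using AB that by (auto simp: lwr_potential_def nilpotent_square)
    show "mderiv (\<lambda>z. \<Phi> l (\<zeta> z)) z = \<Phi> l (\<zeta> z) ** (l *\<^sub>C A z + B z)" if "z \<in> D" for l z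
    proof -
      have "adjugate (\<Phi> l (\<zeta> z)) ** mderiv (\<lambda>z. \<Phi> l (\<zeta> z)) z = l *\<^sub>C A z + B z"
      proof -
        have "log_derivative \<Phi> \<zeta> l z = l *\<^sub>C A z + B z"
          using AB that by (simp add: lwr_potential_def)
        then show ?thesis
          unfolding log_derivative_def matrix_inv_SL2[OF det[OF that]] by (simp only: o_def)
      qed
      then have "\<Phi> l (\<zeta> z) ** (adjugate (\<Phi> l (\<zeta> z)) ** mderiv (\<lambda>z. \<Phi> l (\<zeta> z)) z) = \<Phi> l (\<zeta> z) ** (l *\<^sub>C A z + B z)"
        by simp
      then show ?thesis
        using det[OF that] by (simp add: matrix_mul_assoc mult_adjugate)
    qed
  qed
  with AB show ?thesis by (rule that)
qed

lemma potential_unique: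
  assumes "lwr_potential D \<xi> A B" "lwr_potential D \<xi> A' B'" "z \<in> D"
  shows "A z = A' z"
proof -
  have e: "\<xi> 1 z - \<xi> 0 z = C z" if "lwr_potential D \<xi> C C'" for C C'
    using that assms(3) by (simp add: lwr_potential_def cscale_distrib)
  show ?thesis
    using e[OF assms(1)] e[OF assms(2)] by (simp only:)
qed

text \<open>The zeros of \<open>A\<close> are the critical points of \<open>\<Phi>\<^sub>1 \<Phi>\<^sub>0\<^sup>-\<^sup>1\<close>, a map that does not involve the chart.\<close>

lemma zero_independent_of_chart:
  assumes c: "(D, \<zeta>) \<in> \<A>" "(D', \<zeta>') \<in> \<A>"
    and A: "lwr_chart D (\<lambda>l z. \<Phi> l (\<zeta> z)) A B" "lwr_chart D' (\<lambda>l z. \<Phi> l (\<zeta>' z)) A' B'"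
    and z: "z \<in> D" "z' \<in> D'" "\<zeta> z = \<zeta>' z'" and zero: "A' z' = 0"
  shows "A z = 0"
proof -
  define \<Psi> where "\<Psi> p = \<Phi> 1 p ** adjugate (\<Phi> 0 p)" for p
  define \<tau> where "\<tau> = inv_into D' \<zeta>' \<circ> \<zeta>"
  define U where "U = D \<inter> \<zeta> -` (\<zeta>' ` D')"
  have U: "open U" unfolding U_def by (rule chart_open_preimage[OF c(1) chart(2)[OF c(2)]])
  have zU: "z \<in> U" using z by (auto simp: U_def)
  have "\<tau> holomorphic_on U" unfolding \<tau>_def U_def by (rule transition_holomorphic[OF c])
  then have "(\<tau> has_field_derivative deriv \<tau> z) (at z)"
    using U zU by (rule holomorphic_derivI)
  then have d\<tau>: "(\<tau> has_derivative (\<lambda>v. v * deriv \<tau> z)) (at z)"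
    by (simp add: has_field_derivative_def mult_commute_abs)
  have \<tau>z: "\<tau> z = z'"
    using chart_inj[OF c(2)] z by (simp add: \<tau>_def)
  have \<tau>: "\<zeta>' (\<tau> w) = \<zeta> w" if "w \<in> U" for w
    using that by (auto simp: \<tau>_def U_def f_inv_into_f)
  have "((\<lambda>w. \<Psi> (\<zeta>' w)) has_derivative (\<lambda>v. v *\<^sub>C (\<Phi> 1 (\<zeta>' z') ** A' z' ** adjugate (\<Phi> 0 (\<zeta>' z'))))) (at z')"
    using lwr_chart.quotient_derivative[OF A(2) z(2), of 1 0] by (simp add: \<Psi>_def cscale_distrib)
  then have "((\<lambda>w. \<Psi> (\<zeta>' w)) has_derivative (\<lambda>v. 0)) (at (\<tau> z))"
    by (simp add: zero \<tau>z cscale_distrib)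
  from has_derivative_compose[OF d\<tau> this] have "((\<lambda>w. \<Psi> (\<zeta>' (\<tau> w))) has_derivative (\<lambda>v. 0)) (at z)" .
  then have "((\<lambda>w. \<Psi> (\<zeta> w)) has_derivative (\<lambda>v. 0)) (at z)"
    by (rule has_derivative_transform_within_open[OF _ U zU]) (simp add: \<tau>)
  moreover have "((\<lambda>w. \<Psi> (\<zeta> w)) has_derivative (\<lambda>v. v *\<^sub>C (\<Phi> 1 (\<zeta> z) ** A z ** adjugate (\<Phi> 0 (\<zeta> z))))) (at z)"
    using lwr_chart.quotient_derivative[OF A(1) z(1), of 1 0] by (simp add: \<Psi>_def cscale_distrib)
  ultimately have "(\<lambda>v. 0) = (\<lambda>v. v *\<^sub>C (\<Phi> 1 (\<zeta> z) ** A z ** adjugate (\<Phi> 0 (\<zeta> z))))"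
    by (rule has_derivative_unique)
  from fun_cong[OF this, of 1] have "1 *\<^sub>C (\<Phi> 1 (\<zeta> z) ** A z ** adjugate (\<Phi> 0 (\<zeta> z))) = 0"
    by (simp only:)
  then have "adjugate (\<Phi> 1 (\<zeta> z)) ** (\<Phi> 1 (\<zeta> z) ** A z ** adjugate (\<Phi> 0 (\<zeta> z))) ** \<Phi> 0 (\<zeta> z) = 0"
    by (simp add: cscale_distrib)
  then show ?thesis
    by (simp add: matrix_mul_assoc lwr_chart.F_inverse[OF A(1) z(1)] lwr_chart.F_cancel[OF A(1) z(1)])
qed

abbreviation zeros :: "'a set" where "zeros \<equiv> zeros_of_A \<A> \<Phi>"

lemma zeros_in_chart:
  assumes c: "(D, \<zeta>) \<in> \<A>" and A: "lwr_potential D (log_derivative \<Phi> \<zeta>) A B"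
    "lwr_chart D (\<lambda>l z. \<Phi> l (\<zeta> z)) A B" and z: "z \<in> D"
  shows "\<zeta> z \<in> zeros \<longleftrightarrow> A z = 0"
proof
  assume "A z = 0"
  then show "\<zeta> z \<in> zeros" unfolding zeros_of_A_def using c A(1) z by blast
next
  assume "\<zeta> z \<in> zeros"
  then obtain D' \<zeta>' z' A' B' where c': "(D', \<zeta>') \<in> \<A>" and z': "z' \<in> D'" "\<zeta> z = \<zeta>' z'"
    and A': "lwr_potential D' (log_derivative \<Phi> \<zeta>') A' B'" "A' z' = 0"
    unfolding zeros_of_A_def by blast
  obtain A'' B'' where A'': "lwr_potential D' (log_derivative \<Phi> \<zeta>') A'' B''" "lwr_chart D' (\<lambda>l z. \<Phi> l (\<zeta>' z)) A'' B''"
    using c' by (rule frame_chart)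
  have "A'' z' = 0"
    using potential_unique[OF A''(1) A'(1) z'(1)] A'(2) by simp
  then show "A z = 0"
    by (rule zero_independent_of_chart[OF c c' A(2) A''(2) z z'])
qed

abbreviation regular :: "'a set" where "regular \<equiv> topspace X - zeros"

lemma chart_in_topspace: "(D, \<zeta>) \<in> \<A> \<Longrightarrow> z \<in> D \<Longrightarrow> \<zeta> z \<in> topspace X"
  using openin_subset[OF chart(2)] by blast

lemma regular_chart:
  assumes c: "(D, \<zeta>) \<in> \<A>" and A: "lwr_potential D (log_derivative \<Phi> \<zeta>) A B"
    "lwr_chart D (\<lambda>l z. \<Phi> l (\<zeta> z)) A B"
  shows "D \<inter> \<zeta> -` regular = {z \<in> D. A z \<noteq> 0}"
  using zeros_in_chart[OF c A] chart_in_topspace[OF c] by blast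

lemma regular_open_chart:
  assumes c: "(D, \<zeta>) \<in> \<A>"
  shows "open (D \<inter> \<zeta> -` regular)"
proof -
  obtain A B where A: "lwr_potential D (log_derivative \<Phi> \<zeta>) A B" "lwr_chart D (\<lambda>l z. \<Phi> l (\<zeta> z)) A B"
    using c by (rule frame_chart)
  have D: "open D" by (rule chart(1)[OF c])
  have "holomorphic_matrix_on A D"
    using A(2) by (rule lwr_chart.A_holomorphic)
  then have "continuous_on D A"
    using holomorphic_matrix_has_derivative[OF D]
    by (intro continuous_at_imp_continuous_on ballI has_derivative_continuous) blast
  then have "open (D \<inter> A -` (- {0}))"
    using D by (intro continuous_open_preimage) auto
  moreover have "D \<inter> A -` (- {0}) = {z \<in> D. A z \<noteq> 0}" by blast
  ultimately show ?thesis
    unfolding regular_chart[OF c A] by simp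
qed

lemma regular_open: "openin X regular"
proof (subst openin_subopen, intro ballI)
  fix p assume p: "p \<in> regular"
  then obtain D \<zeta> z where c: "(D, \<zeta>) \<in> \<A>" "z \<in> D" "\<zeta> z = p"
    using topspace_charts[of p] by blast
  have "openin X (\<zeta> ` (D \<inter> \<zeta> -` regular))"
    by (rule chart_open_image[OF c(1) regular_open_chart[OF c(1)]]) blast
  moreover have "p \<in> \<zeta> ` (D \<inter> \<zeta> -` regular)" using c p by blast
  moreover have "\<zeta> ` (D \<inter> \<zeta> -` regular) \<subseteq> regular" by blast
  ultimately show "\<exists>T. openin X T \<and> p \<in> T \<and> T \<subseteq> regular" by blast
qed

text \<open>The identity theorem for one entry of \<open>A\<close>, and the connectedness of a punctured disk.\<close>

lemma zeros_isolated:
  assumes p: "p \<in> topspace X"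
  shows "(\<exists>U. openin X U \<and> p \<in> U \<and> U \<subseteq> zeros) \<or>
    (\<exists>U. openin X U \<and> p \<in> U \<and> U \<inter> zeros \<subseteq> {p} \<and> connectedin X (U - zeros))"
proof -
  obtain D \<zeta> z0 where c: "(D, \<zeta>) \<in> \<A>" "z0 \<in> D" "\<zeta> z0 = p"
    using topspace_charts[OF p] by blast
  obtain A B where A: "lwr_potential D (log_derivative \<Phi> \<zeta>) A B" "lwr_chart D (\<lambda>l z. \<Phi> l (\<zeta> z)) A B"
    using c(1) by (rule frame_chart)
  have D: "open D" by (rule chart(1)[OF c(1)])
  have zeros: "\<zeta> z \<in> zeros \<longleftrightarrow> A z = 0" if "z \<in> D" for z
    by (rule zeros_in_chart[OF c(1) A that])
  obtain r where r: "0 < r" "ball z0 r \<subseteq> D"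
    using D c(2) openE by blast
  have image: "openin X (\<zeta> ` ball z0 s)" "p \<in> \<zeta> ` ball z0 s" if "0 < s" "ball z0 s \<subseteq> D" for s
    using chart_open_image[OF c(1) open_ball that(2)] c(3) that(1) by auto
  show ?thesis
  proof (cases "\<forall>z\<in>ball z0 r. A z = 0")
    case True
    then have "\<zeta> ` ball z0 r \<subseteq> zeros" using zeros r(2) by blast
    then show ?thesis using image[OF r] by blast
  next
    case False
    then obtain z1 where z1: "z1 \<in> ball z0 r" "A z1 \<noteq> 0" by blast
    then obtain i j where ij: "A z1$i$j \<noteq> 0" by (auto simp: vec_eq_iff)
    have hol: "(\<lambda>z. A z$i$j) holomorphic_on ball z0 r"
      using lwr_chart.A_holomorphic[OF A(2)] holomorphic_on_subset[OF _ r(2)] unfolding holomorphic_matrix_on_def by blast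
    have "\<exists>s>0. ball z0 s \<subseteq> ball z0 r \<and> (\<forall>z\<in>ball z0 s - {z0}. A z$i$j \<noteq> 0)"
    proof (cases "A z0$i$j = 0")
      case True
      have z0: "z0 \<in> ball z0 r" using r(1) by simp
      obtain s where "0 < s" "ball z0 s \<subseteq> ball z0 r" "\<And>z. z \<in> ball z0 s - {z0} \<Longrightarrow> A z$i$j \<noteq> 0"
        by (rule isolated_zeros[OF hol open_ball connected_ball z0 True z1(1) ij]) blast
      then show ?thesis by blast
    next
      case False
      have "open (ball z0 r \<inter> (\<lambda>z. A z$i$j) -` (- {0}))"
        by (rule continuous_open_preimage[OF holomorphic_on_imp_continuous_on[OF hol] open_ball]) auto
      moreover have "z0 \<in> ball z0 r \<inter> (\<lambda>z. A z$i$j) -` (- {0})" using False r(1) by simp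
      ultimately obtain s where "0 < s" "ball z0 s \<subseteq> ball z0 r \<inter> (\<lambda>z. A z$i$j) -` (- {0})"
        by (rule openE)
      then show ?thesis by blast
    qed
    then obtain s where s: "0 < s" "ball z0 s \<subseteq> ball z0 r" "\<And>z. z \<in> ball z0 s - {z0} \<Longrightarrow> A z$i$j \<noteq> 0"
      by blast
    have sD: "ball z0 s \<subseteq> D" using s(2) r(2) by blast
    have nz: "A z \<noteq> 0" if "z \<in> ball z0 s - {z0}" for z
      using s(3)[OF that] by (auto simp: vec_eq_iff)
    have zs: "\<zeta> z \<notin> zeros" if "z \<in> ball z0 s" "z \<noteq> z0" for z
      using zeros[of z] nz[of z] that sD by blast
    have "\<zeta> ` ball z0 s \<inter> zeros \<subseteq> {p}"
      using zs c(3) by blast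
    moreover have "connectedin X (\<zeta> ` ball z0 s - zeros)"
    proof -
      have conn: "connectedin X (\<zeta> ` C)" if "C \<subseteq> D" "connected C" for C
      proof -
        have "connectedin (top_of_set D) C"
          using that by (simp add: connectedin_subtopology)
        then show ?thesis by (rule connectedin_continuous_map_image[OF chart_continuous[OF c(1)]])
      qed
      show ?thesis
      proof (cases "p \<in> zeros")
        case True
        have key: "\<zeta> z \<in> zeros \<longleftrightarrow> z = z0" if "z \<in> ball z0 s" for z
          using zs[OF that] True c(3) by (cases "z = z0") simp_all
        have "\<zeta> ` ball z0 s - zeros = \<zeta> ` (ball z0 s - {z0})"
          using key by blast
        moreover have "connectedin X (\<zeta> ` (ball z0 s - {z0}))"
        proof (rule conn)
          show "ball z0 s - {z0} \<subseteq> D" using sD by blast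
          show "connected (ball z0 s - {z0})" by (rule connected_punctured_ball) simp
        qed
        ultimately show ?thesis by (simp only:)
      next
        case False
        have key: "\<zeta> z \<notin> zeros" if "z \<in> ball z0 s" for z
          using zs[OF that] False c(3) by (cases "z = z0") simp_all
        have "\<zeta> ` ball z0 s - zeros = \<zeta> ` ball z0 s"
          using key by blast
        then show ?thesis using conn[OF sD connected_ball] by (simp only:)
      qed
    qed
    ultimately show ?thesis
      using image[OF s(1) sD] by blast
  qed
qed

lemma regular_connected: "connectedin X regular"
  by (rule connected_complement_of_isolated[OF surface_conditions[THEN conjunct2, THEN conjunct1] zeros_isolated])

text \<open>The local motions that take \<open>f'\<close> to another member \<open>g\<close> agree where they meet, by \<open>rigid_motion_unique\<close>, so
  on the connected regular set they are one motion.\<close>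

lemma associated_family:
  assumes \<mu>: "\<mu> \<noteq> 0"
    and charts: "\<And>D \<zeta>. (D, \<zeta>) \<in> \<A> \<Longrightarrow> \<exists>V W b. null_surface M (D \<inter> \<zeta> -` regular) (f \<circ> \<zeta>) V b \<and>
      null_surface M (D \<inter> \<zeta> -` regular) (f' \<circ> \<zeta>) W (\<lambda>z. \<mu> *\<^sub>C b z)"
  shows "associated_member M (restrict_atlas \<A> regular) f \<mu> f'"
    and "associated_member M (restrict_atlas \<A> regular) f \<mu> g \<Longrightarrow>
      \<exists>T. ambient_isometry M T \<and> (\<forall>p\<in>regular. g p = T (f' p))"
proof -
  define member_on where "member_on k D' \<zeta> \<longleftrightarrow>
      conformal_immersion M D' (f \<circ> \<zeta>) \<and> conformal_immersion M D' (k \<circ> \<zeta>) \<and>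
      (\<forall>z\<in>D'. metric (k \<circ> \<zeta>) z = of_real ((norm \<mu>)\<^sup>2) * metric (f \<circ> \<zeta>) z) \<and>
      (\<exists>Q. has_hopf_and_mean_curvature M D' (f \<circ> \<zeta>) Q (\<lambda>_. mean_curvature_of M) \<and>
        has_hopf_and_mean_curvature M D' (k \<circ> \<zeta>) (\<lambda>z. \<mu> * Q z) (\<lambda>_. mean_curvature_of M))"
    for k D' and \<zeta> :: "complex \<Rightarrow> 'a"
  have member: "associated_member M (restrict_atlas \<A> regular) f \<mu> k \<longleftrightarrow>
      (\<forall>D \<zeta>. (D, \<zeta>) \<in> \<A> \<longrightarrow> member_on k (D \<inter> \<zeta> -` regular) \<zeta>)" for k
    unfolding associated_member_def restrict_atlas_def member_on_def ball_simps case_prod_unfold fst_conv snd_conv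
    by (simp only: Ball_def split_paired_All fst_conv snd_conv)
  have pair: "conformal_immersion M D' (f \<circ> \<zeta>)" "conformal_immersion M D' (f' \<circ> \<zeta>)"
      "\<And>z. z \<in> D' \<Longrightarrow> metric (f' \<circ> \<zeta>) z = of_real ((norm \<mu>)\<^sup>2) * metric (f \<circ> \<zeta>) z"
      "\<exists>Q. has_hopf_and_mean_curvature M D' (f \<circ> \<zeta>) Q (\<lambda>_. mean_curvature_of M) \<and>
          has_hopf_and_mean_curvature M D' (f' \<circ> \<zeta>) (\<lambda>z. \<mu> * Q z) (\<lambda>_. mean_curvature_of M)"
      "\<exists>m. \<forall>z\<in>D'. metric (f \<circ> \<zeta>) z = of_real (m z)"
    if c: "(D, \<zeta>) \<in> \<A>" and D': "D' = D \<inter> \<zeta> -` regular" for D \<zeta> D'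
  proof -
    obtain V W b where n: "null_surface M D' (f \<circ> \<zeta>) V b" "null_surface M D' (f' \<circ> \<zeta>) W (\<lambda>z. \<mu> *\<^sub>C b z)"
      using charts[OF c] unfolding D' by blast
    note a = associated_null_surfaces[OF n \<mu>]
    show "conformal_immersion M D' (f \<circ> \<zeta>)" "conformal_immersion M D' (f' \<circ> \<zeta>)"
      by (rule a(1), rule a(2))
    show "metric (f' \<circ> \<zeta>) z = of_real ((norm \<mu>)\<^sup>2) * metric (f \<circ> \<zeta>) z" if "z \<in> D'" for z
      by (rule a(4)[OF that])
    show "\<exists>Q. has_hopf_and_mean_curvature M D' (f \<circ> \<zeta>) Q (\<lambda>_. mean_curvature_of M) \<and>
          has_hopf_and_mean_curvature M D' (f' \<circ> \<zeta>) (\<lambda>z. \<mu> * Q z) (\<lambda>_. mean_curvature_of M)"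
      by (rule a(5))
    show "\<exists>m. \<forall>z\<in>D'. metric (f \<circ> \<zeta>) z = of_real (m z)"
      using a(3) by (intro exI ballI)
  qed
  show "associated_member M (restrict_atlas \<A> regular) f \<mu> f'"
    unfolding member member_on_def by (intro allI impI conjI ballI pair(1-4)[OF _ refl])
  assume "associated_member M (restrict_atlas \<A> regular) f \<mu> g"
  then have "\<forall>D \<zeta>. (D, \<zeta>) \<in> \<A> \<longrightarrow> member_on g (D \<inter> \<zeta> -` regular) \<zeta>"
    by (simp only: member)
  then have member_g: "member_on g D' \<zeta>" if "(D, \<zeta>) \<in> \<A>" "D' = D \<inter> \<zeta> -` regular" for D \<zeta> D'
    using that(1) unfolding that(2) by blast
  define P where "P t p \<longleftrightarrow> rigid_motion M (fst t) (snd t) \<and> g p = act (fst t) (f' p) + snd t" for t p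
  have local: "\<exists>U t. openin X U \<and> p \<in> U \<and> U \<subseteq> regular \<and> (\<forall>q\<in>U. P t q)" if p: "p \<in> regular" for p
  proof -
    obtain D \<zeta> z0 where c: "(D, \<zeta>) \<in> \<A>" "z0 \<in> D" "\<zeta> z0 = p"
      using topspace_charts[of p] p by blast
    define D' where "D' = D \<inter> \<zeta> -` regular"
    have D': "open D'" unfolding D'_def by (rule regular_open_chart[OF c(1)])
    have z0: "z0 \<in> D'" using c p by (simp add: D'_def)
    obtain r where r: "0 < r" "ball z0 r \<subseteq> D'" using D' z0 openE by blast
    note pair = pair[OF c(1) D'_def]
    note member_g = member_g[OF c(1) D'_def, unfolded member_on_def, THEN conjunct2]
    note g = member_g[THEN conjunct1] bspec[OF member_g[THEN conjunct2, THEN conjunct1]]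
      member_g[THEN conjunct2, THEN conjunct2]
    obtain m where m: "\<And>z. z \<in> D' \<Longrightarrow> metric (f \<circ> \<zeta>) z = of_real (m z)" using pair(5) by blast
    obtain Q where Q: "has_hopf_and_mean_curvature M D' (f \<circ> \<zeta>) Q (\<lambda>_. mean_curvature_of M)"
      "has_hopf_and_mean_curvature M D' (f' \<circ> \<zeta>) (\<lambda>z. \<mu> * Q z) (\<lambda>_. mean_curvature_of M)" using pair(4) by blast
    obtain Q' where Q': "has_hopf_and_mean_curvature M D' (f \<circ> \<zeta>) Q' (\<lambda>_. mean_curvature_of M)"
      "has_hopf_and_mean_curvature M D' (g \<circ> \<zeta>) (\<lambda>z. \<mu> * Q' z) (\<lambda>_. mean_curvature_of M)" using g(3) by blast
    have m': "of_real ((norm \<mu>)\<^sup>2) * metric (f \<circ> \<zeta>) z = of_real ((norm \<mu>)\<^sup>2 * m z)" if "z \<in> D'" for z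
      by (simp add: m[OF that])
    have mf': "metric (f' \<circ> \<zeta>) z = of_real ((norm \<mu>)\<^sup>2 * m z)" if "z \<in> D'" for z
      by (simp only: pair(3)[OF that] m'[OF that])
    have mg: "metric (g \<circ> \<zeta>) z = of_real ((norm \<mu>)\<^sup>2 * m z)" if "z \<in> D'" for z
      by (simp only: g(2)[OF that] m'[OF that])
    have QQ': "\<mu> * Q z = \<mu> * Q' z" if "z \<in> D'" for z
      using hopf_differential_unique[OF D' pair(1) m Q(1) Q'(1) that] by simp
    have "\<exists>S c. rigid_motion M S c \<and> (\<forall>z\<in>ball z0 r. (g \<circ> \<zeta>) z = act S ((f' \<circ> \<zeta>) z) + c)"
      by (rule local_congruence[where ?z0.0 = z0, OF D' pair(2) mf' g(1) mg Q(2) Q'(2) QQ' r(2) open_ball convex_ball])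
         (use r(1) in simp_all)
    then obtain S c' where S: "rigid_motion M S c'" "\<And>z. z \<in> ball z0 r \<Longrightarrow> g (\<zeta> z) = act S (f' (\<zeta> z)) + c'"
      by auto
    have "ball z0 r \<subseteq> D" using r(2) by (auto simp: D'_def)
    then have "openin X (\<zeta> ` ball z0 r)" by (rule chart_open_image[OF c(1) open_ball])
    moreover have "p \<in> \<zeta> ` ball z0 r" using c(3) r(1) by auto
    moreover have "\<zeta> ` ball z0 r \<subseteq> regular" using r(2) unfolding D'_def by blast
    moreover have "\<forall>q\<in>\<zeta> ` ball z0 r. P (S, c') q" using S by (auto simp: P_def)
    ultimately show ?thesis by blast
  qed
  have unique: "t = t'" if U: "openin X U" "U \<noteq> {}" "U \<subseteq> regular" "\<forall>q\<in>U. P t q \<and> P t' q" for U t t'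
  proof -
    obtain p where p: "p \<in> U" using U(2) by blast
    then obtain D \<zeta> z where c: "(D, \<zeta>) \<in> \<A>" "z \<in> D" "\<zeta> z = p"
      using topspace_charts[of p] U(3) by blast
    define D' where "D' = D \<inter> \<zeta> -` regular"
    obtain V W b where n: "null_surface M D' (f \<circ> \<zeta>) V b" "null_surface M D' (f' \<circ> \<zeta>) W (\<lambda>z. \<mu> *\<^sub>C b z)"
      using charts[OF c(1)] unfolding D'_def by blast
    interpret s: null_surface M D' "f' \<circ> \<zeta>" W "\<lambda>z. \<mu> *\<^sub>C b z" by (rule n(2))
    have "fst t = fst t' \<and> snd t = snd t'"
    proof (rule rigid_motion_unique[OF s.surface_axioms])
      show "rigid_motion M (fst t) (snd t)" "rigid_motion M (fst t') (snd t')"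
        using U(4) p unfolding P_def by blast+
      show "D \<inter> \<zeta> -` U \<subseteq> D'" using U(3) unfolding D'_def by blast
      show "open (D \<inter> \<zeta> -` U)" by (rule chart_open_preimage[OF c(1) U(1)])
      show "z \<in> D \<inter> \<zeta> -` U" using c p by blast
      show "act (fst t) ((f' \<circ> \<zeta>) w) + snd t = act (fst t') ((f' \<circ> \<zeta>) w) + snd t'" if "w \<in> D \<inter> \<zeta> -` U" for w
        using U(4) that unfolding P_def by auto
    qed
    then show ?thesis by (simp add: prod_eq_iff)
  qed
  have id: "ambient_isometry M (\<lambda>x. x)"
    by (cases M) (auto simp: linear_ident E3_def hermitian_def trace_2 cmat_entries intro!: exI[of _ "\<lambda>x. x"] exI[of _ 0])
  show "\<exists>T. ambient_isometry M T \<and> (\<forall>p\<in>regular. g p = T (f' p))"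
  proof (cases "regular = {}")
    case True
    then show ?thesis using id by blast
  next
    case False
    have "\<exists>t. \<forall>p\<in>regular. P t p"
      by (rule rigid_solutions_glue[OF regular_connected regular_open False]) (fact local, fact unique)
    then obtain t where t: "\<forall>p\<in>regular. P t p" ..
    then have "rigid_motion M (fst t) (snd t)" using False unfolding P_def by blast
    then show ?thesis
      using t rigid_motion_isometry unfolding P_def by blast
  qed
qed

end

theorem theorem4p2:
  fixes X :: "'a topology" and \<A> :: "'a atlas"
    and \<Phi> :: "complex \<Rightarrow> 'a \<Rightarrow> cmat" and l0 l1 :: complex
  assumes "riemann_surface X \<A>"
    and "lwr_frame \<A> \<Phi>"
    and "l0 \<noteq> l1"
  shows "let R = topspace X - zeros_of_A \<A> \<Phi>; \<R> = restrict_atlas \<A> R in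
    (\<forall>\<mu>. \<mu> \<noteq> 0 \<longrightarrow>
      (let f' = induced_E \<Phi> l0 (l0 + \<mu> * (l1 - l0)) in
        associated_member Euclidean \<R> (induced_E \<Phi> l0 l1) \<mu> f' \<and>
        (\<forall>g. associated_member Euclidean \<R> (induced_E \<Phi> l0 l1) \<mu> g \<longrightarrow>
          (\<exists>T. ambient_isometry Euclidean T \<and> (\<forall>p\<in>R. g p = T (f' p)))))) \<and>
    (\<forall>\<mu>. \<mu> \<noteq> 0 \<longrightarrow>
      (let f' = induced_H \<Phi> (l1 - \<mu> * (l1 - l0)) l1 in
        associated_member Hyperbolic \<R> (induced_H \<Phi> l0 l1) \<mu> f' \<and>
        (\<forall>g. associated_member Hyperbolic \<R> (induced_H \<Phi> l0 l1) \<mu> g \<longrightarrow>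
          (\<exists>T. ambient_isometry Hyperbolic T \<and> (\<forall>p\<in>R. g p = T (f' p))))))"
proof -
  interpret lwr_surface X \<A> \<Phi> using assms(1,2) by unfold_locales
  have E: "\<exists>V W b. null_surface Euclidean (D \<inter> \<zeta> -` regular) (induced_E \<Phi> l0 l1 \<circ> \<zeta>) V b \<and>
      null_surface Euclidean (D \<inter> \<zeta> -` regular) (induced_E \<Phi> l0 (l0 + \<mu> * (l1 - l0)) \<circ> \<zeta>) W (\<lambda>z. \<mu> *\<^sub>C b z)"
    and H: "\<exists>V W b. null_surface Hyperbolic (D \<inter> \<zeta> -` regular) (induced_H \<Phi> l0 l1 \<circ> \<zeta>) V b \<and>
      null_surface Hyperbolic (D \<inter> \<zeta> -` regular) (induced_H \<Phi> (l1 - \<mu> * (l1 - l0)) l1 \<circ> \<zeta>) W (\<lambda>z. \<mu> *\<^sub>C b z)"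
    if \<mu>: "\<mu> \<noteq> 0" and c: "(D, \<zeta>) \<in> \<A>" for \<mu> D \<zeta>
  proof -
    obtain A B where A: "lwr_potential D (log_derivative \<Phi> \<zeta>) A B" "lwr_chart D (\<lambda>l z. \<Phi> l (\<zeta> z)) A B"
      using c by (rule frame_chart)
    let ?D = "D \<inter> \<zeta> -` regular" and ?F = "\<lambda>l z. \<Phi> l (\<zeta> z)"
    interpret lwr_chart D ?F A B by (rule A(2))
    have A_nz: "A z \<noteq> 0" if "z \<in> ?D" for z
      using that unfolding regular_chart[OF c A] by blast
    have comp: "induced_E \<Phi> a b \<circ> \<zeta> = induced_E ?F a b" "induced_H \<Phi> a b \<circ> \<zeta> = induced_H ?F a b" for a b
      by (simp_all add: fun_eq_iff induced_E_def induced_H_def)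
    have ne: "l0 \<noteq> l0 + \<mu> * (l1 - l0)" "l1 - \<mu> * (l1 - l0) \<noteq> l1"
      using \<mu> assms(3) by simp_all
    have e: "(l0 + \<mu> * (l1 - l0) - l0) *\<^sub>C x = \<mu> *\<^sub>C ((l1 - l0) *\<^sub>C x)"
      "(l1 - (l1 - \<mu> * (l1 - l0))) *\<^sub>C x = \<mu> *\<^sub>C ((l1 - l0) *\<^sub>C x)" for x
      by (simp_all add: cscale_distrib)
    note D = regular_open_chart[OF c] Int_lower1 A_nz
    show "\<exists>V W b. null_surface Euclidean ?D (induced_E \<Phi> l0 l1 \<circ> \<zeta>) V b \<and>
        null_surface Euclidean ?D (induced_E \<Phi> l0 (l0 + \<mu> * (l1 - l0)) \<circ> \<zeta>) W (\<lambda>z. \<mu> *\<^sub>C b z)"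
      using null_surface_euclidean[OF D assms(3)] null_surface_euclidean[OF D ne(1)]
      unfolding comp e by blast
    show "\<exists>V W b. null_surface Hyperbolic ?D (induced_H \<Phi> l0 l1 \<circ> \<zeta>) V b \<and>
        null_surface Hyperbolic ?D (induced_H \<Phi> (l1 - \<mu> * (l1 - l0)) l1 \<circ> \<zeta>) W (\<lambda>z. \<mu> *\<^sub>C b z)"
      using null_surface_hyperbolic[OF D assms(3)] null_surface_hyperbolic[OF D ne(2)]
      unfolding comp e by blast
  qed
  show ?thesis
    unfolding Let_def
    using associated_family[OF _ E] associated_family[OF _ H] by (intro conjI allI impI) blast+
qed

end
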